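(* Let $\epsilon,\delta>0$, and let $0<t<1/(162kg)$. Let $H=\mathrm{i}\sum_P\lambda_PP$ be a $k$-local Hamiltonian on $n$ qubits with $\|\lambda\|_{B_1}\le g$ and $\|\lambda\|_\infty\le1$. Then there exists an algorithm, given access to real-time evolution $e^{-\mathrm{i}Ht}$ under the unknown $H$, that finds estimates $\widehat\lambda$ such that $\|\widehat\lambda-\lambda\|_\infty\le\epsilon$ with probability at least $1-\delta$ using total evolution time $t_{\mathrm{total}}=\mathcal{O}(g\log(n/\delta)/\epsilon^2)$.
   Context: $P$ ranges over $n$-qubit Pauli matrices in $\{I,X,Y,Z\}^{\otimes n}$; $\mathrm{supp}(P)$ is the set of qubits on which $P$ is not the identity. The coefficients $\lambda_P$ are purely imaginary, so that $H=\mathrm{i}\sum_P\lambda_PP$ is Hermitian. $H$ is $k$-local if $\lambda_P=0$ whenever $|\mathrm{supp}(P)|>k$. $\|\lambda\|_{B_1}=\max_{i\in[n]}\sum_{P:\mathrm{supp}(P)\ni i}|\lambda_P|$ and $\|\lambda\|_\infty=\max_P|\lambda_P|$. Access model: the ability to evolve under $e^{-\mathrm{i}Ht}$ for a chosen time $t>0$; the total evolution time $t_{\mathrm{total}}$ is the sum of the evolution times over all applications. This is structure learning: the algorithm does not know which coefficients $\lambda_P$ are nonzero. As throughout the paper, the locality $k$ is treated as a constant inside $\mathcal{O}(\cdot)$.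
   Formalization: The coefficient of the identity string, which only gives a global phase and cannot be learned, is taken as 0 in the target λ; and log(n/δ) is read as max(1, log(n/δ)), since the literal bound is negative for δ > n. *)

theory Defs
  imports
    "HOL-Probability.Probability"
    "Jordan_Normal_Form.Schur_Decomposition"
begin

section \<open>Pauli strings and Hamiltonians\<close>

definition kron :: "complex mat \<Rightarrow> complex mat \<Rightarrow> complex mat" where
  "kron A B = Matrix.mat (dim_row A * dim_row B) (dim_col A * dim_col B)
     (\<lambda>(i, j). A $$ (i div dim_row B, j div dim_col B) * B $$ (i mod dim_row B, j mod dim_col B))"

datatype pauli = PI | PX | PY | PZ

fun sigma :: "pauli \<Rightarrow> complex mat" where
  "sigma PI = 1\<^sub>m 2"
| "sigma PX = mat_of_rows_list 2 [[0, 1], [1, 0]]"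
| "sigma PY = mat_of_rows_list 2 [[0, - \<i>], [\<i>, 0]]"
| "sigma PZ = mat_of_rows_list 2 [[1, 0], [0, - 1]]"

definition pauli_strings :: "nat \<Rightarrow> pauli list set" where
  "pauli_strings n = {P. length P = n}"

fun pauli_mat :: "pauli list \<Rightarrow> complex mat" where
  "pauli_mat [] = 1\<^sub>m 1"
| "pauli_mat (p # P) = kron (sigma p) (pauli_mat P)"

definition supp :: "pauli list \<Rightarrow> nat set" where
  "supp P = {i. i < length P \<and> P ! i \<noteq> PI}"

text \<open>A coefficient family is a function on Pauli strings; on \<open>n\<close> qubits only its values on
  \<^term>\<open>pauli_strings n\<close> matter.\<close>

definition hamiltonian :: "nat \<Rightarrow> (pauli list \<Rightarrow> complex) \<Rightarrow> complex mat" where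
  "hamiltonian n l = Matrix.mat (2 ^ n) (2 ^ n)
     (\<lambda>(i, j). \<i> * (\<Sum>P\<in>pauli_strings n. l P * pauli_mat P $$ (i, j)))"

definition purely_imaginary :: "nat \<Rightarrow> (pauli list \<Rightarrow> complex) \<Rightarrow> bool" where
  "purely_imaginary n l \<longleftrightarrow> (\<forall>P\<in>pauli_strings n. Re (l P) = 0)"

definition k_local :: "nat \<Rightarrow> nat \<Rightarrow> (pauli list \<Rightarrow> complex) \<Rightarrow> bool" where
  "k_local k n l \<longleftrightarrow> (\<forall>P\<in>pauli_strings n. card (supp P) > k \<longrightarrow> l P = 0)"

text \<open>Used for \<open>n \<ge> 1\<close> only: for \<open>n = 0\<close> the maximum is over the empty set.\<close>

definition norm_B1 :: "nat \<Rightarrow> (pauli list \<Rightarrow> complex) \<Rightarrow> real" where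
  "norm_B1 n l = (MAX i\<in>{..<n}. \<Sum>P | P \<in> pauli_strings n \<and> i \<in> supp P. cmod (l P))"

definition norm_inf :: "nat \<Rightarrow> (pauli list \<Rightarrow> complex) \<Rightarrow> real" where
  "norm_inf n l = (MAX P\<in>pauli_strings n. cmod (l P))"

text \<open>The coefficient of the identity string only contributes a global phase to the evolution. No
  experiment can detect it, so it is estimated by convention as zero: the target of learning is the
  coefficient family of the traceless part of the Hamiltonian.\<close>

definition traceless_part :: "nat \<Rightarrow> (pauli list \<Rightarrow> complex) \<Rightarrow> pauli list \<Rightarrow> complex" where
  "traceless_part n l = l(replicate n PI := 0)"

section \<open>Time evolution\<close>

text \<open>The matrix exponential of a square matrix, with the power series taken entrywise.\<close>

definition mat_exp :: "complex mat \<Rightarrow> complex mat" where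
  "mat_exp A = Matrix.mat (dim_row A) (dim_row A) (\<lambda>(i, j). \<Sum>m. (A ^\<^sub>m m) $$ (i, j) / fact m)"

definition evolution :: "complex mat \<Rightarrow> real \<Rightarrow> complex mat" where
  "evolution H s = mat_exp ((- \<i> * complex_of_real s) \<cdot>\<^sub>m H)"

section \<open>Adaptive quantum algorithms with access to the time evolution\<close>

text \<open>An algorithm acts on the \<open>n\<close> system qubits together with \<open>a\<close> ancilla qubits, i.e. on a space
  of dimension \<open>d = 2 ^ (n + a)\<close>, and starts in the first computational basis state. It may apply
  unitaries that do not depend on the Hamiltonian, evolve the system qubits under the unknown
  Hamiltonian, and measure all qubits in the computational basis, after which it continues from the
  observed basis state in a way that depends on the outcome. Repeated experiments with fresh
  preparations and classical randomness are both obtained from measurements followed by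
  outcome-dependent unitaries.\<close>

datatype 'r qalg =
    Output 'r
  | Apply "complex mat" "'r qalg"
  | Evolve real "'r qalg"
  | Measure "nat \<Rightarrow> 'r qalg"

primrec legal :: "nat \<Rightarrow> 'r qalg \<Rightarrow> bool" where
  "legal d (Output r) \<longleftrightarrow> True"
| "legal d (Apply U A) \<longleftrightarrow> U \<in> carrier_mat d d \<and> U * mat_adjoint U = 1\<^sub>m d \<and> legal d A"
| "legal d (Evolve s A) \<longleftrightarrow> s > 0 \<and> legal d A"
| "legal d (Measure f) \<longleftrightarrow> (\<forall>j<d. legal d (f j))"

primrec evolution_times :: "nat \<Rightarrow> 'r qalg \<Rightarrow> real set" where
  "evolution_times d (Output r) = {}"
| "evolution_times d (Apply U A) = evolution_times d A"
| "evolution_times d (Evolve s A) = insert s (evolution_times d A)"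
| "evolution_times d (Measure f) = (\<Union>j<d. evolution_times d (f j))"

text \<open>The total evolution time is the worst case over all sequences of measurement outcomes.\<close>

primrec total_time :: "nat \<Rightarrow> 'r qalg \<Rightarrow> real" where
  "total_time d (Output r) = 0"
| "total_time d (Apply U A) = total_time d A"
| "total_time d (Evolve s A) = s + total_time d A"
| "total_time d (Measure f) = (MAX j\<in>{..<d}. total_time d (f j))"

text \<open>The Born rule for a unit vector; the function given to \<^const>\<open>embed_pmf\<close> is a probability mass
  function exactly if \<open>v\<close> is normalised, which legal algorithms preserve.\<close>

definition born :: "complex Matrix.vec \<Rightarrow> nat pmf" where
  "born v = embed_pmf (\<lambda>j. if j < dim_vec v then (cmod (vec_index v j))\<^sup>2 else 0)"

primrec run :: "complex mat \<Rightarrow> nat \<Rightarrow> 'r qalg \<Rightarrow> complex Matrix.vec \<Rightarrow> 'r pmf" where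
  "run H a (Output r) v = return_pmf r"
| "run H a (Apply U A) v = run H a A (U *\<^sub>v v)"
| "run H a (Evolve s A) v = run H a A (kron (evolution H s) (1\<^sub>m (2 ^ a)) *\<^sub>v v)"
| "run H a (Measure f) v = bind_pmf (born v) (\<lambda>j. run H a (f j) (unit_vec (dim_vec v) j))"

definition result :: "nat \<Rightarrow> nat \<Rightarrow> complex mat \<Rightarrow> 'r qalg \<Rightarrow> 'r pmf" where
  "result n a H A = run H a A (unit_vec (2 ^ (n + a)) 0)"

end

theory Submission
  imports Defs
begin

text \<open>
  Concatenating evolutions of duration \<open>t\<close> gives access to \<open>U = evolution H T\<close> with \<open>T\<close> between
  \<open>1 / (324 k g)\<close> and \<open>1 / (162 k g)\<close>. For every Pauli string \<open>P\<close> of weight at most \<open>k\<close> choose Pauli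
  strings \<open>Q\<close> and \<open>S\<close> with \<open>Q S = P\<close> up to a phase, \<open>S\<close> supported on a single qubit and
  anticommuting with \<open>P\<close>. The normalised trace \<open>F\<^sub>P\<close> of \<open>Q U S U\<^sup>*\<close> is the correlation between a random
  product eigenstate that is prepared and the outcome of a product measurement, so that a single
  data set from random product bases estimates all \<open>F\<^sub>P\<close> at once, with a loss that depends only on \<open>k\<close>;
  Hoeffding's inequality and a union bound over \<open>(4n)\<^sup>k\<close> strings give the logarithm.

  In the Pauli basis the commutator with \<open>H\<close> is a kernel \<open>M\<close> whose entry at \<open>(R, S)\<close> is the coefficient
  of \<open>R S\<close> times a commutator phase, and \<open>F\<^sub>P\<close> is the sum of \<open>T\<^sup>m (M\<^sup>m)(Q, S) / m!\<close>. In the difference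
  of two such powers one factor is the difference of coefficients, bounded by its maximum \<open>d\<close> and
  determined by its neighbours; the factors to its left are summed starting from \<open>Q\<close>, those to its right
  starting from \<open>S\<close>, and each costs only \<open>2 g\<close> times the current weight. Hence all terms with \<open>m \<ge> 2\<close>
  contribute at most \<open>2 d T / 80\<close>, while the term \<open>m = 1\<close> is \<open>2 d T\<close> for the string with the largest
  difference. So \<open>F\<close> determines the coefficients up to the factor \<open>1 / T\<close> in the maximum norm, and any
  admissible family compatible with the data is an accurate estimate.
\<close>

section \<open>Powers and exponentials of local kernels\<close>

text \<open>Since the support is unknown, the difference of two Hamiltonians is controlled only in
  the maximum norm; bounding it through a sum over all candidate strings would cost a power of n.
  This forces the summation from both ends, and it needs light ends: Q has weight at most k and S
  weight one. Weights grow by at most k per factor, so the two sums produce factorials whose product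
  is at most (m - 1)!, and the m positions of the difference complete m!, which is exactly what the
  exponential divides by. What remains is geometric with ratio 2 g k T. The bound T \<le> 1 / (162 k
  g) makes this ratio at most 1/81, whence the 1/80 of the tail.

  The map F is never inverted: a Lipschitz bound for its inverse suffices, because the estimator
  merely selects a family that fits the data.

  T also needs a lower bound. The signal has size T, so about 1 / (\<epsilon> T)^2 experiments of
  length T are needed, in total 1 / (\<epsilon>^2 T), which has order g / \<epsilon>^2 only if T has
  order 1 / g. This is why short evolutions are concatenated.\<close>

primrec ker_pow :: "'a set \<Rightarrow> ('a \<Rightarrow> 'a \<Rightarrow> complex) \<Rightarrow> nat \<Rightarrow> 'a \<Rightarrow> 'a \<Rightarrow> complex" where
  "ker_pow X M 0 R S = (if R = S then 1 else 0)"
| "ker_pow X M (Suc m) R S = (\<Sum>V\<in>X. M R V * ker_pow X M m V S)"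

lemma ker_pow_Suc_right:
  assumes "finite X" "R \<in> X" "S \<in> X"
  shows "ker_pow X M (Suc m) R S = (\<Sum>V\<in>X. ker_pow X M m R V * M V S)"
  using assms(2)
proof (induction m arbitrary: R)
  case 0
  have "(\<Sum>V\<in>X. M R V * (if V = S then 1 else 0)) = (\<Sum>V\<in>X. if V = S then M R V else 0)"
    by (intro sum.cong) auto
  moreover have "(\<Sum>V\<in>X. (if R = V then 1 else 0) * M V S) = (\<Sum>V\<in>X. if R = V then M V S else 0)"
    by (intro sum.cong) auto
  ultimately show ?case using assms 0 by (simp add: sum.delta sum.delta')
next
  case (Suc m)
  have "ker_pow X M (Suc (Suc m)) R S = (\<Sum>W\<in>X. M R W * ker_pow X M (Suc m) W S)" by simp
  also have "\<dots> = (\<Sum>W\<in>X. M R W * (\<Sum>V\<in>X. ker_pow X M m W V * M V S))"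
    using Suc.IH by (intro sum.cong) (simp_all del: ker_pow.simps)
  also have "\<dots> = (\<Sum>W\<in>X. \<Sum>V\<in>X. M R W * ker_pow X M m W V * M V S)"
    by (simp add: sum_distrib_left mult.assoc)
  also have "\<dots> = (\<Sum>V\<in>X. \<Sum>W\<in>X. M R W * ker_pow X M m W V * M V S)"
    by (rule sum.swap)
  also have "\<dots> = (\<Sum>V\<in>X. ker_pow X M (Suc m) R V * M V S)"
    by (simp add: sum_distrib_right)
  finally show ?case .
qed

lemma ker_pow_transpose:
  assumes "finite X" "R \<in> X" "S \<in> X"
  shows "ker_pow X (\<lambda>V W. M W V) m S R = ker_pow X M m R S"
  using assms(3)
proof (induction m arbitrary: S)
  case (Suc m)
  have "ker_pow X (\<lambda>V W. M W V) (Suc m) S R = (\<Sum>V\<in>X. M V S * ker_pow X M m R V)"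
    using Suc by simp
  also have "\<dots> = ker_pow X M (Suc m) R S"
    using ker_pow_Suc_right[OF assms(1,2) Suc.prems] by (simp add: mult.commute del: ker_pow.simps)
  finally show ?case .
qed simp

text \<open>Telescoping for noncommuting factors, with all powers of A to the left of the difference
  and all powers of B to its right. This lets the left powers be summed along a row from R and the
  right powers along a column into S.\<close>

lemma ker_pow_diff:
  assumes "finite X" "R \<in> X" "S \<in> X"
  shows "ker_pow X A m R S - ker_pow X B m R S =
    (\<Sum>j<m. \<Sum>V\<in>X. \<Sum>W\<in>X. ker_pow X A (m - 1 - j) R V * (A V W - B V W) * ker_pow X B j W S)"
  using assms(2)
proof (induction m arbitrary: R)
  case (Suc m)
  let ?t = "\<lambda>p j R. \<Sum>V\<in>X. \<Sum>W\<in>X. ker_pow X A p R V * (A V W - B V W) * ker_pow X B j W S"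
  have step: "(\<Sum>U\<in>X. A R U * ?t p j U) = ?t (Suc p) j R" for p j
  proof -
    have "(\<Sum>U\<in>X. A R U * ?t p j U) =
      (\<Sum>U\<in>X. \<Sum>V\<in>X. A R U * (\<Sum>W\<in>X. ker_pow X A p U V * (A V W - B V W) * ker_pow X B j W S))"
      by (simp add: sum_distrib_left)
    also have "\<dots> = (\<Sum>V\<in>X. \<Sum>U\<in>X. A R U * (\<Sum>W\<in>X. ker_pow X A p U V * (A V W - B V W) * ker_pow X B j W S))"
      by (rule sum.swap)
    also have "\<dots> = (\<Sum>V\<in>X. \<Sum>U\<in>X. A R U * ker_pow X A p U V * (\<Sum>W\<in>X. (A V W - B V W) * ker_pow X B j W S))"
      by (simp add: sum_distrib_left mult.assoc)
    also have "\<dots> = (\<Sum>V\<in>X. ker_pow X A (Suc p) R V * (\<Sum>W\<in>X. (A V W - B V W) * ker_pow X B j W S))"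
      by (simp add: sum_distrib_right)
    also have "\<dots> = ?t (Suc p) j R"
      by (simp only: sum_distrib_left mult.assoc)
    finally show ?thesis .
  qed
  have last: "?t 0 m R = (\<Sum>W\<in>X. (A R W - B R W) * ker_pow X B m W S)"
  proof -
    have "?t 0 m R = (\<Sum>V\<in>X. if V = R then (\<Sum>W\<in>X. (A V W - B V W) * ker_pow X B m W S) else 0)"
      by (intro sum.cong) auto
    then show ?thesis using assms Suc.prems by (simp add: sum.delta)
  qed
  have "ker_pow X A (Suc m) R S - ker_pow X B (Suc m) R S =
    (\<Sum>U\<in>X. A R U * (ker_pow X A m U S - ker_pow X B m U S)) + (\<Sum>W\<in>X. (A R W - B R W) * ker_pow X B m W S)"
    by (simp add: sum_subtractf[symmetric] sum.distrib[symmetric] algebra_simps)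
  also have "(\<Sum>U\<in>X. A R U * (ker_pow X A m U S - ker_pow X B m U S)) =
     (\<Sum>U\<in>X. A R U * (\<Sum>j<m. ?t (m - 1 - j) j U))"
    using Suc.IH by (intro sum.cong) auto
  also have "\<dots> = (\<Sum>U\<in>X. \<Sum>j<m. A R U * ?t (m - 1 - j) j U)"
    by (subst sum_distrib_left) simp
  also have "\<dots> = (\<Sum>j<m. \<Sum>U\<in>X. A R U * ?t (m - 1 - j) j U)"
    by (rule sum.swap)
  also have "\<dots> = (\<Sum>j<m. ?t (Suc m - 1 - j) j R)"
  proof (rule sum.cong[OF refl])
    fix j assume "j \<in> {..<m}"
    \<comment> \<open>Natural subtraction does not truncate here because j < m.\<close>
    then have "Suc m - 1 - j = Suc (m - 1 - j)" by auto
    then show "(\<Sum>U\<in>X. A R U * ?t (m - 1 - j) j U) = ?t (Suc m - 1 - j) j R" by (simp only: step)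
  qed
  finally show ?case using last by simp
qed simp

text \<open>Splitting off the rightmost factor costs c times the weight of S, at most c k q, and
  leads to columns of weight at most k (q + 1). Iteration gives (c k)^m q (q + 1) ... (q + m - 1),
  hence the Pochhammer symbol. The induction needs general q; the application has q = 1, where the
  symbol is m!.\<close>

lemma ker_pow_column_sum:
  fixes sz :: "'a \<Rightarrow> nat" and c :: real
  assumes fin: "finite X" and c: "c \<ge> 0"
    and col: "\<And>S. S \<in> X \<Longrightarrow> (\<Sum>R\<in>X. cmod (M R S)) \<le> c * sz S"
    and grow: "\<And>R S. R \<in> X \<Longrightarrow> S \<in> X \<Longrightarrow> M R S \<noteq> 0 \<Longrightarrow> sz R \<le> sz S + k"
    and S: "S \<in> X" "sz S \<le> k * q"
  shows "(\<Sum>R\<in>X. cmod (ker_pow X M m R S)) \<le> (c * k) ^ m * pochhammer (real q) m"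
  using S
proof (induction m arbitrary: S q)
  case 0
  have "(\<Sum>R\<in>X. cmod (if R = S then 1 else 0)) = (\<Sum>R\<in>X. if R = S then 1 else 0)"
    by (intro sum.cong) auto
  with 0 fin show ?case by simp
next
  case (Suc m)
  have "(\<Sum>R\<in>X. cmod (ker_pow X M (Suc m) R S)) \<le> (\<Sum>R\<in>X. \<Sum>V\<in>X. cmod (ker_pow X M m R V) * cmod (M V S))"
    using ker_pow_Suc_right[OF fin _ Suc.prems(1), of _ M m]
    by (intro sum_mono) (simp del: ker_pow.simps, intro order_trans[OF norm_sum] sum_mono, simp add: norm_mult)
  also have "\<dots> = (\<Sum>V\<in>X. cmod (M V S) * (\<Sum>R\<in>X. cmod (ker_pow X M m R V)))"
    by (subst sum.swap) (simp add: sum_distrib_left mult.commute)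
  also have "\<dots> \<le> (\<Sum>V\<in>X. cmod (M V S) * ((c * k) ^ m * pochhammer (real (Suc q)) m))"
  proof (intro sum_mono)
    fix V assume V: "V \<in> X"
    show "cmod (M V S) * (\<Sum>R\<in>X. cmod (ker_pow X M m R V)) \<le> cmod (M V S) * ((c * k) ^ m * pochhammer (real (Suc q)) m)"
    proof (cases "M V S = 0")
      case False
      then have "sz V \<le> k * Suc q" using grow[OF V Suc.prems(1)] Suc.prems(2) by simp
      with Suc.IH[OF V, of "Suc q"] show ?thesis by (intro mult_left_mono) auto
    qed simp
  qed
  also have "\<dots> = (\<Sum>V\<in>X. cmod (M V S)) * ((c * k) ^ m * pochhammer (real (Suc q)) m)"
    by (simp add: sum_distrib_right)
  also have "\<dots> \<le> (c * (k * q)) * ((c * k) ^ m * pochhammer (real (Suc q)) m)"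
  proof (intro mult_right_mono)
    have "(\<Sum>V\<in>X. cmod (M V S)) \<le> c * sz S" using col Suc.prems by simp
    also have "real (sz S) \<le> real (k * q)" using Suc.prems by (simp only: of_nat_le_iff)
    finally show "(\<Sum>V\<in>X. cmod (M V S)) \<le> c * (k * q)" using c by (simp add: mult_left_mono)
    have "pochhammer (real (Suc q)) m \<ge> 0" using pochhammer_pos[of "real (Suc q)" m] by simp
    then show "0 \<le> (c * k) ^ m * pochhammer (real (Suc q)) m" using c by simp
  qed
  also have "\<dots> = (c * k) ^ Suc m * pochhammer (real q) (Suc m)"
    by (simp add: pochhammer_rec algebra_simps)
  finally show ?case .
qed

text \<open>Rows and columns are treated alike so that the condition passes to the transposed kernel
  and the row bound follows from the column bound.\<close>

definition local_kernel :: "'a set \<Rightarrow> ('a \<Rightarrow> nat) \<Rightarrow> nat \<Rightarrow> real \<Rightarrow> ('a \<Rightarrow> 'a \<Rightarrow> complex) \<Rightarrow> bool" where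
  "local_kernel X sz k c M \<longleftrightarrow>
    (\<forall>S\<in>X. (\<Sum>R\<in>X. cmod (M R S)) \<le> c * sz S) \<and> (\<forall>R\<in>X. (\<Sum>S\<in>X. cmod (M R S)) \<le> c * sz R) \<and>
    (\<forall>R\<in>X. \<forall>S\<in>X. M R S \<noteq> 0 \<longrightarrow> sz R \<le> sz S + k \<and> sz S \<le> sz R + k)"

lemma local_kernel_column_sum:
  assumes "finite X" "c \<ge> 0" "local_kernel X sz k c M" "S \<in> X" "sz S \<le> k"
  shows "(\<Sum>R\<in>X. cmod (ker_pow X M m R S)) \<le> (c * k) ^ m * fact m"
  using ker_pow_column_sum[of X c M sz k S 1 m] assms
  by (simp add: local_kernel_def pochhammer_fact)

lemma local_kernel_row_sum:
  assumes "finite X" "c \<ge> 0" "local_kernel X sz k c M" "R \<in> X" "sz R \<le> k"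
  shows "(\<Sum>S\<in>X. cmod (ker_pow X M m R S)) \<le> (c * k) ^ m * fact m"
proof -
  have "local_kernel X sz k c (\<lambda>V W. M W V)" using assms(3) by (auto simp: local_kernel_def)
  from local_kernel_column_sum[OF assms(1,2) this assms(4,5), of m]
  show ?thesis using ker_pow_transpose[OF assms(1,4), of _ M m] by simp
qed

text \<open>The middle factor is at most e whatever V and W are, so the double sum splits into a row
  sum starting in Q and a column sum ending in S. Their factorials satisfy (m - j)! j! \<le> m!, and
  the m + 1 values of j complete (m + 1)!.\<close>

lemma local_kernel_pow_diff:
  assumes fin: "finite X" and c: "c \<ge> 0" and AB: "local_kernel X sz k c A" "local_kernel X sz k c B"
    and close: "\<And>V W. V \<in> X \<Longrightarrow> W \<in> X \<Longrightarrow> cmod (A V W - B V W) \<le> e"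
    and Q: "Q \<in> X" "sz Q \<le> k" and S: "S \<in> X" "sz S \<le> k"
  shows "cmod (ker_pow X A (Suc m) Q S - ker_pow X B (Suc m) Q S) \<le> e * (c * k) ^ m * fact (Suc m)"
proof -
  have e: "e \<ge> 0" using close[OF Q(1) Q(1)] norm_ge_zero order_trans by blast
  let ?t = "\<lambda>j V W. ker_pow X A (m - j) Q V * (A V W - B V W) * ker_pow X B j W S"
  have bound: "cmod (\<Sum>V\<in>X. \<Sum>W\<in>X. ?t j V W) \<le> e * (c * k) ^ m * fact m" if j: "j \<le> m" for j
  proof -
    have "cmod (\<Sum>V\<in>X. \<Sum>W\<in>X. ?t j V W) \<le> (\<Sum>V\<in>X. \<Sum>W\<in>X. cmod (?t j V W))"
      by (intro order_trans[OF norm_sum] sum_mono norm_sum)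
    also have "\<dots> \<le> (\<Sum>V\<in>X. \<Sum>W\<in>X. cmod (ker_pow X A (m - j) Q V) * e * cmod (ker_pow X B j W S))"
      using close by (intro sum_mono) (simp add: norm_mult mult_left_mono mult_right_mono)
    also have "\<dots> = e * (\<Sum>V\<in>X. cmod (ker_pow X A (m - j) Q V)) * (\<Sum>W\<in>X. cmod (ker_pow X B j W S))"
      by (simp add: sum_product sum_distrib_left sum_distrib_right mult_ac)
    also have "\<dots> \<le> e * ((c * k) ^ (m - j) * fact (m - j)) * ((c * k) ^ j * fact j)"
      using e c local_kernel_row_sum[OF fin c AB(1) Q] local_kernel_column_sum[OF fin c AB(2) S]
      by (intro mult_mono) (auto intro!: sum_nonneg mult_nonneg_nonneg)
    also have "\<dots> = e * (c * k) ^ m * (fact j * fact (m - j))"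
      using j by (simp add: power_add[symmetric] mult_ac)
    also have "\<dots> \<le> e * (c * k) ^ m * fact m"
    proof (intro mult_left_mono)
      have "fact j * fact (m - j) * (m choose j) = (fact m :: nat)" using j by (rule binomial_fact_lemma)
      moreover have "(m choose j) \<ge> 1" using j by (simp add: Suc_leI)
      ultimately have "fact j * fact (m - j) \<le> (fact m :: nat)"
        by (metis mult.right_neutral mult_le_mono2)
      then show "fact j * fact (m - j) \<le> (fact m :: real)"
        by (metis of_nat_fact of_nat_le_iff of_nat_mult)
    qed (use e c in auto)
    finally show ?thesis .
  qed
  have "cmod (ker_pow X A (Suc m) Q S - ker_pow X B (Suc m) Q S) = cmod (\<Sum>j<Suc m. \<Sum>V\<in>X. \<Sum>W\<in>X. ?t j V W)"
    by (subst ker_pow_diff[OF fin Q(1) S(1)]) simp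
  also have "\<dots> \<le> (\<Sum>j<Suc m. e * (c * k) ^ m * fact m)"
    by (rule order_trans[OF norm_sum], rule sum_mono, rule bound) simp
  also have "\<dots> = e * (c * k) ^ m * fact (Suc m)" by simp
  finally show ?thesis .
qed

definition ker_exp :: "'a set \<Rightarrow> ('a \<Rightarrow> 'a \<Rightarrow> complex) \<Rightarrow> real \<Rightarrow> 'a \<Rightarrow> 'a \<Rightarrow> complex" where
  "ker_exp X M T R S = (\<Sum>m. of_real T ^ m * ker_pow X M m R S / fact m)"

lemma summable_ker_exp:
  assumes fin: "finite X" and c: "c \<ge> 0" and M: "local_kernel X sz k c M" and T: "T \<ge> 0" "c * k * T < 1"
    and Q: "Q \<in> X" "sz Q \<le> k" and S: "S \<in> X"
  shows "summable (\<lambda>m. of_real T ^ m * ker_pow X M m Q S / fact m)"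
proof (rule summable_comparison_test')
  show "summable (\<lambda>m. (c * k * T) ^ m)" using c T by (intro summable_geometric) auto
  fix m :: nat
  have "cmod (ker_pow X M m Q S) \<le> (\<Sum>S\<in>X. cmod (ker_pow X M m Q S))"
    using S fin by (intro member_le_sum) auto
  also have "\<dots> \<le> (c * k) ^ m * fact m" by (rule local_kernel_row_sum[OF fin c M Q])
  finally have "cmod (ker_pow X M m Q S) / fact m \<le> (c * k) ^ m" by (simp add: divide_le_eq)
  from mult_left_mono[OF this, of "T ^ m"] T(1)
  show "norm (of_real T ^ m * ker_pow X M m Q S / fact m) \<le> (c * k * T) ^ m"
    by (simp add: norm_mult norm_divide norm_power power_mult_distrib mult_ac)
qed

text \<open>The terms m = 0 of both series agree and the terms m = 1 give the linear part. From m =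
  2 on the factorial in \<open>local_kernel_pow_diff\<close> cancels, which leaves a geometric
  series of ratio c k T.\<close>

lemma ker_exp_diff:
  assumes fin: "finite X" and c: "c \<ge> 0" and AB: "local_kernel X sz k c A" "local_kernel X sz k c B"
    and close: "\<And>V W. V \<in> X \<Longrightarrow> W \<in> X \<Longrightarrow> cmod (A V W - B V W) \<le> e"
    and T: "T \<ge> 0" "c * k * T < 1"
    and Q: "Q \<in> X" "sz Q \<le> k" and S: "S \<in> X" "sz S \<le> k"
  shows "cmod (ker_exp X A T Q S - ker_exp X B T Q S - T * (A Q S - B Q S))
    \<le> e * T * (c * k * T) / (1 - c * k * T)"
proof -
  let ?x = "c * k * T"
  define f where "f m = of_real T ^ m * ker_pow X A m Q S / fact m - of_real T ^ m * ker_pow X B m Q S / fact m" for m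
  have one: "ker_pow X M (Suc 0) Q S = M Q S" for M
  proof -
    have "(\<Sum>V\<in>X. M Q V * (if V = S then 1 else 0)) = (\<Sum>V\<in>X. if V = S then M Q V else 0)"
      by (intro sum.cong) auto
    then show ?thesis using fin S by (simp add: sum.delta)
  qed
  have sums: "f sums (ker_exp X A T Q S - ker_exp X B T Q S)"
    unfolding f_def ker_exp_def
    by (intro sums_diff summable_sums summable_ker_exp[OF fin c AB(1) T Q S(1)]
        summable_ker_exp[OF fin c AB(2) T Q S(1)])
  have "(\<lambda>m. f (m + 2)) sums (ker_exp X A T Q S - ker_exp X B T Q S - (\<Sum>m<2. f m))"
    using sums sums_iff_shift[of f 2] by simp
  moreover have "(\<Sum>m<2. f m) = T * (A Q S - B Q S)"
    by (simp add: numeral_2_eq_2 f_def one algebra_simps del: ker_pow.simps(2))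
  ultimately have tail: "(\<lambda>m. f (m + 2)) sums (ker_exp X A T Q S - ker_exp X B T Q S - T * (A Q S - B Q S))"
    by simp
  have bound: "cmod (f (m + 2)) \<le> e * T * ?x * ?x ^ m" for m
  proof -
    have "cmod (f (m + 2)) = T ^ (m + 2) * (cmod (ker_pow X A (Suc (Suc m)) Q S - ker_pow X B (Suc (Suc m)) Q S) / fact (m + 2))"
      unfolding f_def using T(1)
      by (simp add: diff_divide_distrib[symmetric] right_diff_distrib[symmetric] norm_mult norm_divide norm_power
          del: ker_pow.simps fact_Suc)
    also have "\<dots> \<le> T ^ (m + 2) * (e * (c * k) ^ (Suc m))"
      using local_kernel_pow_diff[OF fin c AB close Q S, of "Suc m"] T(1)
      by (intro mult_left_mono) (simp_all add: divide_le_eq del: ker_pow.simps fact_Suc)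
    also have "\<dots> = e * T * ?x * ?x ^ m" by (simp add: power_mult_distrib mult_ac)
    finally show ?thesis .
  qed
  have geo: "(\<lambda>m. e * T * ?x * ?x ^ m) sums (e * T * ?x * (1 / (1 - ?x)))"
    using c T by (intro sums_mult geometric_sums) auto
  have "cmod (\<Sum>m. f (m + 2)) \<le> (\<Sum>m. e * T * ?x * ?x ^ m)"
    using bound geo by (intro norm_suminf_le) (auto simp: sums_iff)
  then show ?thesis using sums_unique[OF tail] sums_unique[OF geo] by simp
qed

section \<open>The matrix exponential\<close>

lemma mat_adjoint_carrier [simp, intro]: "A \<in> carrier_mat m n \<Longrightarrow> mat_adjoint A \<in> carrier_mat n m"
  by (auto simp: mat_adjoint_def)

lemma dim_mat_adjoint [simp]: "dim_row (mat_adjoint A) = dim_col A" "dim_col (mat_adjoint A) = dim_row A"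
  by (simp_all add: mat_adjoint_def)

lemma index_mat_adjoint [simp]:
  fixes A :: "complex mat"
  shows "i < dim_col A \<Longrightarrow> j < dim_row A \<Longrightarrow> mat_adjoint A $$ (i, j) = cnj (A $$ (j, i))"
  by (auto simp: mat_adjoint_def mat_of_rows_index)

lemma mat_adjoint_times:
  fixes A B :: "complex mat"
  assumes "A \<in> carrier_mat l m" "B \<in> carrier_mat m n"
  shows "mat_adjoint (A * B) = mat_adjoint B * mat_adjoint A"
proof (rule eq_matI)
  have [simp]: "mat_adjoint B \<in> carrier_mat n m" "mat_adjoint A \<in> carrier_mat m l" using assms by auto
  note carrier_matD[OF this(1), simp] carrier_matD[OF this(2), simp] carrier_matD[OF assms(1), simp] carrier_matD[OF assms(2), simp]
  fix i j assume "i < dim_row (mat_adjoint B * mat_adjoint A)" "j < dim_col (mat_adjoint B * mat_adjoint A)"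
  then show "mat_adjoint (A * B) $$ (i, j) = (mat_adjoint B * mat_adjoint A) $$ (i, j)"
    by (simp add: scalar_prod_def mult.commute)
qed (use assms in auto)

lemma mat_adjoint_adjoint [simp]:
  fixes A :: "complex mat"
  shows "mat_adjoint (mat_adjoint A) = A"
  by (rule eq_matI) simp_all

lemma mat_exp_carrier [simp, intro]: "A \<in> carrier_mat d d \<Longrightarrow> mat_exp A \<in> carrier_mat d d"
  by (auto simp: mat_exp_def)

lemma pow_mat_Suc_left:
  fixes A :: "complex mat"
  assumes A: "A \<in> carrier_mat d d"
  shows "A ^\<^sub>m Suc m = A * A ^\<^sub>m m"
proof (induction m)
  case (Suc m)
  have "A ^\<^sub>m m \<in> carrier_mat d d" using A by auto
  from assoc_mult_mat[OF A this A] show ?case using Suc by simp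
qed (use A in simp)

lemma pow_mat_entry_bound:
  fixes A :: "complex mat"
  assumes A: "A \<in> carrier_mat d d" and a: "\<And>i j. i < d \<Longrightarrow> j < d \<Longrightarrow> cmod (A $$ (i, j)) \<le> a"
    and "i < d" "j < d"
  shows "cmod ((A ^\<^sub>m m) $$ (i, j)) \<le> (d * a) ^ m"
  using assms(3,4)
proof (induction m arbitrary: i j)
  case (Suc m)
  have c: "A ^\<^sub>m m \<in> carrier_mat d d" using A by auto
  have a0: "a \<ge> 0" using a[OF Suc.prems(1) Suc.prems(1)] norm_ge_zero order_trans by blast
  have "(A ^\<^sub>m Suc m) $$ (i, j) = (\<Sum>k<d. (A ^\<^sub>m m) $$ (i, k) * A $$ (k, j))"
    using A c Suc.prems by (simp add: scalar_prod_def atLeast0LessThan)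
  also have "cmod \<dots> \<le> (\<Sum>k<d. (d * a) ^ m * a)"
    using Suc a0 a by (intro order_trans[OF norm_sum] sum_mono) (simp add: norm_mult mult_mono)
  also have "\<dots> = (d * a) ^ Suc m" by simp
  finally show ?case .
qed (use A in auto)

text \<open>Comparison with the series of exp (d a). Absolute convergence is what the Cauchy product
  in \<open>mat_exp_sandwich\<close> requires.\<close>

lemma mat_exp_entry_abs_summable:
  assumes A: "A \<in> carrier_mat d d" and ij: "i < d" "j < d"
  shows "summable (\<lambda>m. cmod ((A ^\<^sub>m m) $$ (i, j) / fact m))"
proof -
  define a where "a = (\<Sum>k<d. \<Sum>l<d. cmod (A $$ (k, l)))"
  have a: "cmod (A $$ (k, l)) \<le> a" if "k < d" "l < d" for k l
  proof -
    have "cmod (A $$ (k, l)) \<le> (\<Sum>l<d. cmod (A $$ (k, l)))" using that by (intro member_le_sum) auto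
    also have "\<dots> \<le> a" unfolding a_def using that by (intro member_le_sum[where f = "\<lambda>k. \<Sum>l<d. cmod (A $$ (k, l))"]) (auto intro: sum_nonneg)
    finally show ?thesis .
  qed
  show ?thesis
  proof (rule summable_comparison_test')
    show "summable (\<lambda>m. (d * a) ^ m / fact m)" using summable_exp[of "d * a"] by (simp add: divide_inverse mult.commute)
    show "norm (cmod ((A ^\<^sub>m m) $$ (i, j) / fact m)) \<le> (d * a) ^ m / fact m" for m
      using pow_mat_entry_bound[OF A a ij, of m] by (simp add: norm_divide divide_right_mono)
  qed
qed

text \<open>Pascal's rule in the shape of a Leibniz rule: the step from m to m + 1 raises either the
  left or the right exponent.\<close>

lemma binomial_sum_Suc:
  fixes G :: "nat \<Rightarrow> nat \<Rightarrow> 'b::comm_semiring_1"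
  shows "(\<Sum>p\<le>Suc m. of_nat (Suc m choose p) * G p (Suc m - p)) =
    (\<Sum>p\<le>m. of_nat (m choose p) * (G (Suc p) (m - p) + G p (Suc (m - p))))"
proof -
  have "(\<Sum>p\<le>Suc m. of_nat (Suc m choose p) * G p (Suc m - p)) =
    G 0 (Suc m) + (\<Sum>p\<le>m. of_nat ((m choose p) + (m choose Suc p)) * G (Suc p) (m - p))"
    by (subst sum.atMost_Suc_shift) (simp del: of_nat_add)
  also have "\<dots> = (\<Sum>p\<le>m. of_nat (m choose p) * G (Suc p) (m - p)) +
     (G 0 (Suc m) + (\<Sum>p\<le>m. of_nat (m choose Suc p) * G (Suc p) (m - p)))"
    by (simp add: sum.distrib algebra_simps)
  also have "G 0 (Suc m) + (\<Sum>p\<le>m. of_nat (m choose Suc p) * G (Suc p) (m - p)) =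
     (\<Sum>p\<le>Suc m. of_nat (m choose p) * G p (Suc m - p))"
    by (subst sum.atMost_Suc_shift) simp
  also have "\<dots> = (\<Sum>p\<le>m. of_nat (m choose p) * G p (Suc (m - p)))"
    by (simp add: Suc_diff_le binomial_eq_0)
  finally show ?thesis by (simp add: sum.distrib algebra_simps)
qed

lemma mult3_mat_entry:
  fixes A X B :: "complex mat"
  assumes "A \<in> carrier_mat d d" "X \<in> carrier_mat d d" "B \<in> carrier_mat d d" "i < d" "j < d"
  shows "(A * X * B) $$ (i, j) = (\<Sum>l<d. \<Sum>k<d. A $$ (i, k) * X $$ (k, l) * B $$ (l, j))"
proof -
  have "(A * X * B) $$ (i, j) = (\<Sum>l<d. (A * X) $$ (i, l) * B $$ (l, j))"
    using assms by (simp add: scalar_prod_def atLeast0LessThan del: assoc_mult_mat)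
  also have "\<dots> = (\<Sum>l<d. \<Sum>k<d. A $$ (i, k) * X $$ (k, l) * B $$ (l, j))"
    using assms by (simp add: scalar_prod_def sum_distrib_right atLeast0LessThan)
  finally show ?thesis .
qed

text \<open>With \<open>B = - A\<close> the sequence \<open>N\<close> consists of the iterated commutators of \<open>A\<close> with \<open>X\<close>.\<close>

lemma mat_exp_sandwich:
  assumes A: "A \<in> carrier_mat d d" and X: "X \<in> carrier_mat d d" and B: "B \<in> carrier_mat d d"
    and N: "\<And>m. N m \<in> carrier_mat d d" "N 0 = X" "\<And>m. N (Suc m) = A * N m + N m * B"
    and ij: "i < d" "j < d"
  shows "(\<lambda>m. N m $$ (i, j) / fact m) sums ((mat_exp A * X * mat_exp B) $$ (i, j))"
proof -
  have pA: "A ^\<^sub>m p \<in> carrier_mat d d" and pB: "B ^\<^sub>m p \<in> carrier_mat d d" for p using A B by auto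
  define G where "G i j p q = (A ^\<^sub>m p * X * B ^\<^sub>m q) $$ (i, j)" for i j p q
  \<comment> \<open>Left multiplication by A and right multiplication by B commute, so the binomial
    formula holds for their sum.\<close>
  have N_eq: "N m $$ (i, j) = (\<Sum>p\<le>m. of_nat (m choose p) * G i j p (m - p))" if "i < d" "j < d" for m i j
    using that
  proof (induction m arbitrary: i j)
    case 0
    then show ?case using X A B N(2) by (simp add: G_def)
  next
    case (Suc m)
    have GA: "(\<Sum>k<d. A $$ (i, k) * G k j p q) = G i j (Suc p) q" for p q
    proof -
      have c: "A ^\<^sub>m p * X * B ^\<^sub>m q \<in> carrier_mat d d"
        by (rule mult_carrier_mat[OF mult_carrier_mat[OF pA X] pB])
      have "A ^\<^sub>m Suc p * X * B ^\<^sub>m q = A * (A ^\<^sub>m p * X * B ^\<^sub>m q)"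
        unfolding pow_mat_Suc_left[OF A]
        using assoc_mult_mat[OF A pA[of p] X] assoc_mult_mat[OF A mult_carrier_mat[OF pA[of p] X] pB[of q]] by simp
      then show ?thesis unfolding G_def using A carrier_matD[OF c] Suc.prems by (simp add: scalar_prod_def atLeast0LessThan)
    qed
    have GB: "(\<Sum>k<d. G i k p q * B $$ (k, j)) = G i j p (Suc q)" for p q
    proof -
      have c: "A ^\<^sub>m p * X * B ^\<^sub>m q \<in> carrier_mat d d"
        by (rule mult_carrier_mat[OF mult_carrier_mat[OF pA X] pB])
      have "A ^\<^sub>m p * X * B ^\<^sub>m Suc q = A ^\<^sub>m p * X * B ^\<^sub>m q * B"
        using assoc_mult_mat[OF mult_carrier_mat[OF pA[of p] X] pB[of q] B] by simp
      then show ?thesis unfolding G_def using B carrier_matD[OF c] Suc.prems by (simp add: scalar_prod_def atLeast0LessThan)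
    qed
    have "N (Suc m) $$ (i, j) = (\<Sum>k<d. A $$ (i, k) * N m $$ (k, j)) + (\<Sum>k<d. N m $$ (i, k) * B $$ (k, j))"
      using A B N(1)[of m] Suc.prems by (simp add: N(3) scalar_prod_def atLeast0LessThan)
    also have "(\<Sum>k<d. A $$ (i, k) * N m $$ (k, j)) = (\<Sum>p\<le>m. of_nat (m choose p) * (\<Sum>k<d. A $$ (i, k) * G k j p (m - p)))"
      using Suc by (simp add: sum_distrib_left mult_ac) (rule sum.swap)
    also have "(\<Sum>k<d. N m $$ (i, k) * B $$ (k, j)) = (\<Sum>p\<le>m. of_nat (m choose p) * (\<Sum>k<d. G i k p (m - p) * B $$ (k, j)))"
      using Suc by (simp add: sum_distrib_left sum_distrib_right mult_ac) (rule sum.swap)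
    finally show ?case unfolding GA GB binomial_sum_Suc
      by (simp add: sum.distrib distrib_left)
  qed
  let ?a = "\<lambda>k p. (A ^\<^sub>m p) $$ (i, k) / fact p" and ?b = "\<lambda>l q. (B ^\<^sub>m q) $$ (l, j) / fact q"
  have eA: "mat_exp A $$ (i, k) = (\<Sum>p. ?a k p)" if "k < d" for k using A ij that by (simp add: mat_exp_def)
  have eB: "mat_exp B $$ (l, j) = (\<Sum>p. ?b l p)" if "l < d" for l using B ij that by (simp add: mat_exp_def)
  \<comment> \<open>Each entry is a finite combination of products of two absolutely convergent
    series; the Cauchy product groups them by total degree m.\<close>
  have "(\<lambda>m. \<Sum>l<d. \<Sum>k<d. X $$ (k, l) * (\<Sum>p\<le>m. ?a k p * ?b l (m - p))) sums
    (\<Sum>l<d. \<Sum>k<d. X $$ (k, l) * (mat_exp A $$ (i, k) * mat_exp B $$ (l, j)))"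
  proof (intro sums_sum sums_mult)
    fix l k assume "l \<in> {..<d}" "k \<in> {..<d}"
    then have lk: "l < d" "k < d" by auto
    show "(\<lambda>m. \<Sum>p\<le>m. ?a k p * ?b l (m - p)) sums (mat_exp A $$ (i, k) * mat_exp B $$ (l, j))"
      unfolding eA[OF lk(2)] eB[OF lk(1)]
      by (rule Cauchy_product_sums[OF mat_exp_entry_abs_summable[OF A ij(1) lk(2)] mat_exp_entry_abs_summable[OF B lk(1) ij(2)]])
  qed
  moreover have "(\<Sum>l<d. \<Sum>k<d. X $$ (k, l) * (mat_exp A $$ (i, k) * mat_exp B $$ (l, j))) = (mat_exp A * X * mat_exp B) $$ (i, j)"
    using A B X ij by (subst mult3_mat_entry[where d = d]) (auto simp: mult_ac)
  moreover have "(\<Sum>l<d. \<Sum>k<d. X $$ (k, l) * (\<Sum>p\<le>m. ?a k p * ?b l (m - p))) = N m $$ (i, j) / fact m" for m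
  proof -
    have "(\<Sum>l<d. \<Sum>k<d. X $$ (k, l) * (\<Sum>p\<le>m. ?a k p * ?b l (m - p))) =
      (\<Sum>l<d. \<Sum>k<d. \<Sum>p\<le>m. X $$ (k, l) * (?a k p * ?b l (m - p)))" by (simp add: sum_distrib_left)
    also have "\<dots> = (\<Sum>l<d. \<Sum>p\<le>m. \<Sum>k<d. X $$ (k, l) * (?a k p * ?b l (m - p)))"
      by (intro sum.cong refl sum.swap)
    also have "\<dots> = (\<Sum>p\<le>m. \<Sum>l<d. \<Sum>k<d. X $$ (k, l) * (?a k p * ?b l (m - p)))"
      by (rule sum.swap)
    also have "\<dots> = (\<Sum>p\<le>m. G i j p (m - p) / (fact p * fact (m - p)))"
      unfolding G_def using pA pB X ij
      by (intro sum.cong refl, subst mult3_mat_entry[where d = d])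
         (auto simp: sum_divide_distrib mult_ac intro!: sum.cong)
    also have "\<dots> = (\<Sum>p\<le>m. of_nat (m choose p) * G i j p (m - p)) / fact m"
      unfolding sum_divide_distrib
      by (intro sum.cong refl) (simp add: binomial_fact field_simps)
    finally show ?thesis using N_eq[OF ij] by simp
  qed
  ultimately show ?thesis by simp
qed

text \<open>The sandwich around the identity matrix with B = - A: the first commutator vanishes, so
  only the term m = 0 survives.\<close>

lemma mat_exp_inverse:
  assumes A: "A \<in> carrier_mat d d"
  shows "mat_exp A * mat_exp (- A) = 1\<^sub>m d"
proof (rule eq_matI)
  have c: "mat_exp A \<in> carrier_mat d d" "mat_exp (- A) \<in> carrier_mat d d" using A by auto
  then show "dim_row (mat_exp A * mat_exp (- A)) = dim_row (1\<^sub>m d)" "dim_col (mat_exp A * mat_exp (- A)) = dim_col (1\<^sub>m d)" by auto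
  fix i j assume "i < dim_row (1\<^sub>m d :: complex mat)" "j < dim_col (1\<^sub>m d :: complex mat)"
  then have ij: "i < d" "j < d" by auto
  define N :: "nat \<Rightarrow> complex mat" where "N m = (if m = 0 then 1\<^sub>m d else 0\<^sub>m d d)" for m
  have "(\<lambda>m. N m $$ (i, j) / fact m) sums ((mat_exp A * 1\<^sub>m d * mat_exp (- A)) $$ (i, j))"
    using A by (intro mat_exp_sandwich[OF A _ _ _ _ _ ij]) (auto simp: N_def intro!: eq_matI)
  moreover have "(\<lambda>m. N m $$ (i, j) / fact m) sums (\<Sum>m\<in>{0}. N m $$ (i, j) / fact m)"
    using ij by (intro sums_finite) (auto simp: N_def)
  ultimately have "(mat_exp A * 1\<^sub>m d * mat_exp (- A)) $$ (i, j) = N 0 $$ (i, j)"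
    by (auto dest: sums_unique2)
  then show "(mat_exp A * mat_exp (- A)) $$ (i, j) = 1\<^sub>m d $$ (i, j)"
    using right_mult_one_mat[OF c(1)] by (simp add: N_def)
qed

lemma pow_mat_smult:
  fixes A :: "complex mat"
  assumes "A \<in> carrier_mat d d"
  shows "(c \<cdot>\<^sub>m A) ^\<^sub>m m = (c ^ m) \<cdot>\<^sub>m (A ^\<^sub>m m)"
proof (induction m)
  case (Suc m)
  have "A ^\<^sub>m m \<in> carrier_mat d d" using assms by auto
  then show ?case using Suc assms
    by (auto intro!: eq_matI simp: mult_smult_assoc_mat[where nr = d and n = d and nc = d] mult_smult_distrib[where nr = d and n = d and nc = d] mult_ac)
qed (use assms in \<open>auto intro!: eq_matI\<close>)

text \<open>Again the sandwich around the identity matrix. Multiples of A commute, so its iterates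
  are the powers of (a + b) A.\<close>

lemma mat_exp_add:
  assumes A: "A \<in> carrier_mat d d"
  shows "mat_exp (a \<cdot>\<^sub>m A) * mat_exp (b \<cdot>\<^sub>m A) = mat_exp ((a + b) \<cdot>\<^sub>m A)"
proof (rule eq_matI)
  have c: "mat_exp (a \<cdot>\<^sub>m A) \<in> carrier_mat d d" "mat_exp (b \<cdot>\<^sub>m A) \<in> carrier_mat d d" "mat_exp ((a + b) \<cdot>\<^sub>m A) \<in> carrier_mat d d"
    using A by auto
  then show "dim_row (mat_exp (a \<cdot>\<^sub>m A) * mat_exp (b \<cdot>\<^sub>m A)) = dim_row (mat_exp ((a + b) \<cdot>\<^sub>m A))"
    "dim_col (mat_exp (a \<cdot>\<^sub>m A) * mat_exp (b \<cdot>\<^sub>m A)) = dim_col (mat_exp ((a + b) \<cdot>\<^sub>m A))" by auto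
  fix i j assume "i < dim_row (mat_exp ((a + b) \<cdot>\<^sub>m A))" "j < dim_col (mat_exp ((a + b) \<cdot>\<^sub>m A))"
  then have ij: "i < d" "j < d" using c by auto
  define N where "N m = (a + b) ^ m \<cdot>\<^sub>m (A ^\<^sub>m m)" for m
  have p: "A ^\<^sub>m m \<in> carrier_mat d d" for m using A by auto
  have "(\<lambda>m. N m $$ (i, j) / fact m) sums ((mat_exp (a \<cdot>\<^sub>m A) * 1\<^sub>m d * mat_exp (b \<cdot>\<^sub>m A)) $$ (i, j))"
  proof (rule mat_exp_sandwich[OF _ _ _ _ _ _ ij])
    show "N m \<in> carrier_mat d d" for m using p by (auto simp: N_def)
    show "N 0 = 1\<^sub>m d" using A by (auto simp: N_def)
    fix m
    have smult: "a \<cdot>\<^sub>m (c \<cdot>\<^sub>m Y) + c \<cdot>\<^sub>m (b \<cdot>\<^sub>m Y) = ((a + b) * c) \<cdot>\<^sub>m Y" for c and Y :: "complex mat"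
      by (rule eq_matI) (auto simp: algebra_simps)
    have "a \<cdot>\<^sub>m A * N m = a \<cdot>\<^sub>m ((a + b) ^ m \<cdot>\<^sub>m (A ^\<^sub>m Suc m))"
      unfolding N_def pow_mat_Suc_left[OF A] mult_smult_assoc_mat[OF A smult_carrier_mat[OF p]] mult_smult_distrib[OF A p] ..
    moreover have "N m * (b \<cdot>\<^sub>m A) = (a + b) ^ m \<cdot>\<^sub>m (b \<cdot>\<^sub>m (A ^\<^sub>m Suc m))"
      unfolding N_def pow_mat.simps mult_smult_assoc_mat[OF p smult_carrier_mat[OF A]] mult_smult_distrib[OF p A] ..
    ultimately show "N (Suc m) = a \<cdot>\<^sub>m A * N m + N m * (b \<cdot>\<^sub>m A)"
      by (simp only: N_def smult power_Suc)
  qed (use A in auto)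
  moreover have "(\<lambda>m. N m $$ (i, j) / fact m) = (\<lambda>m. (((a + b) \<cdot>\<^sub>m A) ^\<^sub>m m) $$ (i, j) / fact m)"
    by (simp add: N_def pow_mat_smult[OF A])
  ultimately have "mat_exp ((a + b) \<cdot>\<^sub>m A) $$ (i, j) = (mat_exp (a \<cdot>\<^sub>m A) * 1\<^sub>m d * mat_exp (b \<cdot>\<^sub>m A)) $$ (i, j)"
    using ij A by (simp add: mat_exp_def sums_iff)
  then show "(mat_exp (a \<cdot>\<^sub>m A) * mat_exp (b \<cdot>\<^sub>m A)) $$ (i, j) = mat_exp ((a + b) \<cdot>\<^sub>m A) $$ (i, j)"
    using right_mult_one_mat[OF c(1)] by simp
qed

lemma mat_adjoint_one [simp]: "mat_adjoint (1\<^sub>m d :: complex mat) = 1\<^sub>m d"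
  by (rule eq_matI) auto

lemma mat_adjoint_pow:
  fixes A :: "complex mat"
  assumes A: "A \<in> carrier_mat d d"
  shows "mat_adjoint (A ^\<^sub>m m) = mat_adjoint A ^\<^sub>m m"
proof (induction m)
  case 0
  then show ?case using A carrier_matD[OF mat_adjoint_carrier[OF A]] by simp
next
  case (Suc m)
  have "A ^\<^sub>m m \<in> carrier_mat d d" using A by auto
  from mat_adjoint_times[OF this A] Suc show ?case
    by (simp only: pow_mat.simps(2) pow_mat_Suc_left[OF mat_adjoint_carrier[OF A], symmetric])
qed

lemma mat_adjoint_exp:
  assumes A: "A \<in> carrier_mat d d"
  shows "mat_adjoint (mat_exp A) = mat_exp (mat_adjoint A)"
proof (rule eq_matI)
  have c: "mat_adjoint (mat_exp A) \<in> carrier_mat d d" "mat_exp (mat_adjoint A) \<in> carrier_mat d d" using A by auto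
  then show "dim_row (mat_adjoint (mat_exp A)) = dim_row (mat_exp (mat_adjoint A))"
    "dim_col (mat_adjoint (mat_exp A)) = dim_col (mat_exp (mat_adjoint A))" by auto
  fix i j assume "i < dim_row (mat_exp (mat_adjoint A))" "j < dim_col (mat_exp (mat_adjoint A))"
  then have ij: "i < d" "j < d" using c by auto
  have p: "A ^\<^sub>m m \<in> carrier_mat d d" for m using A by auto
  have "summable (\<lambda>m. (A ^\<^sub>m m) $$ (j, i) / fact m)"
    using mat_exp_entry_abs_summable[OF A ij(2,1)] by (rule summable_norm_cancel)
  then have "(\<lambda>m. cnj ((A ^\<^sub>m m) $$ (j, i) / fact m)) sums cnj (\<Sum>m. (A ^\<^sub>m m) $$ (j, i) / fact m)"
    by (simp add: sums_cnj summable_sums del: complex_cnj_divide)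
  moreover have "cnj ((A ^\<^sub>m m) $$ (j, i) / fact m) = (mat_adjoint A ^\<^sub>m m) $$ (i, j) / fact m" for m
    using ij carrier_matD[OF p[of m]] by (simp add: mat_adjoint_pow[OF A, symmetric])
  ultimately show "mat_adjoint (mat_exp A) $$ (i, j) = mat_exp (mat_adjoint A) $$ (i, j)"
    using ij A carrier_matD[OF mat_adjoint_carrier[OF A]] by (simp add: mat_exp_def sums_iff)
qed

section \<open>Kronecker products and Pauli strings\<close>

text \<open>Quotient and remainder by p identify the index range of a Kronecker product with pairs
  of indices of the factors; products and traces of Kronecker products are split this way.\<close>

lemma sum_div_mod:
  fixes f :: "nat \<Rightarrow> nat \<Rightarrow> 'b::comm_monoid_add"
  shows "(\<Sum>k<m * p. f (k div p) (k mod p)) = (\<Sum>a<m. \<Sum>b<p. f a b)"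
proof (cases "p = 0")
  case False
  have lt: "b + a * p < m * p" if "a < m" "b < p" for a b
  proof -
    have "b + a * p < Suc a * p" using that by simp
    also have "\<dots> \<le> m * p" using that by (intro mult_right_mono) auto
    finally show ?thesis .
  qed
  have "(\<Sum>k<m * p. f (k div p) (k mod p)) = (\<Sum>(a, b)\<in>{..<m} \<times> {..<p}. f a b)"
    using False
    by (intro sum.reindex_bij_witness[where i = "\<lambda>(a, b). b + a * p" and j = "\<lambda>k. (k div p, k mod p)"])
       (auto simp: less_mult_imp_div_less lt)
  then show ?thesis by (simp add: sum.cartesian_product)
qed simp

lemma kron_carrier [simp, intro]:
  "A \<in> carrier_mat m n \<Longrightarrow> B \<in> carrier_mat p q \<Longrightarrow> kron A B \<in> carrier_mat (m * p) (n * q)"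
  by (auto simp: kron_def)

lemma dim_kron [simp]: "dim_row (kron A B) = dim_row A * dim_row B" "dim_col (kron A B) = dim_col A * dim_col B"
  by (auto simp: kron_def)

lemma index_kron:
  "i < dim_row A * dim_row B \<Longrightarrow> j < dim_col A * dim_col B \<Longrightarrow>
    kron A B $$ (i, j) = A $$ (i div dim_row B, j div dim_col B) * B $$ (i mod dim_row B, j mod dim_col B)"
  by (auto simp: kron_def)

lemma kron_mult:
  assumes "A \<in> carrier_mat m n" "B \<in> carrier_mat p q" "C \<in> carrier_mat n r" "D \<in> carrier_mat q s"
  shows "kron A B * kron C D = kron (A * C) (B * D)"
proof (rule eq_matI)
  note d [simp] = carrier_matD[OF assms(1)] carrier_matD[OF assms(2)] carrier_matD[OF assms(3)] carrier_matD[OF assms(4)]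
  fix i j assume "i < dim_row (kron (A * C) (B * D))" "j < dim_col (kron (A * C) (B * D))"
  then have i: "i < m * p" and j: "j < r * s" by auto
  have p: "p > 0" and s: "s > 0" using i j by (auto intro: Nat.gr0I)
  have ij: "i div p < m" "i mod p < p" "j div s < r" "j mod s < s"
    using i j p s by (auto simp: less_mult_imp_div_less)
  have "(kron A B * kron C D) $$ (i, j) = (\<Sum>k<n * q. kron A B $$ (i, k) * kron C D $$ (k, j))"
    using i j by (simp add: scalar_prod_def atLeast0LessThan)
  also have "\<dots> = (\<Sum>k<n * q. (\<lambda>a b. A $$ (i div p, a) * C $$ (a, j div s) * (B $$ (i mod p, b) * D $$ (b, j mod s))) (k div q) (k mod q))"
    using i j by (intro sum.cong) (auto simp: index_kron mult_ac)
  also have "\<dots> = (\<Sum>a<n. \<Sum>b<q. A $$ (i div p, a) * C $$ (a, j div s) * (B $$ (i mod p, b) * D $$ (b, j mod s)))"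
    by (rule sum_div_mod)
  also have "\<dots> = (A * C) $$ (i div p, j div s) * (B * D) $$ (i mod p, j mod s)"
    using ij by (simp add: scalar_prod_def atLeast0LessThan sum_product)
  also have "\<dots> = kron (A * C) (B * D) $$ (i, j)" using i j by (simp add: index_kron)
  finally show "(kron A B * kron C D) $$ (i, j) = kron (A * C) (B * D) $$ (i, j)" .
qed (use assms in auto)

lemma kron_one [simp]: "kron (1\<^sub>m a) (1\<^sub>m b) = 1\<^sub>m (a * b)"
proof (rule eq_matI)
  fix i j assume "i < dim_row (1\<^sub>m (a * b) :: complex mat)" "j < dim_col (1\<^sub>m (a * b) :: complex mat)"
  then have ij: "i < a * b" "j < a * b" by auto
  then have b: "b > 0" by (auto intro: Nat.gr0I)
  have "i = j \<longleftrightarrow> i div b = j div b \<and> i mod b = j mod b" by (metis div_mult_mod_eq)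
  then show "kron (1\<^sub>m a) (1\<^sub>m b) $$ (i, j) = 1\<^sub>m (a * b) $$ (i, j)"
    using ij b by (auto simp: index_kron less_mult_imp_div_less)
qed auto

lemma kron_one_right [simp]: "kron A (1\<^sub>m (Suc 0)) = A"
  by (rule eq_matI) (auto simp: index_kron)

lemma kron_smult: "kron (a \<cdot>\<^sub>m A) (b \<cdot>\<^sub>m B) = (a * b) \<cdot>\<^sub>m kron A B"
proof (rule eq_matI)
  fix i j assume "i < dim_row ((a * b) \<cdot>\<^sub>m kron A B)" "j < dim_col ((a * b) \<cdot>\<^sub>m kron A B)"
  then have ij: "i < dim_row A * dim_row B" "j < dim_col A * dim_col B" by auto
  then have "dim_row B > 0" "dim_col B > 0" by (auto intro: Nat.gr0I)
  then show "kron (a \<cdot>\<^sub>m A) (b \<cdot>\<^sub>m B) $$ (i, j) = ((a * b) \<cdot>\<^sub>m kron A B) $$ (i, j)"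
    using ij by (simp add: index_kron less_mult_imp_div_less)
qed auto

primrec tensor :: "complex mat list \<Rightarrow> complex mat" where
  "tensor [] = 1\<^sub>m 1"
| "tensor (A # As) = kron A (tensor As)"

lemma pauli_mat_eq_tensor: "pauli_mat P = tensor (map sigma P)"
  by (induction P) auto

lemma tensor_carrier: "set As \<subseteq> carrier_mat 2 2 \<Longrightarrow> tensor As \<in> carrier_mat (2 ^ length As) (2 ^ length As)"
  by (induction As) auto

section \<open>Multiplication and commutation of Pauli strings\<close>

fun pauli_mult :: "pauli \<Rightarrow> pauli \<Rightarrow> pauli" where
  "pauli_mult PI q = q"
| "pauli_mult p PI = p"
| "pauli_mult PX PX = PI" | "pauli_mult PX PY = PZ" | "pauli_mult PX PZ = PY"
| "pauli_mult PY PX = PZ" | "pauli_mult PY PY = PI" | "pauli_mult PY PZ = PX"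
| "pauli_mult PZ PX = PY" | "pauli_mult PZ PY = PX" | "pauli_mult PZ PZ = PI"

text \<open>The cocycle that belongs to \<open>pauli_mult\<close>: i along the cycle X, Y, Z and - i
  against it.\<close>

fun pauli_phase :: "pauli \<Rightarrow> pauli \<Rightarrow> complex" where
  "pauli_phase PX PY = \<i>" | "pauli_phase PY PX = - \<i>"
| "pauli_phase PY PZ = \<i>" | "pauli_phase PZ PY = - \<i>"
| "pauli_phase PZ PX = \<i>" | "pauli_phase PX PZ = - \<i>"
| "pauli_phase p q = 1"

lemma sigma_carrier [simp, intro]: "sigma p \<in> carrier_mat 2 2"
  by (cases p) (auto simp: mat_of_rows_list_def)

lemma dim_sigma [simp]: "dim_row (sigma p) = 2" "dim_col (sigma p) = 2"
  using carrier_matD[OF sigma_carrier] by auto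

lemma less_2_iff: "i < (2::nat) \<longleftrightarrow> i = 0 \<or> i = Suc 0" by auto

lemma eq_mat_2I:
  assumes "A \<in> carrier_mat 2 2" "B \<in> carrier_mat 2 2"
    "A $$ (0, 0) = B $$ (0, 0)" "A $$ (0, 1) = B $$ (0, 1)" "A $$ (1, 0) = B $$ (1, 0)" "A $$ (1, 1) = B $$ (1, 1)"
  shows "A = B"
  using assms by (intro eq_matI) (auto simp: less_2_iff)

lemma index_mult_mat_2:
  fixes A B :: "complex mat"
  assumes "A \<in> carrier_mat 2 2" "B \<in> carrier_mat 2 2" "i < 2" "j < 2"
  shows "(A * B) $$ (i, j) = A $$ (i, 0) * B $$ (0, j) + A $$ (i, 1) * B $$ (1, j)"
proof -
  have "(A * B) $$ (i, j) = (\<Sum>k<2. A $$ (i, k) * B $$ (k, j))"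
    using assms by (simp add: scalar_prod_def atLeast0LessThan)
  then show ?thesis by (simp add: numeral_2_eq_2)
qed

lemma sigma_mult: "sigma p * sigma q = pauli_phase p q \<cdot>\<^sub>m sigma (pauli_mult p q)"
proof (rule eq_mat_2I)
  show "sigma p * sigma q \<in> carrier_mat 2 2" by (rule mult_carrier_mat[OF sigma_carrier sigma_carrier])
qed (simp_all add: index_mult_mat_2 del: sigma.simps index_mult_mat(1); cases p; cases q; simp add: mat_of_rows_list_def)+

definition string_mult :: "pauli list \<Rightarrow> pauli list \<Rightarrow> pauli list" where
  "string_mult = map2 pauli_mult"

definition string_phase :: "pauli list \<Rightarrow> pauli list \<Rightarrow> complex" where
  "string_phase P Q = prod_list (map2 pauli_phase P Q)"

lemma pauli_mat_carrier [simp, intro]: "pauli_mat P \<in> carrier_mat (2 ^ length P) (2 ^ length P)"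
  using tensor_carrier[of "map sigma P"] by (auto simp: pauli_mat_eq_tensor)

lemma dim_pauli_mat [simp]: "dim_row (pauli_mat P) = 2 ^ length P" "dim_col (pauli_mat P) = 2 ^ length P"
  using carrier_matD[OF pauli_mat_carrier] by auto

lemma pauli_mat_mult:
  assumes "length P = length Q"
  shows "pauli_mat P * pauli_mat Q = string_phase P Q \<cdot>\<^sub>m pauli_mat (string_mult P Q)"
  using assms
proof (induction P Q rule: list_induct2)
  case (Cons p P q Q)
  have "pauli_mat P * pauli_mat Q = string_phase P Q \<cdot>\<^sub>m pauli_mat (string_mult P Q)" by (rule Cons.IH)
  moreover have "kron (sigma p) (pauli_mat P) * kron (sigma q) (pauli_mat Q) = kron (sigma p * sigma q) (pauli_mat P * pauli_mat Q)"
    using Cons.hyps pauli_mat_carrier[of P] pauli_mat_carrier[of Q]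
    by (intro kron_mult[OF sigma_carrier _ sigma_carrier]) auto
  ultimately show ?case
    by (simp add: sigma_mult kron_smult string_phase_def string_mult_def)
qed (auto simp: string_phase_def string_mult_def intro!: eq_matI)

lemma pauli_mat_hermitian:
  "i < 2 ^ length P \<Longrightarrow> j < 2 ^ length P \<Longrightarrow> cnj (pauli_mat P $$ (i, j)) = pauli_mat P $$ (j, i)"
proof (induction P arbitrary: i j)
  case (Cons p P)
  have s: "cnj (sigma p $$ (a, b)) = sigma p $$ (b, a)" if "a < 2" "b < 2" for a b
    using that by (cases p) (auto simp: less_2_iff mat_of_rows_list_def)
  show ?case using Cons.prems by (simp add: index_kron Cons.IH s less_mult_imp_div_less)
qed auto

lemma tensor_trace:
  assumes "set As \<subseteq> carrier_mat 2 2"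
  shows "(\<Sum>i<2 ^ length As. tensor As $$ (i, i)) = (\<Prod>A\<leftarrow>As. A $$ (0, 0) + A $$ (1, 1))"
  using assms
proof (induction As)
  case (Cons A As)
  have c: "tensor As \<in> carrier_mat (2 ^ length As) (2 ^ length As)" using Cons by (intro tensor_carrier) auto
  have A: "A \<in> carrier_mat 2 2" using Cons by auto
  have "(\<Sum>i<2 ^ length (A # As). tensor (A # As) $$ (i, i)) =
    (\<Sum>k<2 * 2 ^ length As. (\<lambda>a b. A $$ (a, a) * tensor As $$ (b, b)) (k div 2 ^ length As) (k mod 2 ^ length As))"
    using c A by (intro sum.cong) (auto simp: index_kron)
  also have "\<dots> = (\<Sum>a<2. \<Sum>b<2 ^ length As. A $$ (a, a) * tensor As $$ (b, b))"
    by (rule sum_div_mod)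
  also have "\<dots> = (\<Sum>a<2. A $$ (a, a)) * (\<Sum>b<2 ^ length As. tensor As $$ (b, b))"
    by (simp add: sum_product)
  finally show ?case using Cons by (simp add: numeral_2_eq_2)
qed simp

lemma pauli_mat_trace:
  "(\<Sum>i<2 ^ length P. pauli_mat P $$ (i, i)) = (if P = replicate (length P) PI then 2 ^ length P else 0)"
proof -
  have s: "sigma p $$ (0, 0) + sigma p $$ (Suc 0, Suc 0) = (if p = PI then 2 else 0)" for p
    by (cases p) (auto simp: mat_of_rows_list_def)
  have "(\<Sum>i<2 ^ length P. pauli_mat P $$ (i, i)) = (\<Prod>p\<leftarrow>P. if p = PI then 2 else 0)"
    using tensor_trace[of "map sigma P"] by (simp add: pauli_mat_eq_tensor comp_def s image_subset_iff)
  also have "\<dots> = (if P = replicate (length P) PI then 2 ^ length P else 0)"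
    by (induction P) auto
  finally show ?thesis .
qed

lemma pauli_mult_eq_PI [simp]: "pauli_mult p q = PI \<longleftrightarrow> p = q"
  by (cases p; cases q) auto

lemma pauli_phase_self [simp]: "pauli_phase p p = 1"
  by (cases p) auto

lemma string_mult_eq_identity:
  "length P = length Q \<Longrightarrow> string_mult P Q = replicate (length P) PI \<longleftrightarrow> P = Q"
  unfolding string_mult_def by (induction P Q rule: list_induct2) auto

lemma string_phase_self [simp]: "string_phase P P = 1"
  unfolding string_phase_def by (induction P) auto

lemma length_string_mult [simp]: "length (string_mult P Q) = min (length P) (length Q)"
  by (simp add: string_mult_def)

text \<open>The product is a phase times a string; this string is the identity only for P = Q, and
  every other string is traceless.\<close>

lemma pauli_mat_orthogonal:
  assumes "length P = length Q"
  shows "(\<Sum>i<2 ^ length P. (pauli_mat P * pauli_mat Q) $$ (i, i)) = (if P = Q then 2 ^ length P else 0)"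
proof -
  have "(\<Sum>i<2 ^ length P. (pauli_mat P * pauli_mat Q) $$ (i, i)) =
    string_phase P Q * (\<Sum>i<2 ^ length P. pauli_mat (string_mult P Q) $$ (i, i))"
    unfolding pauli_mat_mult[OF assms] using assms by (simp add: sum_distrib_left)
  also have "\<dots> = (if P = Q then 2 ^ length P else 0)"
    using pauli_mat_trace[of "string_mult P Q"] string_mult_eq_identity[OF assms] assms by simp
  finally show ?thesis .
qed

text \<open>As \<open>string_mult\<close> is commutative, the commutator of the two matrices is this
  number times the matrix of the product string.\<close>

definition commutator_phase :: "pauli list \<Rightarrow> pauli list \<Rightarrow> complex" where
  "commutator_phase P Q = string_phase P Q - string_phase Q P"

lemma cmod_string_phase: "cmod (string_phase P Q) = 1"
proof -
  have c: "cmod (pauli_phase p q) = 1" for p q by (cases p; cases q) auto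
  show ?thesis unfolding string_phase_def
  proof (induction P arbitrary: Q)
    case (Cons p P)
    then show ?case by (cases Q) (auto simp: norm_mult c)
  qed simp
qed

lemma cmod_commutator_phase: "cmod (commutator_phase P Q) \<le> 2"
  unfolding commutator_phase_def using norm_triangle_ineq4[of "string_phase P Q" "string_phase Q P"]
  by (simp add: cmod_string_phase)

lemma pauli_phase_swap: "p = PI \<or> q = PI \<or> p = q \<Longrightarrow> pauli_phase p q = pauli_phase q p"
  by (cases p; cases q) auto

lemma string_phase_commute:
  assumes "length P = length Q" "\<And>i. i < length P \<Longrightarrow> P ! i = PI \<or> Q ! i = PI \<or> P ! i = Q ! i"
  shows "string_phase P Q = string_phase Q P"
  using assms
proof (induction P Q rule: list_induct2)
  case (Cons p P q Q)
  have "string_phase P Q = string_phase Q P" using Cons.prems[of "Suc _"] by (intro Cons.IH) force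
  moreover have "pauli_phase p q = pauli_phase q p" using Cons.prems[of 0] by (auto intro: pauli_phase_swap)
  ultimately show ?case by (simp add: string_phase_def)
qed simp

lemma pauli_mult_cancel [simp]: "pauli_mult (pauli_mult p q) q = p" "pauli_mult p (pauli_mult p q) = q"
  by (cases p; cases q; simp)+

lemma pauli_mult_PI_right [simp]: "pauli_mult p PI = p" by (cases p) auto

lemma pauli_mult_commute: "pauli_mult p q = pauli_mult q p"
  by (cases p; cases q) auto

lemma nth_string_mult [simp]: "i < length P \<Longrightarrow> i < length Q \<Longrightarrow> string_mult P Q ! i = pauli_mult (P ! i) (Q ! i)"
  by (simp add: string_mult_def)

lemma string_mult_cancel: "length P = length Q \<Longrightarrow> string_mult (string_mult P Q) Q = P"
  by (rule nth_equalityI) auto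

lemma string_mult_cancel_left: "length P = length Q \<Longrightarrow> string_mult P (string_mult P Q) = Q"
  by (rule nth_equalityI) auto

lemma string_mult_commute: "length P = length Q \<Longrightarrow> string_mult P Q = string_mult Q P"
  by (rule nth_equalityI) (auto simp: pauli_mult_commute)

lemma finite_supp [simp, intro]: "finite (supp P)"
  by (auto simp: supp_def)

lemma finite_pauli_strings [simp, intro]: "finite (pauli_strings n)"
proof -
  have "finite (UNIV :: pauli set)" by (rule finite_subset[of _ "{PI, PX, PY, PZ}"]) (use pauli.exhaust in auto)
  from finite_lists_length_eq[OF this, of n] show ?thesis by (simp add: pauli_strings_def)
qed

lemma card_pauli_strings: "card (pauli_strings n) = 4 ^ n"
proof -
  have U: "(UNIV :: pauli set) = {PI, PX, PY, PZ}" using pauli.exhaust by auto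
  have "finite (UNIV :: pauli set)" "card (UNIV :: pauli set) = 4" unfolding U by simp_all
  with card_lists_length_eq[of "UNIV :: pauli set" n] show ?thesis by (simp add: pauli_strings_def)
qed

lemma supp_string_mult: "length P = length Q \<Longrightarrow> supp (string_mult P Q) \<subseteq> supp P \<union> supp Q"
  by (auto simp: supp_def)

section \<open>The Heisenberg picture in the Pauli basis\<close>

definition pauli_sum :: "nat \<Rightarrow> (pauli list \<Rightarrow> complex) \<Rightarrow> complex mat" where
  "pauli_sum n c = Matrix.mat (2 ^ n) (2 ^ n) (\<lambda>(i, j). \<Sum>P\<in>pauli_strings n. c P * pauli_mat P $$ (i, j))"

lemma pauli_sum_carrier [simp, intro]: "pauli_sum n c \<in> carrier_mat (2 ^ n) (2 ^ n)"
  by (auto simp: pauli_sum_def)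

lemma hamiltonian_eq_pauli_sum: "hamiltonian n l = pauli_sum n (\<lambda>P. \<i> * l P)"
  by (simp add: hamiltonian_def pauli_sum_def sum_distrib_left mult.assoc)

lemma hamiltonian_carrier [simp, intro]: "hamiltonian n l \<in> carrier_mat (2 ^ n) (2 ^ n)"
  by (simp add: hamiltonian_eq_pauli_sum)

lemma hamiltonian_hermitian:
  assumes "purely_imaginary n l"
  shows "mat_adjoint (hamiltonian n l) = hamiltonian n l"
proof (rule eq_matI)
  note d [simp] = carrier_matD[OF hamiltonian_carrier[of n l]]
  fix i j assume "i < dim_row (hamiltonian n l)" "j < dim_col (hamiltonian n l)"
  then have ij: "i < 2 ^ n" "j < 2 ^ n" by auto
  have re: "cnj (\<i> * l P) = \<i> * l P" if "P \<in> pauli_strings n" for P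
    using assms that by (auto simp: purely_imaginary_def complex_eq_iff)
  have "cnj (hamiltonian n l $$ (j, i)) = (\<Sum>P\<in>pauli_strings n. cnj (\<i> * l P) * cnj (pauli_mat P $$ (j, i)))"
    using ij by (simp add: hamiltonian_eq_pauli_sum pauli_sum_def del: complex_cnj_mult) simp
  also have "\<dots> = (\<Sum>P\<in>pauli_strings n. \<i> * l P * pauli_mat P $$ (i, j))"
    using ij by (intro sum.cong refl) (simp add: re pauli_mat_hermitian pauli_strings_def del: complex_cnj_mult)
  also have "\<dots> = hamiltonian n l $$ (i, j)" using ij by (simp add: hamiltonian_eq_pauli_sum pauli_sum_def)
  finally show "mat_adjoint (hamiltonian n l) $$ (i, j) = hamiltonian n l $$ (i, j)" using ij by simp
qed (simp_all add: carrier_matD[OF hamiltonian_carrier])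

lemma bij_string_mult: "S \<in> pauli_strings n \<Longrightarrow> bij_betw (\<lambda>P. string_mult P S) (pauli_strings n) (pauli_strings n)"
  by (rule bij_betwI[where g = "\<lambda>P. string_mult P S"]) (auto simp: pauli_strings_def string_mult_cancel)

lemma pauli_sum_mult_entry:
  assumes "i < 2 ^ n" "j < 2 ^ n"
  shows "(pauli_sum n a * pauli_sum n b) $$ (i, j) =
    (\<Sum>P\<in>pauli_strings n. \<Sum>S\<in>pauli_strings n. a P * b S * (pauli_mat P * pauli_mat S) $$ (i, j))"
proof -
  let ?X = "pauli_strings n"
  have "(pauli_sum n a * pauli_sum n b) $$ (i, j) = (\<Sum>k<2 ^ n. pauli_sum n a $$ (i, k) * pauli_sum n b $$ (k, j))"
    using assms carrier_matD[OF pauli_sum_carrier] by (simp add: scalar_prod_def atLeast0LessThan)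
  also have "\<dots> = (\<Sum>k<2 ^ n. \<Sum>P\<in>?X. \<Sum>S\<in>?X. a P * b S * (pauli_mat P $$ (i, k) * pauli_mat S $$ (k, j)))"
    using assms by (simp add: pauli_sum_def sum_product mult_ac)
  also have "\<dots> = (\<Sum>P\<in>?X. \<Sum>k<2 ^ n. \<Sum>S\<in>?X. a P * b S * (pauli_mat P $$ (i, k) * pauli_mat S $$ (k, j)))"
    by (rule sum.swap)
  also have "\<dots> = (\<Sum>P\<in>?X. \<Sum>S\<in>?X. \<Sum>k<2 ^ n. a P * b S * (pauli_mat P $$ (i, k) * pauli_mat S $$ (k, j)))"
    by (intro sum.cong refl sum.swap)
  also have "\<dots> = (\<Sum>P\<in>?X. \<Sum>S\<in>?X. a P * b S * (pauli_mat P * pauli_mat S) $$ (i, j))"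
    using assms by (intro sum.cong refl) (simp add: pauli_strings_def scalar_prod_def atLeast0LessThan sum_distrib_left)
  finally show ?thesis .
qed

text \<open>The only string that multiplies S to R is \<open>string_mult R S\<close>. The factor i
  in H cancels against the - i of the evolution, so no further constant appears.\<close>

definition pauli_kernel :: "(pauli list \<Rightarrow> complex) \<Rightarrow> pauli list \<Rightarrow> pauli list \<Rightarrow> complex" where
  "pauli_kernel l R S = l (string_mult R S) * commutator_phase (string_mult R S) S"

lemma hamiltonian_commutator:
  "- \<i> \<cdot>\<^sub>m (hamiltonian n l * pauli_sum n c - pauli_sum n c * hamiltonian n l) =
    pauli_sum n (\<lambda>R. \<Sum>S\<in>pauli_strings n. pauli_kernel l R S * c S)"
proof (rule eq_matI)
  note d [simp] = carrier_matD[OF pauli_sum_carrier] carrier_matD[OF hamiltonian_carrier]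
  let ?X = "pauli_strings n"
  fix i j assume "i < dim_row (pauli_sum n (\<lambda>R. \<Sum>S\<in>?X. pauli_kernel l R S * c S))"
    "j < dim_col (pauli_sum n (\<lambda>R. \<Sum>S\<in>?X. pauli_kernel l R S * c S))"
  then have ij: "i < 2 ^ n" "j < 2 ^ n" by auto
  have "(- \<i> \<cdot>\<^sub>m (hamiltonian n l * pauli_sum n c - pauli_sum n c * hamiltonian n l)) $$ (i, j) =
    - \<i> * ((hamiltonian n l * pauli_sum n c) $$ (i, j) - (pauli_sum n c * hamiltonian n l) $$ (i, j))"
    using ij by simp
  also have "(hamiltonian n l * pauli_sum n c) $$ (i, j) =
      (\<Sum>S\<in>?X. \<Sum>P\<in>?X. \<i> * l P * c S * (pauli_mat P * pauli_mat S) $$ (i, j))"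
    unfolding hamiltonian_eq_pauli_sum pauli_sum_mult_entry[OF ij] by (rule sum.swap)
  also have "(pauli_sum n c * hamiltonian n l) $$ (i, j) =
      (\<Sum>S\<in>?X. \<Sum>P\<in>?X. \<i> * l P * c S * (pauli_mat S * pauli_mat P) $$ (i, j))"
    unfolding hamiltonian_eq_pauli_sum pauli_sum_mult_entry[OF ij] by (simp add: mult_ac)
  also have "- \<i> * ((\<Sum>S\<in>?X. \<Sum>P\<in>?X. \<i> * l P * c S * (pauli_mat P * pauli_mat S) $$ (i, j)) -
      (\<Sum>S\<in>?X. \<Sum>P\<in>?X. \<i> * l P * c S * (pauli_mat S * pauli_mat P) $$ (i, j))) =
      (\<Sum>S\<in>?X. \<Sum>P\<in>?X. l P * c S * ((pauli_mat P * pauli_mat S) $$ (i, j) - (pauli_mat S * pauli_mat P) $$ (i, j)))"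
  proof -
    have "- \<i> * (\<i> * a * b * x - \<i> * a * b * y) = a * b * (x - y)" for a b x y :: complex
      by (simp add: algebra_simps)
    then show ?thesis unfolding sum_subtractf[symmetric] sum_distrib_left by (simp only:)
  qed
  also have "\<dots> = (\<Sum>S\<in>?X. \<Sum>P\<in>?X. l P * commutator_phase P S * c S * pauli_mat (string_mult P S) $$ (i, j))"
  proof (intro sum.cong refl)
    fix S P assume "S \<in> ?X" "P \<in> ?X"
    then have len: "length P = n" "length S = n" by (auto simp: pauli_strings_def)
    then show "l P * c S * ((pauli_mat P * pauli_mat S) $$ (i, j) - (pauli_mat S * pauli_mat P) $$ (i, j)) =
      l P * commutator_phase P S * c S * pauli_mat (string_mult P S) $$ (i, j)"
      using ij string_mult_commute[of P S]
      by (simp add: pauli_mat_mult commutator_phase_def algebra_simps)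
  qed
  \<comment> \<open>For fixed S substitute R = P S; multiplication by S is an involution, so P is
    recovered as R S.\<close>
  also have "\<dots> = (\<Sum>S\<in>?X. \<Sum>R\<in>?X. pauli_kernel l R S * c S * pauli_mat R $$ (i, j))"
  proof (rule sum.cong[OF refl])
    fix S assume S: "S \<in> ?X"
    show "(\<Sum>P\<in>?X. l P * commutator_phase P S * c S * pauli_mat (string_mult P S) $$ (i, j)) =
      (\<Sum>R\<in>?X. pauli_kernel l R S * c S * pauli_mat R $$ (i, j))"
      using S by (subst sum.reindex_bij_betw[OF bij_string_mult[OF S], symmetric], intro sum.cong refl)
        (auto simp: pauli_kernel_def string_mult_cancel pauli_strings_def)
  qed
  also have "\<dots> = (\<Sum>R\<in>?X. \<Sum>S\<in>?X. pauli_kernel l R S * c S * pauli_mat R $$ (i, j))"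
    by (rule sum.swap)
  also have "\<dots> = pauli_sum n (\<lambda>R. \<Sum>S\<in>?X. pauli_kernel l R S * c S) $$ (i, j)"
    using ij by (simp add: pauli_sum_def sum_distrib_right)
  finally show "(- \<i> \<cdot>\<^sub>m (hamiltonian n l * pauli_sum n c - pauli_sum n c * hamiltonian n l)) $$ (i, j) =
    pauli_sum n (\<lambda>R. \<Sum>S\<in>?X. pauli_kernel l R S * c S) $$ (i, j)" .
qed (simp_all add: carrier_matD[OF pauli_sum_carrier] carrier_matD[OF hamiltonian_carrier])

section \<open>Group law and unitarity of the evolution\<close>

lemma evolution_carrier [simp, intro]: "H \<in> carrier_mat d d \<Longrightarrow> evolution H s \<in> carrier_mat d d"
  by (auto simp: evolution_def)

lemma evolution_add:
  assumes "H \<in> carrier_mat d d"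
  shows "evolution H s * evolution H r = evolution H (s + r)"
  unfolding evolution_def mat_exp_add[OF assms] by (simp add: algebra_simps)

lemma evolution_inverse:
  assumes "H \<in> carrier_mat d d"
  shows "evolution H s * evolution H (- s) = 1\<^sub>m d"
proof -
  have "(- \<i> * complex_of_real (- s)) \<cdot>\<^sub>m H = - ((- \<i> * complex_of_real s) \<cdot>\<^sub>m H)"
    by (rule eq_matI) auto
  then show ?thesis unfolding evolution_def using assms by (simp only: mat_exp_inverse[OF smult_carrier_mat])
qed

lemma mat_adjoint_evolution:
  assumes "H \<in> carrier_mat d d" "mat_adjoint H = H"
  shows "mat_adjoint (evolution H s) = evolution H (- s)"
proof -
  have "mat_adjoint (c \<cdot>\<^sub>m H) = cnj c \<cdot>\<^sub>m H" for c
  proof (rule eq_matI)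
    fix i j assume "i < dim_row (cnj c \<cdot>\<^sub>m H)" "j < dim_col (cnj c \<cdot>\<^sub>m H)"
    then have ij: "i < d" "j < d" using assms(1) by auto
    have "cnj (H $$ (j, i)) = mat_adjoint H $$ (i, j)" using assms(1) ij by simp
    also have "\<dots> = H $$ (i, j)" by (simp only: assms(2))
    finally show "mat_adjoint (c \<cdot>\<^sub>m H) $$ (i, j) = (cnj c \<cdot>\<^sub>m H) $$ (i, j)" using assms(1) ij by simp
  qed (use assms(1) in auto)
  then show ?thesis using assms(1) unfolding evolution_def
    by (subst mat_adjoint_exp[where d = d]) auto
qed

lemma evolution_unitary:
  assumes "H \<in> carrier_mat d d" "mat_adjoint H = H"
  shows "evolution H s * mat_adjoint (evolution H s) = 1\<^sub>m d" "mat_adjoint (evolution H s) * evolution H s = 1\<^sub>m d"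
  using evolution_inverse[OF assms(1), of s] evolution_inverse[OF assms(1), of "- s"] mat_adjoint_evolution[OF assms, of s]
  by simp_all

lemma pauli_sum_single:
  assumes "S \<in> pauli_strings n"
  shows "pauli_sum n (\<lambda>R. if R = S then 1 else 0) = pauli_mat S"
proof (rule eq_matI)
  have len: "length S = n" using assms by (simp add: pauli_strings_def)
  fix i j assume "i < dim_row (pauli_mat S)" "j < dim_col (pauli_mat S)"
  then have ij: "i < 2 ^ n" "j < 2 ^ n" using len by auto
  have "(\<Sum>P\<in>pauli_strings n. (if P = S then 1 else 0) * pauli_mat P $$ (i, j)) =
    (\<Sum>P\<in>pauli_strings n. if P = S then pauli_mat P $$ (i, j) else 0)"
    by (intro sum.cong) auto
  then show "pauli_sum n (\<lambda>R. if R = S then 1 else 0) $$ (i, j) = pauli_mat S $$ (i, j)"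
    using ij assms by (simp add: pauli_sum_def sum.delta)
qed (use assms in \<open>auto simp: pauli_sum_def pauli_strings_def\<close>)

text \<open>Orthogonality lets the trace against Q read off the coefficient at Q. The trace is
  spelled out in entries because the series to which this is applied converges entrywise.\<close>

lemma trace_pauli_mult_pauli_sum:
  assumes "Q \<in> pauli_strings n"
  shows "(\<Sum>i<2 ^ n. \<Sum>k<2 ^ n. pauli_mat Q $$ (i, k) * pauli_sum n c $$ (k, i)) = 2 ^ n * c Q"
proof -
  let ?X = "pauli_strings n"
  have "(\<Sum>i<2 ^ n. \<Sum>k<2 ^ n. pauli_mat Q $$ (i, k) * pauli_sum n c $$ (k, i)) =
     (\<Sum>i<2 ^ n. \<Sum>k<2 ^ n. \<Sum>R\<in>?X. c R * (pauli_mat Q $$ (i, k) * pauli_mat R $$ (k, i)))"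
    by (simp add: pauli_sum_def sum_distrib_left mult_ac)
  also have "\<dots> = (\<Sum>i<2 ^ n. \<Sum>R\<in>?X. \<Sum>k<2 ^ n. c R * (pauli_mat Q $$ (i, k) * pauli_mat R $$ (k, i)))"
    by (intro sum.cong refl sum.swap)
  also have "\<dots> = (\<Sum>R\<in>?X. \<Sum>i<2 ^ n. \<Sum>k<2 ^ n. c R * (pauli_mat Q $$ (i, k) * pauli_mat R $$ (k, i)))"
    by (rule sum.swap)
  also have "\<dots> = (\<Sum>R\<in>?X. c R * (\<Sum>i<2 ^ n. (pauli_mat Q * pauli_mat R) $$ (i, i)))"
    using assms
    by (intro sum.cong refl) (simp add: pauli_strings_def scalar_prod_def atLeast0LessThan sum_distrib_left)
  also have "\<dots> = (\<Sum>R\<in>?X. if R = Q then 2 ^ n * c Q else 0)"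
  proof (intro sum.cong refl)
    fix R assume "R \<in> ?X"
    then show "c R * (\<Sum>i<2 ^ n. (pauli_mat Q * pauli_mat R) $$ (i, i)) = (if R = Q then 2 ^ n * c Q else 0)"
      using pauli_mat_orthogonal[of Q R] assms by (auto simp: pauli_strings_def)
  qed
  also have "\<dots> = 2 ^ n * c Q" using assms by simp
  finally show ?thesis .
qed

text \<open>The iterated commutators of - i T H with S are Pauli sums whose coefficients form the
  column S of T^m M^m. The trace against Q selects one entry of it, and the convergence of the
  kernel series is inherited from the matrix exponential.\<close>

lemma heisenberg_trace:
  fixes l :: "pauli list \<Rightarrow> complex"
  assumes Q: "Q \<in> pauli_strings n" and S: "S \<in> pauli_strings n"
  defines "H \<equiv> hamiltonian n l"
  shows "(\<Sum>i<2 ^ n. (pauli_mat Q * (evolution H T * pauli_mat S * evolution H (- T))) $$ (i, i)) =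
    2 ^ n * ker_exp (pauli_strings n) (pauli_kernel l) T Q S"
proof -
  let ?X = "pauli_strings n" and ?M = "pauli_kernel l" and ?d = "2 ^ n :: nat"
  define A where "A = (- \<i> * complex_of_real T) \<cdot>\<^sub>m H"
  define B where "B = (- \<i> * complex_of_real (- T)) \<cdot>\<^sub>m H"
  define c where "c m R = ker_pow ?X ?M m R S" for m R
  define N where "N m = of_real T ^ m \<cdot>\<^sub>m pauli_sum n (c m)" for m
  have H: "H \<in> carrier_mat ?d ?d" by (simp add: H_def)
  then have AB: "A \<in> carrier_mat ?d ?d" "B \<in> carrier_mat ?d ?d" by (auto simp: A_def B_def)
  have SC: "pauli_mat S \<in> carrier_mat ?d ?d" and QC: "pauli_mat Q \<in> carrier_mat ?d ?d"
    using S Q pauli_mat_carrier[of S] pauli_mat_carrier[of Q] by (auto simp: pauli_strings_def)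
  have N: "N m \<in> carrier_mat ?d ?d" for m by (simp add: N_def)
  have "c 0 = (\<lambda>R. if R = S then 1 else 0)" by (simp add: c_def fun_eq_iff)
  then have N0: "N 0 = pauli_mat S"
    using pauli_sum_single[OF S] by (auto simp: N_def intro!: eq_matI)
  have N_Suc: "N (Suc m) = A * N m + N m * B" for m
  proof -
    define Y where "Y = pauli_sum n (c m)"
    have Y: "Y \<in> carrier_mat ?d ?d" by (simp add: Y_def)
    have "A * N m = (of_real T ^ m * (- \<i> * of_real T)) \<cdot>\<^sub>m (H * Y)"
      unfolding A_def N_def Y_def[symmetric] mult_smult_assoc_mat[OF H smult_carrier_mat[OF Y]] mult_smult_distrib[OF H Y]
      by (rule eq_matI) auto
    moreover have "N m * B = (of_real T ^ m * (\<i> * of_real T)) \<cdot>\<^sub>m (Y * H)"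
      unfolding B_def N_def Y_def[symmetric] mult_smult_assoc_mat[OF Y smult_carrier_mat[OF H]] mult_smult_distrib[OF Y H]
      by (rule eq_matI) auto
    moreover have "(of_real T ^ m * (- \<i> * of_real T)) \<cdot>\<^sub>m U + (of_real T ^ m * (\<i> * of_real T)) \<cdot>\<^sub>m V =
      of_real T ^ Suc m \<cdot>\<^sub>m (- \<i> \<cdot>\<^sub>m (U - V))" if "U \<in> carrier_mat ?d ?d" "V \<in> carrier_mat ?d ?d" for U V
      using that by (intro eq_matI) (auto simp: algebra_simps)
    ultimately have "A * N m + N m * B = of_real T ^ Suc m \<cdot>\<^sub>m (- \<i> \<cdot>\<^sub>m (H * Y - Y * H))"
      using H Y by (metis mult_carrier_mat)
    also have "\<dots> = N (Suc m)"
    proof -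
      have "(\<lambda>R. \<Sum>S\<in>?X. ?M R S * c m S) = c (Suc m)" by (simp add: c_def fun_eq_iff)
      then show ?thesis unfolding H_def Y_def hamiltonian_commutator N_def by simp
    qed
    finally show ?thesis by simp
  qed
  define W where "W = evolution H T * pauli_mat S * evolution H (- T)"
  have W: "W \<in> carrier_mat ?d ?d"
    unfolding W_def by (rule mult_carrier_mat[OF mult_carrier_mat[OF evolution_carrier[OF H] SC] evolution_carrier[OF H]])
  have sums: "(\<lambda>m. N m $$ (i, j) / fact m) sums (W $$ (i, j))" if "i < ?d" "j < ?d" for i j
    unfolding W_def evolution_def A_def[symmetric] B_def[symmetric]
    by (rule mat_exp_sandwich[OF AB(1) SC AB(2) N N0 N_Suc that])
  have "(\<lambda>m. \<Sum>i<?d. \<Sum>k<?d. pauli_mat Q $$ (i, k) * (N m $$ (k, i) / fact m)) sums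
    (\<Sum>i<?d. \<Sum>k<?d. pauli_mat Q $$ (i, k) * W $$ (k, i))"
    by (intro sums_sum sums_mult sums) auto
  moreover have "(\<Sum>i<?d. \<Sum>k<?d. pauli_mat Q $$ (i, k) * (N m $$ (k, i) / fact m)) =
     2 ^ n * (of_real T ^ m * c m Q / fact m)" for m
  proof -
    have "(\<Sum>i<?d. \<Sum>k<?d. pauli_mat Q $$ (i, k) * (N m $$ (k, i) / fact m)) =
      of_real T ^ m / fact m * (\<Sum>i<?d. \<Sum>k<?d. pauli_mat Q $$ (i, k) * pauli_sum n (c m) $$ (k, i))"
      unfolding sum_distrib_left by (intro sum.cong refl) (simp add: N_def carrier_matD[OF pauli_sum_carrier])
    then show ?thesis unfolding trace_pauli_mult_pauli_sum[OF Q] by simp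
  qed
  moreover have "(\<Sum>i<?d. (pauli_mat Q * W) $$ (i, i)) = (\<Sum>i<?d. \<Sum>k<?d. pauli_mat Q $$ (i, k) * W $$ (k, i))"
    using carrier_matD[OF QC] carrier_matD[OF W] by (intro sum.cong refl) (simp add: scalar_prod_def atLeast0LessThan)
  ultimately have "(\<lambda>m. 2 ^ n * (of_real T ^ m * c m Q / fact m)) sums (\<Sum>i<?d. (pauli_mat Q * W) $$ (i, i))"
    by simp
  then have s2: "(\<lambda>m. of_real T ^ m * c m Q / fact m) sums ((\<Sum>i<?d. (pauli_mat Q * W) $$ (i, i)) / 2 ^ n)"
    by (auto dest: sums_divide[where c = "2 ^ n"])
  then have "ker_exp ?X ?M T Q S = (\<Sum>i<?d. (pauli_mat Q * W) $$ (i, i)) / 2 ^ n"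
    unfolding ker_exp_def c_def by (simp add: sums_iff)
  then show ?thesis unfolding W_def by simp
qed

section \<open>Locality of the commutator kernel\<close>

lemma sum_supp_le_norm_B1:
  assumes "i < n"
  shows "(\<Sum>P | P \<in> pauli_strings n \<and> i \<in> supp P. cmod (l P)) \<le> norm_B1 n l"
  unfolding norm_B1_def using assms by (intro Max_ge) auto

text \<open>In the second alternative P S is trivial on the support of P, so P and S agree there and
  commute as well. This alternative serves the row sums, where the product string is the fixed
  one.\<close>

lemma commutator_phase_zero_if_disjoint:
  assumes len: "length P = n" "length S = n"
    and "supp P \<inter> supp S = {} \<or> supp P \<inter> supp (string_mult P S) = {}"
  shows "commutator_phase P S = 0"
proof -
  have "P ! i = PI \<or> S ! i = PI \<or> P ! i = S ! i" if "i < n" for i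
    using assms that by (auto simp: supp_def)
  then show ?thesis unfolding commutator_phase_def using len by (subst string_phase_commute) auto
qed

text \<open>A nonzero phase needs a common site. Counting 2 for every common site turns this
  condition into a sum over sites, which \<open>norm_B1\<close> can bound one site at a
  time.\<close>

lemma cmod_commutator_phase_le_overlap:
  assumes "P \<in> pauli_strings n" "S \<in> pauli_strings n" "Y = S \<or> Y = string_mult P S"
  shows "cmod (commutator_phase P S) \<le> (\<Sum>i\<in>supp Y. if i \<in> supp P then 2 else 0)"
proof (cases "supp P \<inter> supp Y = {}")
  case True
  then have "commutator_phase P S = 0"
    using assms by (intro commutator_phase_zero_if_disjoint[of P n]) (auto simp: pauli_strings_def)
  then show ?thesis by (auto intro: sum_nonneg)
next
  case False
  then obtain i where i: "i \<in> supp P" "i \<in> supp Y" by auto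
  have "cmod (commutator_phase P S) \<le> 2" by (rule cmod_commutator_phase)
  also have "2 = (if i \<in> supp P then 2 else 0 :: real)" using i by simp
  also have "\<dots> \<le> (\<Sum>i\<in>supp Y. if i \<in> supp P then 2 else 0)"
    using i by (intro member_le_sum) auto
  finally show ?thesis .
qed

lemma weighted_overlap_sum:
  assumes "supp Y \<subseteq> {..<n}"
  shows "(\<Sum>P\<in>pauli_strings n. cmod (l P) * (\<Sum>i\<in>supp Y. if i \<in> supp P then 2 else 0)) \<le> 2 * norm_B1 n l * card (supp Y)"
proof -
  have "(\<Sum>P\<in>pauli_strings n. cmod (l P) * (\<Sum>i\<in>supp Y. if i \<in> supp P then 2 else 0)) =
    (\<Sum>P\<in>pauli_strings n. \<Sum>i\<in>supp Y. if i \<in> supp P then 2 * cmod (l P) else 0)"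
    unfolding sum_distrib_left by (intro sum.cong refl) auto
  also have "\<dots> = (\<Sum>i\<in>supp Y. \<Sum>P\<in>pauli_strings n. if i \<in> supp P then 2 * cmod (l P) else 0)"
    by (rule sum.swap)
  also have "\<dots> = (\<Sum>i\<in>supp Y. 2 * (\<Sum>P | P \<in> pauli_strings n \<and> i \<in> supp P. cmod (l P)))"
    by (intro sum.cong refl) (auto simp: sum.inter_filter sum_distrib_left intro!: sum.cong)
  also have "\<dots> \<le> (\<Sum>i\<in>supp Y. 2 * norm_B1 n l)"
    using assms sum_supp_le_norm_B1[of _ n l] by (intro sum_mono) auto
  finally show ?thesis by (simp add: mult_ac)
qed

text \<open>Both sums are reindexed by the Hamiltonian string P: a column fixes S and has R = P S, a
  row fixes R and has S = P R. A nonzero phase forces P to meet the fixed string, and each of its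
  sites contributes at most 2 g. Weights differ by at most k because R and S differ by a factor of
  weight at most k.\<close>

lemma pauli_kernel_local:
  assumes loc: "k_local k n l" and B1: "norm_B1 n l \<le> g"
  shows "local_kernel (pauli_strings n) (\<lambda>P. card (supp P)) k (2 * g) (pauli_kernel l)"
proof -
  let ?X = "pauli_strings n"
  have sub: "supp Y \<subseteq> {..<n}" if "Y \<in> ?X" for Y using that by (auto simp: supp_def pauli_strings_def)
  have mem: "string_mult R S \<in> ?X" if "R \<in> ?X" "S \<in> ?X" for R S using that by (auto simp: pauli_strings_def)
  have card: "2 * norm_B1 n l * card (supp Y) \<le> 2 * g * card (supp Y)" for Y
    using B1 by (intro mult_right_mono) auto
  have col: "(\<Sum>R\<in>?X. cmod (pauli_kernel l R S)) \<le> 2 * g * card (supp S)" if S: "S \<in> ?X" for S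
  proof -
    have "(\<Sum>R\<in>?X. cmod (pauli_kernel l R S)) = (\<Sum>P\<in>?X. cmod (pauli_kernel l (string_mult P S) S))"
      by (rule sum.reindex_bij_betw[OF bij_string_mult[OF S], symmetric])
    also have "\<dots> = (\<Sum>P\<in>?X. cmod (l P) * cmod (commutator_phase P S))"
      using S by (intro sum.cong) (auto simp: pauli_kernel_def norm_mult string_mult_cancel pauli_strings_def)
    also have "\<dots> \<le> (\<Sum>P\<in>?X. cmod (l P) * (\<Sum>i\<in>supp S. if i \<in> supp P then 2 else 0))"
      using S by (intro sum_mono mult_left_mono cmod_commutator_phase_le_overlap) auto
    also have "\<dots> \<le> 2 * g * card (supp S)"
      using weighted_overlap_sum[OF sub[OF S], of l] card[of S] by linarith
    finally show ?thesis .
  qed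
  have row: "(\<Sum>S\<in>?X. cmod (pauli_kernel l R S)) \<le> 2 * g * card (supp R)" if R: "R \<in> ?X" for R
  proof -
    have "(\<Sum>S\<in>?X. cmod (pauli_kernel l R S)) = (\<Sum>P\<in>?X. cmod (pauli_kernel l R (string_mult P R)))"
      by (rule sum.reindex_bij_betw[OF bij_string_mult[OF R], symmetric])
    also have "\<dots> = (\<Sum>P\<in>?X. cmod (l P) * cmod (commutator_phase P (string_mult P R)))"
    proof (intro sum.cong refl)
      fix P assume "P \<in> ?X"
      then have "length P = length R" using R by (simp add: pauli_strings_def)
      then have "string_mult R (string_mult P R) = P"
        by (metis string_mult_cancel_left string_mult_commute)
      then show "cmod (pauli_kernel l R (string_mult P R)) = cmod (l P) * cmod (commutator_phase P (string_mult P R))"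
        by (simp add: pauli_kernel_def norm_mult)
    qed
    also have "\<dots> \<le> (\<Sum>P\<in>?X. cmod (l P) * (\<Sum>i\<in>supp R. if i \<in> supp P then 2 else 0))"
      using R mem by (intro sum_mono mult_left_mono cmod_commutator_phase_le_overlap)
        (auto simp: string_mult_cancel_left pauli_strings_def)
    also have "\<dots> \<le> 2 * g * card (supp R)"
      using weighted_overlap_sum[OF sub[OF R], of l] card[of R] by linarith
    finally show ?thesis .
  qed
  have grow: "card (supp R) \<le> card (supp S) + k \<and> card (supp S) \<le> card (supp R) + k"
    if RS: "R \<in> ?X" "S \<in> ?X" "pauli_kernel l R S \<noteq> 0" for R S
  proof -
    let ?P = "string_mult R S"
    have len: "length R = length S" using RS by (auto simp: pauli_strings_def)
    have P: "card (supp ?P) \<le> k"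
      using RS loc mem[OF RS(1,2)] by (force simp: k_local_def pauli_kernel_def)
    have "supp R \<subseteq> supp S \<union> supp ?P"
      using supp_string_mult[of ?P S] string_mult_cancel[OF len] len by auto
    then have "card (supp R) \<le> card (supp S) + card (supp ?P)"
      by (intro order_trans[OF card_mono card_Un_le]) auto
    moreover have "supp S \<subseteq> supp R \<union> supp ?P"
      using supp_string_mult[of R ?P] string_mult_cancel_left[OF len] len by auto
    then have "card (supp S) \<le> card (supp R) + card (supp ?P)"
      by (intro order_trans[OF card_mono card_Un_le]) auto
    ultimately show ?thesis using P by linarith
  qed
  show ?thesis unfolding local_kernel_def using col row grow by blast
qed

section \<open>Probe pairs that isolate one coefficient\<close>

fun next_pauli :: "pauli \<Rightarrow> pauli" where
  "next_pauli PI = PI" | "next_pauli PX = PY" | "next_pauli PY = PZ" | "next_pauli PZ = PX"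

definition probe_site :: "pauli list \<Rightarrow> nat" where
  "probe_site P = Min (supp P)"

text \<open>\<open>out_probe P\<close> and \<open>in_probe P\<close> are the strings \<open>Q\<close> and \<open>S\<close> of the introduction: the first-order
  response of the former to the latter is proportional to the coefficient of \<open>P\<close> alone.\<close>

definition out_probe :: "pauli list \<Rightarrow> pauli list" where
  "out_probe P = P[probe_site P := next_pauli (P ! probe_site P)]"

definition in_probe :: "pauli list \<Rightarrow> pauli list" where
  "in_probe P = (replicate (length P) PI)[probe_site P := next_pauli (next_pauli (P ! probe_site P))]"

lemma length_probe [simp]: "length (out_probe P) = length P" "length (in_probe P) = length P"
  by (simp_all add: out_probe_def in_probe_def)

lemma supp_nonempty_iff: "supp P \<noteq> {} \<longleftrightarrow> P \<noteq> replicate (length P) PI"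
  by (auto simp: supp_def list_eq_iff_nth_eq)

lemma probe_site:
  assumes "supp P \<noteq> {}"
  shows "probe_site P < length P" "P ! probe_site P \<noteq> PI"
  using Min_in[OF finite_supp assms] by (auto simp: probe_site_def supp_def)

lemma next_pauli_eq_PI [simp]: "next_pauli p = PI \<longleftrightarrow> p = PI" by (cases p) auto

lemma supp_out_probe: "supp P \<noteq> {} \<Longrightarrow> supp (out_probe P) = supp P"
  using probe_site[of P] by (auto simp: supp_def out_probe_def nth_list_update split: if_splits)

lemma supp_in_probe: "supp P \<noteq> {} \<Longrightarrow> supp (in_probe P) = {probe_site P}"
  using probe_site[of P] by (auto simp: supp_def in_probe_def nth_list_update split: if_splits)

text \<open>\<open>next_pauli\<close> runs through the cycle X, Y, Z, so the two successors of a
  letter multiply to that letter up to a phase. Away from the probe site \<open>in_probe\<close> is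
  trivial.\<close>

lemma string_mult_probes:
  assumes "supp P \<noteq> {}"
  shows "string_mult (out_probe P) (in_probe P) = P"
proof (rule nth_equalityI)
  have "pauli_mult (next_pauli p) (next_pauli (next_pauli p)) = p" for p by (cases p) auto
  then show "string_mult (out_probe P) (in_probe P) ! i = P ! i" if "i < length (string_mult (out_probe P) (in_probe P))" for i
    using probe_site[OF assms] that by (auto simp: out_probe_def in_probe_def nth_list_update)
qed simp

lemma string_phase_single_site:
  assumes "i < length P" "length S = length P" "\<And>j. j < length P \<Longrightarrow> j \<noteq> i \<Longrightarrow> P ! j = PI \<or> S ! j = PI"
  shows "string_phase P S = pauli_phase (P ! i) (S ! i)"
proof -
  have "string_phase P S = (\<Prod>j<length P. pauli_phase (P ! j) (S ! j))"
    unfolding string_phase_def using assms(2) by (simp add: prod.list_conv_set_nth atLeast0LessThan)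
  also have "\<dots> = (\<Prod>j<length P. if j = i then pauli_phase (P ! i) (S ! i) else 1)"
  proof (intro prod.cong refl)
    fix j assume "j \<in> {..<length P}"
    have "pauli_phase PI q = 1" "pauli_phase q PI = 1" for q by (cases q; simp)+
    then show "pauli_phase (P ! j) (S ! j) = (if j = i then pauli_phase (P ! i) (S ! i) else 1)"
      using assms(3)[of j] \<open>j \<in> {..<length P}\<close> by auto
  qed
  also have "\<dots> = pauli_phase (P ! i) (S ! i)" using assms(1) by simp
  finally show ?thesis .
qed

text \<open>The strings meet in one site only and carry different nontrivial letters there, so they
  anticommute. The value 2 is attained exactly, which fixes the size of the first-order
  signal.\<close>

lemma commutator_phase_in_probe:
  assumes "supp P \<noteq> {}"
  shows "cmod (commutator_phase P (in_probe P)) = 2"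
proof -
  let ?i = "probe_site P" let ?p = "P ! ?i"
  have i: "?i < length P" "?p \<noteq> PI" using probe_site[OF assms] by auto
  have "commutator_phase P (in_probe P) =
    pauli_phase ?p (next_pauli (next_pauli ?p)) - pauli_phase (next_pauli (next_pauli ?p)) ?p"
    unfolding commutator_phase_def using i
    by (subst (1 2) string_phase_single_site[where i = ?i]) (auto simp: in_probe_def)
  also have "cmod \<dots> = 2" using i(2) by (cases ?p) auto
  finally show ?thesis .
qed

text \<open>By \<open>heisenberg_trace\<close> this is the normalised trace that the overview calls
  F at P, for the evolution of duration T.\<close>

definition probe_mean :: "nat \<Rightarrow> (pauli list \<Rightarrow> complex) \<Rightarrow> real \<Rightarrow> pauli list \<Rightarrow> complex" where
  "probe_mean n l T P = ker_exp (pauli_strings n) (pauli_kernel l) T (out_probe P) (in_probe P)"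

text \<open>The higher orders also see the differences at other strings, so the first order is
  certain to dominate only where the difference is largest.\<close>

lemma probe_mean_separates:
  assumes l: "k_local k n l" "norm_B1 n l \<le> g" and l': "k_local k n l'" "norm_B1 n l' \<le> g"
    and g: "g \<ge> 0" and k: "k \<ge> 1" and T: "T \<ge> 0" "2 * g * k * T \<le> 1 / 81"
    and P: "P \<in> pauli_strings n" "supp P \<noteq> {}" "card (supp P) \<le> k"
    and max: "\<And>R. R \<in> pauli_strings n \<Longrightarrow> supp R \<noteq> {} \<Longrightarrow> cmod (l R - l' R) \<le> cmod (l P - l' P)"
  shows "T * cmod (l P - l' P) \<le> cmod (probe_mean n l T P - probe_mean n l' T P)"
proof -
  let ?X = "pauli_strings n" and ?Q = "out_probe P" and ?S = "in_probe P"
  define d where "d = cmod (l P - l' P)"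
  define x where "x = 2 * g * k * T"
  have x: "0 \<le> x" "x \<le> 1 / 81" using T g by (auto simp: x_def)
  have close: "cmod (pauli_kernel l V W - pauli_kernel l' V W) \<le> 2 * d" if "V \<in> ?X" "W \<in> ?X" for V W
  proof -
    let ?R = "string_mult V W"
    have eq: "cmod (pauli_kernel l V W - pauli_kernel l' V W) = cmod (l ?R - l' ?R) * cmod (commutator_phase ?R W)"
      by (simp add: pauli_kernel_def norm_mult[symmetric] algebra_simps)
    show ?thesis
    proof (cases "supp ?R = {}")
      \<comment> \<open>The hypothesis on the maximum says nothing about the identity string, but
        that string commutes with W.\<close>
      case True
      then have "commutator_phase ?R W = 0"
        using that by (intro commutator_phase_zero_if_disjoint[of ?R n]) (auto simp: pauli_strings_def)
      then show ?thesis unfolding eq by (simp add: d_def)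
    next
      case False
      then have "cmod (l ?R - l' ?R) \<le> d" unfolding d_def using that by (intro max) (auto simp: pauli_strings_def)
      then have "cmod (l ?R - l' ?R) * cmod (commutator_phase ?R W) \<le> d * 2"
        by (intro mult_mono cmod_commutator_phase) (auto simp: d_def)
      then show ?thesis unfolding eq by simp
    qed
  qed
  have "cmod (ker_exp ?X (pauli_kernel l) T ?Q ?S - ker_exp ?X (pauli_kernel l') T ?Q ?S
      - T * (pauli_kernel l ?Q ?S - pauli_kernel l' ?Q ?S)) \<le> 2 * d * T * (2 * g * k * T) / (1 - 2 * g * k * T)"
    using g T P k supp_out_probe[OF P(2)] supp_in_probe[OF P(2)]
    by (intro ker_exp_diff[OF finite_pauli_strings _ pauli_kernel_local[OF l] pauli_kernel_local[OF l'] close])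
       (auto simp: pauli_strings_def)
  also have "\<dots> = 2 * d * T * (x / (1 - x))" by (simp add: x_def)
  \<comment> \<open>x / (1 - x) is increasing and equals 1/80 at x = 1/81.\<close>
  also have "\<dots> \<le> 2 * d * T * (1 / 80)"
    using x T by (intro mult_left_mono) (auto simp: d_def field_simps)
  finally have err: "cmod (probe_mean n l T P - probe_mean n l' T P - T * (pauli_kernel l ?Q ?S - pauli_kernel l' ?Q ?S)) \<le> d * T / 40"
    by (simp add: probe_mean_def mult.commute)
  have "cmod (T * (pauli_kernel l ?Q ?S - pauli_kernel l' ?Q ?S)) = T * (d * 2)"
    using T commutator_phase_in_probe[OF P(2)]
    by (simp add: pauli_kernel_def string_mult_probes[OF P(2)] norm_mult left_diff_distrib[symmetric] d_def)
  \<comment> \<open>The signal 2 d T loses at most d T / 40; the conclusion keeps only d T of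
    it.\<close>
  then have "T * (d * 2) \<le> cmod (probe_mean n l T P - probe_mean n l' T P) + d * T / 40"
    using err norm_triangle_ineq2[of "of_real T * (pauli_kernel l ?Q ?S - pauli_kernel l' ?Q ?S)" "probe_mean n l T P - probe_mean n l' T P"]
    by (simp add: norm_minus_commute)
  moreover have "d * T \<ge> 0" using T by (simp add: d_def)
  ultimately show ?thesis unfolding d_def[symmetric] by (simp add: mult_ac)
qed

section \<open>Measurements in products of Pauli eigenbases\<close>

lemma mat_adjoint_kron: "mat_adjoint (kron A B) = kron (mat_adjoint A) (mat_adjoint B)"
proof (rule eq_matI)
  fix i j assume "i < dim_row (kron (mat_adjoint A) (mat_adjoint B))" "j < dim_col (kron (mat_adjoint A) (mat_adjoint B))"
  then have ij: "i < dim_col A * dim_col B" "j < dim_row A * dim_row B" by auto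
  then have "dim_row B > 0" "dim_col B > 0" by (auto intro: Nat.gr0I)
  then show "mat_adjoint (kron A B) $$ (i, j) = kron (mat_adjoint A) (mat_adjoint B) $$ (i, j)"
    using ij by (simp add: index_kron less_mult_imp_div_less)
qed auto

definition inv_sqrt2 :: complex where "inv_sqrt2 = complex_of_real (1 / sqrt 2)"

lemma inv_sqrt2_simps [simp]: "cnj inv_sqrt2 = inv_sqrt2" "inv_sqrt2 * inv_sqrt2 = 1 / 2" "inv_sqrt2 * (inv_sqrt2 * a) = a / 2"
  "a * inv_sqrt2 * (b * inv_sqrt2) = a * b / 2" "(cmod inv_sqrt2)\<^sup>2 = 1 / 2"
proof -
  show 1: "inv_sqrt2 * inv_sqrt2 = 1 / 2"
    unfolding inv_sqrt2_def of_real_mult[symmetric] by simp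
  show "inv_sqrt2 * (inv_sqrt2 * a) = a / 2"
    unfolding mult.assoc[symmetric] 1 by simp
  have "a * inv_sqrt2 * (b * inv_sqrt2) = a * b * (inv_sqrt2 * inv_sqrt2)" by (simp only: mult_ac)
  then show "a * inv_sqrt2 * (b * inv_sqrt2) = a * b / 2" unfolding 1 by simp
qed (auto simp: inv_sqrt2_def norm_divide power_divide)

text \<open>For \<open>p \<noteq> PI\<close> the columns of \<open>eigenbasis p\<close> are eigenvectors of \<open>sigma p\<close> for the eigenvalues \<open>1\<close>
  and \<open>-1\<close>, in this order.\<close>

fun eigenbasis :: "pauli \<Rightarrow> complex mat" where
  "eigenbasis PX = mat_of_rows_list 2 [[inv_sqrt2, inv_sqrt2], [inv_sqrt2, - inv_sqrt2]]"
| "eigenbasis PY = mat_of_rows_list 2 [[inv_sqrt2, inv_sqrt2], [\<i> * inv_sqrt2, - \<i> * inv_sqrt2]]"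
| "eigenbasis p = 1\<^sub>m 2"

lemma eigenbasis_carrier [simp, intro]: "eigenbasis p \<in> carrier_mat 2 2"
  by (cases p) (auto simp: mat_of_rows_list_def)

lemma dim_eigenbasis [simp]: "dim_row (eigenbasis p) = 2" "dim_col (eigenbasis p) = 2"
  using carrier_matD[OF eigenbasis_carrier] by auto

lemma eigenbasis_unitary:
  "eigenbasis p * mat_adjoint (eigenbasis p) = 1\<^sub>m 2" "mat_adjoint (eigenbasis p) * eigenbasis p = 1\<^sub>m 2"
proof -
  show "eigenbasis p * mat_adjoint (eigenbasis p) = 1\<^sub>m 2"
  proof (rule eq_mat_2I)
    show "eigenbasis p * mat_adjoint (eigenbasis p) \<in> carrier_mat 2 2" by (intro mult_carrier_mat[where n = 2]) auto
  qed (simp_all add: index_mult_mat_2 del: eigenbasis.simps index_mult_mat(1); cases p; simp add: mat_of_rows_list_def)+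
  show "mat_adjoint (eigenbasis p) * eigenbasis p = 1\<^sub>m 2"
  proof (rule eq_mat_2I)
    show "mat_adjoint (eigenbasis p) * eigenbasis p \<in> carrier_mat 2 2" by (intro mult_carrier_mat[where n = 2]) auto
  qed (simp_all add: index_mult_mat_2 del: eigenbasis.simps index_mult_mat(1); cases p; simp add: mat_of_rows_list_def)+
qed

lemma eigenbasis_diagonalizes:
  assumes "p \<noteq> PI"
  shows "eigenbasis p * sigma PZ * mat_adjoint (eigenbasis p) = sigma p"
proof (rule eq_mat_2I)
  have c: "eigenbasis p * sigma PZ \<in> carrier_mat 2 2" by (rule mult_carrier_mat[OF eigenbasis_carrier sigma_carrier])
  have two: "1 < (2::nat)" by simp
  have e: "(eigenbasis p * sigma PZ * mat_adjoint (eigenbasis p)) $$ (i, j) = sigma p $$ (i, j)" if "i < 2" "j < 2" for i j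
    unfolding index_mult_mat_2[OF c mat_adjoint_carrier[OF eigenbasis_carrier] that]
      index_mult_mat_2[OF eigenbasis_carrier sigma_carrier that(1) pos2]
      index_mult_mat_2[OF eigenbasis_carrier sigma_carrier that(1) two]
    using that assms by (cases p) (auto simp: less_2_iff mat_of_rows_list_def)
  show "eigenbasis p * sigma PZ * mat_adjoint (eigenbasis p) \<in> carrier_mat 2 2"
    by (rule mult_carrier_mat[OF c mat_adjoint_carrier[OF eigenbasis_carrier]])
  show "(eigenbasis p * sigma PZ * mat_adjoint (eigenbasis p)) $$ (0, 0) = sigma p $$ (0, 0)"
    "(eigenbasis p * sigma PZ * mat_adjoint (eigenbasis p)) $$ (0, 1) = sigma p $$ (0, 1)"
    "(eigenbasis p * sigma PZ * mat_adjoint (eigenbasis p)) $$ (1, 0) = sigma p $$ (1, 0)"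
    "(eigenbasis p * sigma PZ * mat_adjoint (eigenbasis p)) $$ (1, 1) = sigma p $$ (1, 1)"
    by (rule e; simp)+
qed (rule sigma_carrier)

definition product_basis :: "pauli list \<Rightarrow> complex mat" where
  "product_basis s = tensor (map eigenbasis s)"

lemma product_basis_carrier [simp, intro]: "product_basis s \<in> carrier_mat (2 ^ length s) (2 ^ length s)"
  using tensor_carrier[of "map eigenbasis s"] by (auto simp: product_basis_def)

lemma dim_product_basis [simp]: "dim_row (product_basis s) = 2 ^ length s" "dim_col (product_basis s) = 2 ^ length s"
  using carrier_matD[OF product_basis_carrier] by auto

lemma product_basis_simps [simp]:
  "product_basis [] = 1\<^sub>m 1" "product_basis (p # s) = kron (eigenbasis p) (product_basis s)"
  by (auto simp: product_basis_def)

lemma product_basis_unitary: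
  "product_basis s * mat_adjoint (product_basis s) = 1\<^sub>m (2 ^ length s)"
  "mat_adjoint (product_basis s) * product_basis s = 1\<^sub>m (2 ^ length s)"
proof (induction s)
  case (Cons p s)
  note c = mat_adjoint_carrier[OF eigenbasis_carrier] mat_adjoint_carrier[OF product_basis_carrier]
  {
    case 1
    show ?case using Cons(1)
      by (simp add: mat_adjoint_kron kron_mult[OF eigenbasis_carrier product_basis_carrier c] eigenbasis_unitary)
  next
    case 2
    show ?case using Cons(2)
      by (simp add: mat_adjoint_kron kron_mult[OF c eigenbasis_carrier product_basis_carrier] eigenbasis_unitary)
  }
qed auto

section \<open>Reading Pauli strings off product measurements\<close>

definition matches :: "pauli list \<Rightarrow> pauli list \<Rightarrow> bool" where
  "matches Q s \<longleftrightarrow> list_all2 (\<lambda>q p. q = PI \<or> q = p) Q s"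

definition z_string :: "pauli list \<Rightarrow> pauli list" where
  "z_string Q = map (\<lambda>p. if p = PI then PI else PZ) Q"

lemma length_z_string [simp]: "length (z_string Q) = length Q"
  by (simp add: z_string_def)

lemma product_basis_diagonalizes:
  assumes "matches Q s"
  shows "product_basis s * pauli_mat (z_string Q) * mat_adjoint (product_basis s) = pauli_mat Q"
  using assms unfolding matches_def
proof (induction Q s rule: list_all2_induct)
  case Nil
  then show ?case by (simp add: z_string_def)
next
  case (Cons q Q p s)
  have len: "length Q = length s" using Cons by (auto dest: list_all2_lengthD)
  let ?z = "sigma (if q = PI then PI else PZ)" and ?Z = "pauli_mat (z_string Q)"
  have Z: "?Z \<in> carrier_mat (2 ^ length s) (2 ^ length s)" using pauli_mat_carrier[of "z_string Q"] len by simp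
  note cz = mult_carrier_mat[OF eigenbasis_carrier sigma_carrier]
  note cZ = mult_carrier_mat[OF product_basis_carrier Z]
  have "product_basis (p # s) * pauli_mat (z_string (q # Q)) * mat_adjoint (product_basis (p # s)) =
    kron (eigenbasis p * ?z * mat_adjoint (eigenbasis p)) (product_basis s * ?Z * mat_adjoint (product_basis s))"
    unfolding product_basis_simps mat_adjoint_kron z_string_def list.map pauli_mat.simps
    unfolding z_string_def[symmetric] kron_mult[OF eigenbasis_carrier product_basis_carrier sigma_carrier Z]
      kron_mult[OF cz cZ mat_adjoint_carrier[OF eigenbasis_carrier] mat_adjoint_carrier[OF product_basis_carrier]] ..
  also have "eigenbasis p * ?z * mat_adjoint (eigenbasis p) = sigma q"
  proof (cases "q = PI")
    case True
    then show ?thesis using right_mult_one_mat[OF eigenbasis_carrier[of p]] eigenbasis_unitary[of p] by simp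
  next
    case False
    then show ?thesis using Cons eigenbasis_diagonalizes[of p] by (simp del: sigma.simps)
  qed
  finally show ?case using Cons.IH by simp
qed

lemma z_string_diag:
  assumes "i < 2 ^ length Q" "j < 2 ^ length Q"
  shows "i \<noteq> j \<Longrightarrow> pauli_mat (z_string Q) $$ (i, j) = 0"
    and "i = j \<Longrightarrow> pauli_mat (z_string Q) $$ (i, j) \<in> {1, -1}"
proof -
  have "(i \<noteq> j \<longrightarrow> pauli_mat (z_string Q) $$ (i, j) = 0) \<and> (i = j \<longrightarrow> pauli_mat (z_string Q) $$ (i, j) \<in> {1, -1})"
    using assms
  proof (induction Q arbitrary: i j)
    case (Cons q Q)
    let ?d = "2 ^ length Q :: nat"
    have lt: "i div ?d < 2" "i mod ?d < ?d" "j div ?d < 2" "j mod ?d < ?d"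
      using Cons.prems by (auto simp: less_mult_imp_div_less)
    have eq: "i = j \<longleftrightarrow> i div ?d = j div ?d \<and> i mod ?d = j mod ?d" by (metis div_mult_mod_eq)
    have s: "(a \<noteq> b \<longrightarrow> sigma (if q = PI then PI else PZ) $$ (a, b) = 0) \<and>
       (a = b \<longrightarrow> sigma (if q = PI then PI else PZ) $$ (a, b) \<in> {1, -1})" if "a < 2" "b < 2" for a b
      using that by (auto simp: less_2_iff mat_of_rows_list_def)
    have "pauli_mat (z_string (q # Q)) $$ (i, j) =
      sigma (if q = PI then PI else PZ) $$ (i div ?d, j div ?d) * pauli_mat (z_string Q) $$ (i mod ?d, j mod ?d)"
      using Cons.prems by (simp add: z_string_def index_kron del: sigma.simps)
    then show ?case using s[OF lt(1,3)] Cons.IH[OF lt(2,4)] unfolding eq by auto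
  qed (auto simp: z_string_def)
  then show "i \<noteq> j \<Longrightarrow> pauli_mat (z_string Q) $$ (i, j) = 0" "i = j \<Longrightarrow> pauli_mat (z_string Q) $$ (i, j) \<in> {1, -1}" by auto
qed

text \<open>The parity of the bits of y on the support of Q, that is, the eigenvalue of Q at column
  y of the product basis of any matching setting.\<close>

definition z_sign :: "pauli list \<Rightarrow> nat \<Rightarrow> real" where
  "z_sign Q y = Re (pauli_mat (z_string Q) $$ (y, y))"

lemma of_real_z_sign: "y < 2 ^ length Q \<Longrightarrow> complex_of_real (z_sign Q y) = pauli_mat (z_string Q) $$ (y, y)"
  using z_string_diag(2)[of y Q y] by (auto simp: z_sign_def)

lemma abs_z_sign: "y < 2 ^ length Q \<Longrightarrow> \<bar>z_sign Q y\<bar> = 1"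
  using z_string_diag(2)[of y Q y] by (auto simp: z_sign_def)

lemma trace_mult_commute:
  fixes A B :: "complex mat"
  assumes "A \<in> carrier_mat d d" "B \<in> carrier_mat d d"
  shows "(\<Sum>i<d. (A * B) $$ (i, i)) = (\<Sum>i<d. (B * A) $$ (i, i))"
proof -
  have e: "(\<Sum>i<d. (X * Y) $$ (i, i)) = (\<Sum>i<d. \<Sum>k<d. X $$ (i, k) * Y $$ (k, i))"
    if "X \<in> carrier_mat d d" "Y \<in> carrier_mat d d" for X Y :: "complex mat"
    using that by (intro sum.cong refl) (simp add: scalar_prod_def atLeast0LessThan)
  show ?thesis unfolding e[OF assms] e[OF assms(2,1)] by (subst sum.swap) (simp add: mult.commute)
qed

text \<open>Expanding Q and S in the eigenbases of matching settings turns the trace into a sum over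
  pairs of eigenvectors, weighted by their transition probabilities under U. It can thus be sampled:
  prepare eigenvector x, evolve, measure y, multiply the two signs.\<close>

lemma basis_measurement_trace:
  assumes m: "matches Q s" "matches S r" and len: "length s = n" "length r = n"
    and U: "U \<in> carrier_mat (2 ^ n) (2 ^ n)"
  defines "G \<equiv> mat_adjoint (product_basis s) * U * product_basis r"
  shows "complex_of_real (\<Sum>x<2 ^ n. \<Sum>y<2 ^ n. z_sign S x * z_sign Q y * (cmod (G $$ (y, x)))\<^sup>2) =
    (\<Sum>i<2 ^ n. (pauli_mat Q * (U * pauli_mat S * mat_adjoint U)) $$ (i, i))"
proof -
  let ?d = "2 ^ n :: nat"
  define V where "V = product_basis s"
  define W where "W = product_basis r"
  define ZQ where "ZQ = pauli_mat (z_string Q)"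
  define ZS where "ZS = pauli_mat (z_string S)"
  have lQ: "length Q = n" "length S = n" using m len by (auto simp: matches_def dest: list_all2_lengthD)
  have V: "V \<in> carrier_mat ?d ?d" and W: "W \<in> carrier_mat ?d ?d"
    using product_basis_carrier[of s] product_basis_carrier[of r] len by (auto simp: V_def W_def)
  have ZQ: "ZQ \<in> carrier_mat ?d ?d" and ZS: "ZS \<in> carrier_mat ?d ?d"
    using pauli_mat_carrier[of "z_string Q"] pauli_mat_carrier[of "z_string S"] lQ by (auto simp: ZQ_def ZS_def)
  have Va: "mat_adjoint V \<in> carrier_mat ?d ?d" and Wa: "mat_adjoint W \<in> carrier_mat ?d ?d" and Ua: "mat_adjoint U \<in> carrier_mat ?d ?d"
    using V W U by auto
  have G: "G = mat_adjoint V * U * W" "G \<in> carrier_mat ?d ?d"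
    using V W U Va by (auto simp: G_def V_def W_def intro!: mult_carrier_mat)
  have Ga: "mat_adjoint G = mat_adjoint W * (mat_adjoint U * V)"
    unfolding G(1) mat_adjoint_times[OF mult_carrier_mat[OF Va U] W] mat_adjoint_times[OF Va U] by simp
  have Ga_c: "mat_adjoint G \<in> carrier_mat ?d ?d" using G(2) by auto
  note assoc = assoc_mult_mat[where n\<^sub>1 = ?d and n\<^sub>2 = ?d and n\<^sub>3 = ?d and n\<^sub>4 = ?d]
  have cc: "X * Y \<in> carrier_mat ?d ?d" if "X \<in> carrier_mat ?d ?d" "Y \<in> carrier_mat ?d ?d" for X Y :: "complex mat"
    using that by (rule mult_carrier_mat)
  \<comment> \<open>Q U S U^* is V ZQ M. Cyclicity of the trace moves V behind M, and M V is the
    diagonal matrix ZS conjugated by G.\<close>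
  define M where "M = mat_adjoint V * (U * pauli_mat S * mat_adjoint U)"
  have PS: "pauli_mat S = W * ZS * mat_adjoint W"
    using product_basis_diagonalizes[OF m(2)] by (simp add: W_def ZS_def)
  have PQ: "pauli_mat Q = V * ZQ * mat_adjoint V"
    using product_basis_diagonalizes[OF m(1)] by (simp add: V_def ZQ_def)
  have MV: "M * V = G * ZS * mat_adjoint G"
    unfolding M_def PS Ga unfolding G(1) using V W U Va Wa Ua ZS by (simp add: assoc cc)
  have M_c: "M \<in> carrier_mat ?d ?d" unfolding M_def PS using V W U Va Wa Ua ZS by (simp add: cc)
  have "pauli_mat Q * (U * pauli_mat S * mat_adjoint U) = V * (ZQ * M)"
    unfolding M_def PQ PS using V W U Va Wa Ua ZS ZQ by (simp add: assoc cc)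
  then have "(\<Sum>i<?d. (pauli_mat Q * (U * pauli_mat S * mat_adjoint U)) $$ (i, i)) = (\<Sum>i<?d. (ZQ * M * V) $$ (i, i))"
    using trace_mult_commute[OF V cc[OF ZQ M_c]] by simp
  also have "ZQ * M * V = ZQ * (G * ZS * mat_adjoint G)"
    using assoc[OF ZQ M_c V] MV by simp
  also have "(\<Sum>i<?d. (ZQ * (G * ZS * mat_adjoint G)) $$ (i, i)) =
    (\<Sum>y<?d. complex_of_real (z_sign Q y) * (\<Sum>x<?d. complex_of_real (z_sign S x) * complex_of_real ((cmod (G $$ (y, x)))\<^sup>2)))"
  proof (intro sum.cong refl)
    fix y assume "y \<in> {..<?d}"
    then have y: "y < ?d" by simp
    have inner: "(G * ZS * mat_adjoint G) $$ (y, y) = (\<Sum>x<?d. complex_of_real (z_sign S x) * complex_of_real ((cmod (G $$ (y, x)))\<^sup>2))"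
    proof -
      have "(G * ZS * mat_adjoint G) $$ (y, y) = (\<Sum>l<?d. \<Sum>k<?d. G $$ (y, k) * ZS $$ (k, l) * mat_adjoint G $$ (l, y))"
        by (rule mult3_mat_entry[OF G(2) ZS Ga_c y y])
      also have "\<dots> = (\<Sum>l<?d. \<Sum>k<?d. if k = l then complex_of_real (z_sign S l) * (G $$ (y, l) * cnj (G $$ (y, l))) else 0)"
      proof (intro sum.cong refl)
        fix l k assume "l \<in> {..<?d}" "k \<in> {..<?d}"
        then show "G $$ (y, k) * ZS $$ (k, l) * mat_adjoint G $$ (l, y) =
          (if k = l then complex_of_real (z_sign S l) * (G $$ (y, l) * cnj (G $$ (y, l))) else 0)"
          using z_string_diag(1)[of k S l] of_real_z_sign[of l S] lQ y carrier_matD[OF G(2)]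
          by (auto simp: ZS_def)
      qed
      also have "\<dots> = (\<Sum>x<?d. complex_of_real (z_sign S x) * complex_of_real ((cmod (G $$ (y, x)))\<^sup>2))"
        by (simp add: complex_norm_square del: of_real_power)
      finally show ?thesis .
    qed
    have "(ZQ * (G * ZS * mat_adjoint G)) $$ (y, y) = (\<Sum>k<?d. ZQ $$ (y, k) * (G * ZS * mat_adjoint G) $$ (k, y))"
      using y carrier_matD[OF ZQ] carrier_matD[OF cc[OF cc[OF G(2) ZS] Ga_c]]
      by (simp add: scalar_prod_def atLeast0LessThan del: assoc_mult_mat)
    also have "\<dots> = (\<Sum>k<?d. if k = y then complex_of_real (z_sign Q y) * (G * ZS * mat_adjoint G) $$ (y, y) else 0)"
    proof (intro sum.cong refl)
      fix k assume "k \<in> {..<?d}"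
      then show "ZQ $$ (y, k) * (G * ZS * mat_adjoint G) $$ (k, y) =
        (if k = y then complex_of_real (z_sign Q y) * (G * ZS * mat_adjoint G) $$ (y, y) else 0)"
        using z_string_diag(1)[of y Q k] of_real_z_sign[of y Q] lQ y by (auto simp: ZQ_def)
    qed
    also have "\<dots> = complex_of_real (z_sign Q y) * (G * ZS * mat_adjoint G) $$ (y, y)" using y by simp
    finally show "(ZQ * (G * ZS * mat_adjoint G)) $$ (y, y) =
      complex_of_real (z_sign Q y) * (\<Sum>x<?d. complex_of_real (z_sign S x) * complex_of_real ((cmod (G $$ (y, x)))\<^sup>2))"
      unfolding inner .
  qed
  also have "\<dots> = complex_of_real (\<Sum>y<?d. \<Sum>x<?d. z_sign S x * z_sign Q y * (cmod (G $$ (y, x)))\<^sup>2)"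
    by (simp add: sum_distrib_left mult_ac)
  also have "\<dots> = complex_of_real (\<Sum>x<?d. \<Sum>y<?d. z_sign S x * z_sign Q y * (cmod (G $$ (y, x)))\<^sup>2)"
    by (subst sum.swap) simp
  finally show ?thesis by simp
qed

text \<open>Each site in the support fixes one of four letters, all other sites are free. A uniform
  setting therefore matches Q with probability 4 to the power minus the weight of Q; this is the
  whole loss of measuring all strings at once.\<close>

lemma card_matches: "4 ^ card (supp Q) * card {s \<in> pauli_strings (length Q). matches Q s} = 4 ^ length Q"
proof (induction Q)
  case Nil
  have "{s \<in> pauli_strings 0. matches [] s} = {[]}" by (auto simp: pauli_strings_def matches_def)
  then show ?case by (simp add: supp_def)
next
  case (Cons q Q)
  let ?A = "{p. q = PI \<or> q = p}" and ?B = "{s \<in> pauli_strings (length Q). matches Q s}"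
  have "{s \<in> pauli_strings (length (q # Q)). matches (q # Q) s} = (\<lambda>(p, s). p # s) ` (?A \<times> ?B)"
  proof (intro Set.set_eqI iffI)
    fix s assume "s \<in> {s \<in> pauli_strings (length (q # Q)). matches (q # Q) s}"
    then show "s \<in> (\<lambda>(p, s). p # s) ` (?A \<times> ?B)"
      by (cases s) (auto simp: pauli_strings_def matches_def)
  qed (auto simp: pauli_strings_def matches_def)
  then have "card {s \<in> pauli_strings (length (q # Q)). matches (q # Q) s} = card (?A \<times> ?B)"
    by (simp add: card_image inj_on_def)
  also have "\<dots> = card ?A * card ?B" by (rule card_cartesian_product)
  finally have c: "card {s \<in> pauli_strings (length (q # Q)). matches (q # Q) s} = card ?A * card ?B" .
  have U: "(UNIV :: pauli set) = {PI, PX, PY, PZ}" using pauli.exhaust by auto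
  have A: "card ?A = (if q = PI then 4 else 1)"
  proof (cases "q = PI")
    case True
    then have "?A = {PI, PX, PY, PZ}" using U by auto
    then have "card ?A = card {PI, PX, PY, PZ}" by simp
    then show ?thesis using True by simp
  qed simp
  have "supp (q # Q) = (if q = PI then {} else {0}) \<union> Suc ` supp Q"
  proof (intro Set.set_eqI iffI)
    fix i assume "i \<in> supp (q # Q)"
    then show "i \<in> (if q = PI then {} else {0}) \<union> Suc ` supp Q"
      by (cases i) (auto simp: supp_def)
  qed (auto simp: supp_def split: if_splits)
  then have "card (supp (q # Q)) = (if q = PI then 0 else 1) + card (supp Q)"
    by (auto simp: card_image card_insert_if)
  then show ?case using Cons unfolding c A by (auto simp: mult_ac)
qed

text \<open>All entries have equal modulus, so measuring after this unitary gives a uniform outcome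
  from any basis state.\<close>

lemma norm_entry_product_basis_X:
  "i < 2 ^ n \<Longrightarrow> j < 2 ^ n \<Longrightarrow> (cmod (product_basis (replicate n PX) $$ (i, j)))\<^sup>2 = 1 / 2 ^ n"
proof (induction n arbitrary: i j)
  case (Suc n)
  have e: "(cmod (eigenbasis PX $$ (a, b)))\<^sup>2 = 1 / 2" if "a < 2" "b < 2" for a b
    using that by (auto simp: less_2_iff mat_of_rows_list_def)
  show ?case using Suc.prems
    by (simp add: index_kron norm_mult power_mult_distrib Suc.IH e less_mult_imp_div_less del: eigenbasis.simps)
qed auto

section \<open>Independent trials\<close>

lemma pmf_born:
  assumes "(\<Sum>j<dim_vec v. (cmod (vec_index v j))\<^sup>2) = 1"
  shows "pmf (born v) j = (if j < dim_vec v then (cmod (vec_index v j))\<^sup>2 else 0)"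
  unfolding born_def
proof (rule pmf_embed_pmf)
  have "(\<integral>\<^sup>+j. ennreal (if j < dim_vec v then (cmod (vec_index v j))\<^sup>2 else 0) \<partial>count_space UNIV) =
    (\<Sum>j<dim_vec v. ennreal (if j < dim_vec v then (cmod (vec_index v j))\<^sup>2 else 0))"
    by (rule nn_integral_count_space') auto
  also have "\<dots> = ennreal (\<Sum>j<dim_vec v. (cmod (vec_index v j))\<^sup>2)"
    by (simp add: sum_ennreal)
  finally show "(\<integral>\<^sup>+j. ennreal (if j < dim_vec v then (cmod (vec_index v j))\<^sup>2 else 0) \<partial>count_space UNIV) = 1"
    using assms by simp
qed simp

lemma mult_unit_vec_index:
  fixes M :: "complex mat"
  assumes "M \<in> carrier_mat d d" "x < d" "y < d"
  shows "vec_index (M *\<^sub>v unit_vec d x) y = M $$ (y, x)"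
  using assms by simp

lemma unitary_column_norm:
  fixes M :: "complex mat"
  assumes M: "M \<in> carrier_mat d d" and "mat_adjoint M * M = 1\<^sub>m d" "x < d"
  shows "(\<Sum>y<d. (cmod (M $$ (y, x)))\<^sup>2) = 1"
proof -
  have "complex_of_real (\<Sum>y<d. (cmod (M $$ (y, x)))\<^sup>2) = (\<Sum>y<d. cnj (M $$ (y, x)) * M $$ (y, x))"
    by (simp add: complex_norm_square mult.commute del: of_real_power)
  also have "\<dots> = (mat_adjoint M * M) $$ (x, x)"
    using M assms(3) by (simp add: scalar_prod_def atLeast0LessThan)
  also have "\<dots> = 1" using assms by simp
  finally show ?thesis by (simp only: of_real_eq_1_iff)
qed

lemma born_unitary_column:
  fixes M :: "complex mat"
  assumes M: "M \<in> carrier_mat d d" "mat_adjoint M * M = 1\<^sub>m d" and x: "x < d"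
  shows "pmf (born (M *\<^sub>v unit_vec d x)) y = (if y < d then (cmod (M $$ (y, x)))\<^sup>2 else 0)"
proof -
  let ?v = "M *\<^sub>v unit_vec d x"
  have d: "dim_vec ?v = d" using M by simp
  have "(\<Sum>y<d. (cmod (vec_index ?v y))\<^sup>2) = (\<Sum>y<d. (cmod (M $$ (y, x)))\<^sup>2)"
    using mult_unit_vec_index[OF M(1) x] by (intro sum.cong) auto
  also have "\<dots> = 1" by (rule unitary_column_norm[OF M x])
  finally show ?thesis
    using pmf_born[of ?v y] mult_unit_vec_index[OF M(1) x, of y] unfolding d by simp
qed

lemma set_pmf_born_unitary_column:
  fixes M :: "complex mat"
  assumes "M \<in> carrier_mat d d" "mat_adjoint M * M = 1\<^sub>m d" "x < d"
  shows "set_pmf (born (M *\<^sub>v unit_vec d x)) \<subseteq> {..<d}"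
  using born_unitary_column[OF assms] by (auto simp: set_pmf_eq split: if_splits)

section \<open>Random settings and a single experiment\<close>

definition draw_uniform :: "nat \<Rightarrow> (nat \<Rightarrow> 'r qalg) \<Rightarrow> 'r qalg" where
  "draw_uniform n f = Apply (product_basis (replicate n PX)) (Measure f)"

text \<open>Classical randomness has to be produced by measurements. The initial state j drops out
  of the right-hand side, and the drawn number b remains in the register as the next basis
  state.\<close>

lemma run_draw_uniform:
  assumes "j < 2 ^ n"
  shows "run H 0 (draw_uniform n f) (unit_vec (2 ^ n) j) =
    bind_pmf (pmf_of_set {..<2 ^ n}) (\<lambda>b. run H 0 (f b) (unit_vec (2 ^ n) b))"
proof -
  let ?M = "product_basis (replicate n PX)"
  have M: "?M \<in> carrier_mat (2 ^ n) (2 ^ n)" using product_basis_carrier[of "replicate n PX"] by simp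
  have u: "mat_adjoint ?M * ?M = 1\<^sub>m (2 ^ n)" using product_basis_unitary(2)[of "replicate n PX"] by simp
  have "born (?M *\<^sub>v unit_vec (2 ^ n) j) = pmf_of_set {..<2 ^ n}"
    using assms lessThan_empty_iff[of "2 ^ n :: nat"]
    by (intro pmf_eqI)
      (simp add: born_unitary_column[OF M u assms] pmf_of_set indicator_def norm_entry_product_basis_X)
  then show ?thesis using M by (simp add: draw_uniform_def)
qed

lemma run_evolve_steps:
  assumes H: "H \<in> carrier_mat d d" and v: "v \<in> carrier_vec d"
  shows "run H 0 ((Evolve t ^^ Suc m) A) v = run H 0 A (evolution H (real (Suc m) * t) *\<^sub>v v)"
  using v
proof (induction m arbitrary: v)
  case (Suc m)
  have c: "evolution H s \<in> carrier_mat d d" for s using H by auto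
  have "run H 0 ((Evolve t ^^ Suc (Suc m)) A) v = run H 0 ((Evolve t ^^ Suc m) A) (evolution H t *\<^sub>v v)"
    by (simp del: kron_one)
  also have "\<dots> = run H 0 A (evolution H (real (Suc m) * t) *\<^sub>v (evolution H t *\<^sub>v v))"
    using c Suc.prems by (intro Suc.IH) (auto intro: mult_mat_vec_carrier)
  also have "evolution H (real (Suc m) * t) *\<^sub>v (evolution H t *\<^sub>v v) = evolution H (real (Suc (Suc m)) * t) *\<^sub>v v"
    unfolding assoc_mult_mat_vec[OF c c Suc.prems, symmetric] evolution_add[OF H] by (simp add: algebra_simps)
  finally show ?case .
qed (simp del: kron_one)

text \<open>Two uniform n-bit numbers carry the randomness of one uniform string. Every bijection
  transports the uniform distribution, so none needs to be specified.\<close>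

definition setting :: "nat \<Rightarrow> nat \<times> nat \<Rightarrow> pauli list" where
  "setting n = (SOME h. bij_betw h ({..<2 ^ n} \<times> {..<2 ^ n}) (pauli_strings n))"

lemma bij_setting: "bij_betw (setting n) ({..<2 ^ n} \<times> {..<2 ^ n}) (pauli_strings n)"
proof -
  let ?A = "{..<2 ^ n} \<times> {..<2 ^ n} :: (nat \<times> nat) set"
  have "card ?A = card (pauli_strings n)"
    by (simp add: card_pauli_strings card_cartesian_product power_mult_distrib[symmetric])
  then have "\<exists>h. bij_betw h ?A (pauli_strings n)"
    by (intro finite_same_card_bij) auto
  then show ?thesis unfolding setting_def by (rule someI_ex)
qed

lemma length_setting: "b < 2 ^ n \<Longrightarrow> b' < 2 ^ n \<Longrightarrow> length (setting n (b, b')) = n"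
  using bij_betw_apply[OF bij_setting, of "(b, b')" n] by (auto simp: pauli_strings_def)

text \<open>The system is prepared in a random eigenstate of the Pauli string that is shifted cyclically
  with respect to the one whose eigenbasis is measured, so that on every qubit the input and the
  output observable anticommute.\<close>

definition trial :: "nat \<Rightarrow> nat \<Rightarrow> real \<Rightarrow> (pauli list \<times> nat \<times> nat \<Rightarrow> 'r qalg) \<Rightarrow> 'r qalg" where
  "trial n m t f =
    draw_uniform n (\<lambda>b. draw_uniform n (\<lambda>b'. draw_uniform n (\<lambda>x.
      Apply (product_basis (map next_pauli (setting n (b, b'))))
        ((Evolve t ^^ m)
          (Apply (mat_adjoint (product_basis (setting n (b, b'))))
            (Measure (\<lambda>y. f (setting n (b, b'), x, y))))))))"

definition transition :: "pauli list \<Rightarrow> complex mat \<Rightarrow> complex mat" where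
  "transition s U = mat_adjoint (product_basis s) * U * product_basis (map next_pauli s)"

definition outcome_pmf :: "nat \<Rightarrow> complex mat \<Rightarrow> (pauli list \<times> nat \<times> nat) pmf" where
  "outcome_pmf n U = do {
    s \<leftarrow> pmf_of_set (pauli_strings n);
    x \<leftarrow> pmf_of_set {..<2 ^ n};
    y \<leftarrow> born (transition s U *\<^sub>v unit_vec (2 ^ n) x);
    return_pmf (s, x, y)}"

lemma transition_carrier:
  assumes "length s = n" "U \<in> carrier_mat (2 ^ n) (2 ^ n)"
  shows "transition s U \<in> carrier_mat (2 ^ n) (2 ^ n)"
proof -
  have V: "mat_adjoint (product_basis s) \<in> carrier_mat (2 ^ n) (2 ^ n)"
    using product_basis_carrier[of s] assms by auto
  have W: "product_basis (map next_pauli s) \<in> carrier_mat (2 ^ n) (2 ^ n)"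
    using product_basis_carrier[of "map next_pauli s"] assms by auto
  show ?thesis unfolding transition_def by (rule mult_carrier_mat[OF mult_carrier_mat[OF V assms(2)] W])
qed

lemma transition_unitary:
  assumes s: "length s = n" and U: "U \<in> carrier_mat (2 ^ n) (2 ^ n)" "mat_adjoint U * U = 1\<^sub>m (2 ^ n)"
  shows "mat_adjoint (transition s U) * transition s U = 1\<^sub>m (2 ^ n)"
proof -
  let ?d = "2 ^ n :: nat"
  define V where "V = product_basis s"
  define W where "W = product_basis (map next_pauli s)"
  have c: "V \<in> carrier_mat ?d ?d" "W \<in> carrier_mat ?d ?d" "mat_adjoint V \<in> carrier_mat ?d ?d"
     "mat_adjoint W \<in> carrier_mat ?d ?d" "mat_adjoint U \<in> carrier_mat ?d ?d"
    using product_basis_carrier[of s] product_basis_carrier[of "map next_pauli s"] s U by (auto simp: V_def W_def)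
  have VV: "V * mat_adjoint V = 1\<^sub>m ?d" and WW: "mat_adjoint W * W = 1\<^sub>m ?d"
    using product_basis_unitary(1)[of s] product_basis_unitary(2)[of "map next_pauli s"] s by (auto simp: V_def W_def)
  have cc: "X * Y \<in> carrier_mat ?d ?d" if "X \<in> carrier_mat ?d ?d" "Y \<in> carrier_mat ?d ?d" for X Y :: "complex mat"
    using that by (rule mult_carrier_mat)
  note assoc = assoc_mult_mat[where n\<^sub>1 = ?d and n\<^sub>2 = ?d and n\<^sub>3 = ?d and n\<^sub>4 = ?d]
  have T: "transition s U = mat_adjoint V * (U * W)"
    unfolding transition_def V_def[symmetric] W_def[symmetric] by (rule assoc[OF c(3) U(1) c(2)])
  have Ta: "mat_adjoint (transition s U) = mat_adjoint W * mat_adjoint U * V"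
    unfolding T mat_adjoint_times[OF c(3) cc[OF U(1) c(2)]] mat_adjoint_times[OF U(1) c(2)] by simp
  have "mat_adjoint (transition s U) * transition s U = mat_adjoint W * mat_adjoint U * (V * (mat_adjoint V * (U * W)))"
    unfolding Ta unfolding T by (rule assoc[OF cc[OF c(4,5)] c(1) cc[OF c(3) cc[OF U(1) c(2)]]])
  also have "V * (mat_adjoint V * (U * W)) = V * mat_adjoint V * (U * W)"
    by (rule assoc[OF c(1,3) cc[OF U(1) c(2)], symmetric])
  also have "\<dots> = U * W" unfolding VV by (rule left_mult_one_mat[OF cc[OF U(1) c(2)]])
  also have "mat_adjoint W * mat_adjoint U * (U * W) = mat_adjoint W * (mat_adjoint U * (U * W))"
    by (rule assoc[OF c(4,5) cc[OF U(1) c(2)]])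
  also have "mat_adjoint U * (U * W) = mat_adjoint U * U * W"
    by (rule assoc[OF c(5) U(1) c(2), symmetric])
  also have "\<dots> = W" unfolding U(2) by (rule left_mult_one_mat[OF c(2)])
  finally show ?thesis unfolding WW .
qed

lemma pair_pmf_of_set:
  assumes "finite A" "A \<noteq> {}" "finite B" "B \<noteq> {}"
  shows "pair_pmf (pmf_of_set A) (pmf_of_set B) = pmf_of_set (A \<times> B)"
proof (rule pmf_eqI)
  fix z :: "'a \<times> 'b"
  show "pmf (pair_pmf (pmf_of_set A) (pmf_of_set B)) z = pmf (pmf_of_set (A \<times> B)) z"
    using assms by (cases z) (simp add: pmf_pair pmf_of_set card_cartesian_product indicator_def)
qed

lemma bind_setting_pmf:
  "bind_pmf (pmf_of_set {..<2 ^ n}) (\<lambda>b. bind_pmf (pmf_of_set {..<2 ^ n}) (\<lambda>b'. F (setting n (b, b')))) =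
    bind_pmf (pmf_of_set (pauli_strings n)) F"
proof -
  let ?A = "{..<2 ^ n} :: nat set"
  have A: "finite ?A" "?A \<noteq> {}" by (auto simp: lessThan_empty_iff)
  have "pmf_of_set (pauli_strings n) = map_pmf (setting n) (pair_pmf (pmf_of_set ?A) (pmf_of_set ?A))"
    unfolding pair_pmf_of_set[OF A A] using A by (intro map_pmf_of_set_bij_betw[OF bij_setting, symmetric]) auto
  then show ?thesis by (simp add: pair_pmf_def map_bind_pmf bind_assoc_pmf bind_return_pmf bind_map_pmf)
qed

text \<open>The start j is arbitrary because a trial leaves the register at its outcome y, where the
  next trial begins. The initial draws erase this memory, so the distribution does not depend on j
  and successive trials are independent.\<close>

lemma run_trial:
  assumes H: "H \<in> carrier_mat (2 ^ n) (2 ^ n)" and j: "j < 2 ^ n"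
  shows "run H 0 (trial n (Suc m) t f) (unit_vec (2 ^ n) j) =
    bind_pmf (outcome_pmf n (evolution H (real (Suc m) * t))) (\<lambda>r. run H 0 (f r) (unit_vec (2 ^ n) (snd (snd r))))"
proof -
  let ?d = "2 ^ n :: nat" and ?U = "evolution H (real (Suc m) * t)"
  let ?F = "\<lambda>s. bind_pmf (pmf_of_set {..<?d}) (\<lambda>x. bind_pmf (born (transition s ?U *\<^sub>v unit_vec ?d x))
    (\<lambda>y. run H 0 (f (s, x, y)) (unit_vec ?d y)))"
  have U: "?U \<in> carrier_mat ?d ?d" using H by auto
  have ne: "{..<?d} \<noteq> {}" by (auto simp: lessThan_empty_iff)
  have inner: "run H 0 (Apply (product_basis (map next_pauli s)) ((Evolve t ^^ Suc m)
      (Apply (mat_adjoint (product_basis s)) (Measure (\<lambda>y. f (s, x, y)))))) (unit_vec ?d x) =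
    bind_pmf (born (transition s ?U *\<^sub>v unit_vec ?d x)) (\<lambda>y. run H 0 (f (s, x, y)) (unit_vec ?d y))"
    if s: "length s = n" and x: "x < ?d" for s x
  proof -
    have V: "mat_adjoint (product_basis s) \<in> carrier_mat ?d ?d"
      using product_basis_carrier[of s] s by auto
    have W: "product_basis (map next_pauli s) \<in> carrier_mat ?d ?d"
      using product_basis_carrier[of "map next_pauli s"] s by auto
    have v: "product_basis (map next_pauli s) *\<^sub>v unit_vec ?d x \<in> carrier_vec ?d"
      using W by (auto intro: mult_mat_vec_carrier)
    have eq: "mat_adjoint (product_basis s) *\<^sub>v (?U *\<^sub>v (product_basis (map next_pauli s) *\<^sub>v unit_vec ?d x)) =
      transition s ?U *\<^sub>v unit_vec ?d x"
      unfolding transition_def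
      using assoc_mult_mat_vec[OF V U v] assoc_mult_mat_vec[OF mult_carrier_mat[OF V U] W, of "unit_vec ?d x"] by simp
    have "run H 0 (Apply (product_basis (map next_pauli s)) ((Evolve t ^^ Suc m)
      (Apply (mat_adjoint (product_basis s)) (Measure (\<lambda>y. f (s, x, y)))))) (unit_vec ?d x) =
      run H 0 (Apply (mat_adjoint (product_basis s)) (Measure (\<lambda>y. f (s, x, y))))
       (?U *\<^sub>v (product_basis (map next_pauli s) *\<^sub>v unit_vec ?d x))"
      unfolding run.simps(2) run_evolve_steps[OF H v] ..
    also have "\<dots> = bind_pmf (born (transition s ?U *\<^sub>v unit_vec ?d x)) (\<lambda>y. run H 0 (f (s, x, y)) (unit_vec ?d y))"
      unfolding run.simps eq using carrier_matD(1)[OF transition_carrier[OF s U]] by (simp add: dim_mult_mat_vec)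
    finally show ?thesis .
  qed
  have "run H 0 (trial n (Suc m) t f) (unit_vec ?d j) =
     bind_pmf (pmf_of_set {..<?d}) (\<lambda>b. bind_pmf (pmf_of_set {..<?d}) (\<lambda>b'. ?F (setting n (b, b'))))"
    unfolding trial_def run_draw_uniform[OF j]
  proof (rule bind_pmf_cong[OF refl])
    fix b assume "b \<in> set_pmf (pmf_of_set {..<?d})"
    then have b: "b < ?d" using ne by (simp add: set_pmf_of_set)
    show "run H 0 (draw_uniform n (\<lambda>b'. draw_uniform n (\<lambda>x. Apply (product_basis (map next_pauli (setting n (b, b'))))
        ((Evolve t ^^ Suc m) (Apply (mat_adjoint (product_basis (setting n (b, b')))) (Measure (\<lambda>y. f (setting n (b, b'), x, y))))))))
       (unit_vec ?d b) = bind_pmf (pmf_of_set {..<?d}) (\<lambda>b'. ?F (setting n (b, b')))"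
      unfolding run_draw_uniform[OF b]
    proof (rule bind_pmf_cong[OF refl])
      fix b' assume "b' \<in> set_pmf (pmf_of_set {..<?d})"
      then have b': "b' < ?d" using ne by (simp add: set_pmf_of_set)
      show "run H 0 (draw_uniform n (\<lambda>x. Apply (product_basis (map next_pauli (setting n (b, b'))))
        ((Evolve t ^^ Suc m) (Apply (mat_adjoint (product_basis (setting n (b, b')))) (Measure (\<lambda>y. f (setting n (b, b'), x, y)))))))
       (unit_vec ?d b') = ?F (setting n (b, b'))"
        unfolding run_draw_uniform[OF b'] using ne
        by (intro bind_pmf_cong[OF refl] inner[OF length_setting[OF b b']]) (simp add: set_pmf_of_set)
    qed
  qed
  also have "\<dots> = bind_pmf (pmf_of_set (pauli_strings n)) ?F" by (rule bind_setting_pmf)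
  finally show ?thesis by (simp add: outcome_pmf_def bind_assoc_pmf bind_return_pmf)
qed

lemma pauli_strings_nonempty [simp]: "pauli_strings n \<noteq> {}"
  using card_pauli_strings[of n] by auto

lemma outcome_pmf_bounds:
  assumes U: "U \<in> carrier_mat (2 ^ n) (2 ^ n)" "mat_adjoint U * U = 1\<^sub>m (2 ^ n)"
    and r: "(s, x, y) \<in> set_pmf (outcome_pmf n U)"
  shows "s \<in> pauli_strings n" "x < 2 ^ n" "y < 2 ^ n"
proof -
  have ne: "{..<2 ^ n :: nat} \<noteq> {}" by (auto simp: lessThan_empty_iff)
  have s: "s \<in> pauli_strings n" and x: "x < 2 ^ n" and y: "y \<in> set_pmf (born (transition s U *\<^sub>v unit_vec (2 ^ n) x))"
    using r ne by (auto simp: outcome_pmf_def set_pmf_of_set)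
  then have "length s = n" by (simp add: pauli_strings_def)
  from set_pmf_born_unitary_column[OF transition_carrier[OF this U(1)] transition_unitary[OF this U] x] y
  show "y < 2 ^ n" by auto
  show "s \<in> pauli_strings n" "x < 2 ^ n" by fact+
qed

section \<open>Repetition of the experiment\<close>

primrec trials :: "nat \<Rightarrow> nat \<Rightarrow> real \<Rightarrow> nat \<Rightarrow> ((pauli list \<times> nat \<times> nat) list \<Rightarrow> 'r) \<Rightarrow> 'r qalg" where
  "trials n m t 0 est = Output (est [])"
| "trials n m t (Suc N) est = trial n m t (\<lambda>r. trials n m t N (\<lambda>rs. est (r # rs)))"

lemma run_trials:
  assumes H: "H \<in> carrier_mat (2 ^ n) (2 ^ n)" "mat_adjoint H = H" and j: "j < 2 ^ n"
  shows "run H 0 (trials n (Suc m) t N est) (unit_vec (2 ^ n) j) =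
    map_pmf est (replicate_pmf N (outcome_pmf n (evolution H (real (Suc m) * t))))"
  using j
proof (induction N arbitrary: est j)
  case (Suc N)
  let ?D = "outcome_pmf n (evolution H (real (Suc m) * t))"
  have "run H 0 (trials n (Suc m) t (Suc N) est) (unit_vec (2 ^ n) j) =
    bind_pmf ?D (\<lambda>r. run H 0 (trials n (Suc m) t N (\<lambda>rs. est (r # rs))) (unit_vec (2 ^ n) (snd (snd r))))"
    unfolding trials.simps by (rule run_trial[OF H(1) Suc.prems])
  also have "\<dots> = bind_pmf ?D (\<lambda>r. map_pmf (\<lambda>rs. est (r # rs)) (replicate_pmf N ?D))"
  proof (rule bind_pmf_cong[OF refl])
    fix r assume "r \<in> set_pmf ?D"
    then have "snd (snd r) < 2 ^ n"
      using outcome_pmf_bounds(3)[OF evolution_carrier[OF H(1)] evolution_unitary(2)[OF H], of "fst r" "fst (snd r)" "snd (snd r)"]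
      by simp
    then show "run H 0 (trials n (Suc m) t N (\<lambda>rs. est (r # rs))) (unit_vec (2 ^ n) (snd (snd r))) =
      map_pmf (\<lambda>rs. est (r # rs)) (replicate_pmf N ?D)" by (rule Suc.IH)
  qed
  also have "\<dots> = map_pmf est (replicate_pmf (Suc N) ?D)"
    by (simp add: map_pmf_def bind_assoc_pmf bind_return_pmf)
  finally show ?case .
qed simp

section \<open>Legality and resource count\<close>

lemma funpow_Evolve:
  "legal d ((Evolve t ^^ m) A) \<longleftrightarrow> (m = 0 \<or> t > 0) \<and> legal d A"
  "total_time d ((Evolve t ^^ m) A) = m * t + total_time d A"
  "evolution_times d ((Evolve t ^^ m) A) \<subseteq> insert t (evolution_times d A)"
  by (induction m) (auto simp: algebra_simps)

lemma legal_draw_uniform: "(\<And>b. b < 2 ^ n \<Longrightarrow> legal (2 ^ n) (f b)) \<Longrightarrow> legal (2 ^ n) (draw_uniform n f)"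
  using product_basis_carrier[of "replicate n PX"] product_basis_unitary(1)[of "replicate n PX"]
  by (simp add: draw_uniform_def)

lemma legal_trial:
  assumes "t > 0" "\<And>r. legal (2 ^ n) (f r)"
  shows "legal (2 ^ n) (trial n m t f)"
  unfolding trial_def
proof (intro legal_draw_uniform)
  fix b b' x :: nat assume "b < 2 ^ n" "b' < 2 ^ n"
  then have len: "length (setting n (b, b')) = n" by (rule length_setting)
  have "mat_adjoint (product_basis (setting n (b, b'))) \<in> carrier_mat (2 ^ n) (2 ^ n)"
    "product_basis (map next_pauli (setting n (b, b'))) \<in> carrier_mat (2 ^ n) (2 ^ n)"
    using product_basis_carrier[of "setting n (b, b')"] product_basis_carrier[of "map next_pauli (setting n (b, b'))"] len
    by auto
  then show "legal (2 ^ n) (Apply (product_basis (map next_pauli (setting n (b, b')))) ((Evolve t ^^ m)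
      (Apply (mat_adjoint (product_basis (setting n (b, b')))) (Measure (\<lambda>y. f (setting n (b, b'), x, y))))))"
    using assms product_basis_unitary(1)[of "map next_pauli (setting n (b, b'))"]
      product_basis_unitary(2)[of "setting n (b, b')"] len
    by (simp add: funpow_Evolve)
qed

text \<open>All branches of a measurement cost the same time, so the worst case over outcomes is
  that common value.\<close>

lemma Max_const: "Max ((\<lambda>j. c) ` {..<2 ^ n :: nat}) = (c :: real)"
proof -
  have "(\<lambda>j. c) ` {..<2 ^ n :: nat} = {c}" by (auto simp: image_iff intro!: exI[of _ 0])
  then show ?thesis by simp
qed

lemma total_time_trial:
  assumes "\<And>r. total_time (2 ^ n) (f r) = T"
  shows "total_time (2 ^ n) (trial n m t f) = m * t + T"
  by (simp add: trial_def draw_uniform_def funpow_Evolve assms Max_const)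

lemma evolution_times_trial:
  assumes "\<And>r. evolution_times (2 ^ n) (f r) \<subseteq> {t}"
  shows "evolution_times (2 ^ n) (trial n m t f) \<subseteq> {t}"
proof -
  have "evolution_times (2 ^ n) ((Evolve t ^^ m) A) \<subseteq> {t}" if "evolution_times (2 ^ n) A \<subseteq> {t}" for A :: "'a qalg"
    using funpow_Evolve(3)[where d = "2 ^ n" and t = t and m = m and A = A] that by auto
  then show ?thesis using assms unfolding trial_def draw_uniform_def evolution_times.simps
    by (intro UN_least) (simp add: UN_least)
qed

lemma trials_resources:
  assumes "t > 0"
  shows "legal (2 ^ n) (trials n m t N est)"
    "total_time (2 ^ n) (trials n m t N est) = N * (m * t)"
    "evolution_times (2 ^ n) (trials n m t N est) \<subseteq> {t}"
proof -
  show "legal (2 ^ n) (trials n m t N est)"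
    by (induction N arbitrary: est) (auto intro: legal_trial assms)
  show "total_time (2 ^ n) (trials n m t N est) = N * (m * t)"
    by (induction N arbitrary: est) (simp_all add: total_time_trial algebra_simps)
  show "evolution_times (2 ^ n) (trials n m t N est) \<subseteq> {t}"
    by (induction N arbitrary: est) (simp_all add: evolution_times_trial)
qed

section \<open>Concentration of empirical means\<close>

lemma exp_moment_replicate_pmf:
  fixes f :: "'a \<Rightarrow> real"
  shows "(\<integral>\<^sup>+xs. ennreal (exp (l * (\<Sum>x\<leftarrow>xs. f x))) \<partial>replicate_pmf N p) = (\<integral>\<^sup>+x. ennreal (exp (l * f x)) \<partial>p) ^ N"
proof (induction N)
  case (Suc N)
  have "(\<integral>\<^sup>+xs. ennreal (exp (l * (\<Sum>x\<leftarrow>xs. f x))) \<partial>replicate_pmf (Suc N) p) =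
    (\<integral>\<^sup>+x. (\<integral>\<^sup>+xs. ennreal (exp (l * f x)) * ennreal (exp (l * (\<Sum>x\<leftarrow>xs. f x))) \<partial>replicate_pmf N p) \<partial>p)"
    by (simp add: distrib_left exp_add ennreal_mult')
  also have "\<dots> = (\<integral>\<^sup>+x. ennreal (exp (l * f x)) * (\<integral>\<^sup>+x. ennreal (exp (l * f x)) \<partial>p) ^ N \<partial>p)"
    using Suc by (simp add: nn_integral_cmult)
  also have "\<dots> = (\<integral>\<^sup>+x. ennreal (exp (l * f x)) \<partial>p) ^ Suc N"
    by (simp add: nn_integral_multc)
  finally show ?case .
qed simp

text \<open>Chernoff's method with exponent \<tau>: on an interval of length 2 Hoeffding's lemma
  bounds each centred exponential moment by exp (\<tau>^2 / 2), and l = \<tau> minimises N l^2 / 2 -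
  l N \<tau>.\<close>

lemma replicate_pmf_upper_tail:
  fixes f :: "'a \<Rightarrow> real" and p :: "'a pmf"
  assumes f: "\<And>x. \<bar>f x\<bar> \<le> 1" and \<tau>: "\<tau> > 0"
  defines "\<mu> \<equiv> measure_pmf.expectation p f"
  shows "measure_pmf.prob (replicate_pmf N p) {xs. (\<Sum>x\<leftarrow>xs. f x - \<mu>) \<ge> N * \<tau>} \<le> exp (- (N * \<tau>\<^sup>2 / 2))"
proof -
  interpret interval_bounded_random_variable "measure_pmf p" f "-1" 1
    using f by unfold_locales (auto simp: abs_le_iff minus_le_iff)
  let ?g = "\<lambda>xs. ennreal (exp (\<tau> * (\<Sum>x\<leftarrow>xs. f x - \<mu>)))"
  have "(\<integral>\<^sup>+x. ennreal (exp (\<tau> * (f x - \<mu>))) \<partial>p) \<le> ennreal (exp (\<tau>\<^sup>2 / 2))"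
    using Hoeffdings_lemma_nn_integral[OF \<tau>] by (simp add: \<mu>_def)
  then have m: "(\<integral>\<^sup>+xs. ?g xs \<partial>replicate_pmf N p) \<le> ennreal (exp (\<tau>\<^sup>2 / 2)) ^ N"
    by (subst exp_moment_replicate_pmf) (rule power_mono, auto)
  have "emeasure (measure_pmf (replicate_pmf N p)) {xs. (\<Sum>x\<leftarrow>xs. f x - \<mu>) \<ge> N * \<tau>} =
    emeasure (measure_pmf (replicate_pmf N p)) {xs\<in>UNIV. 1 \<le> ennreal (exp (- (\<tau> * (N * \<tau>)))) * ?g xs}"
  proof (intro arg_cong2[where f = emeasure] refl Collect_cong)
    fix xs :: "'a list"
    have "1 \<le> ennreal (exp (- (\<tau> * (N * \<tau>)))) * ?g xs \<longleftrightarrow> 1 \<le> exp (\<tau> * (\<Sum>x\<leftarrow>xs. f x - \<mu>) - \<tau> * (N * \<tau>))"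
      by (simp add: ennreal_mult'[symmetric] exp_add[symmetric] add.commute
          flip: ennreal_1 del: one_le_exp_iff ennreal_1)
    also have "\<dots> \<longleftrightarrow> \<tau> * (\<Sum>x\<leftarrow>xs. f x - \<mu>) \<ge> \<tau> * (N * \<tau>)" by simp
    also have "\<dots> \<longleftrightarrow> (\<Sum>x\<leftarrow>xs. f x - \<mu>) \<ge> N * \<tau>" using \<tau> by simp
    finally show "((\<Sum>x\<leftarrow>xs. f x - \<mu>) \<ge> N * \<tau>) = (xs \<in> UNIV \<and> 1 \<le> ennreal (exp (- (\<tau> * (N * \<tau>)))) * ?g xs)"
      by simp
  qed
  also have "\<dots> \<le> ennreal (exp (- (\<tau> * (N * \<tau>)))) * (\<integral>\<^sup>+xs. ?g xs * indicator UNIV xs \<partial>measure_pmf (replicate_pmf N p))"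
    using nn_integral_Markov_inequality[of ?g UNIV "measure_pmf (replicate_pmf N p)" "ennreal (exp (- (\<tau> * (N * \<tau>))))"]
    by simp
  also have "\<dots> \<le> ennreal (exp (- (\<tau> * (N * \<tau>)))) * ennreal (exp (\<tau>\<^sup>2 / 2)) ^ N"
    using m by (intro mult_left_mono) auto
  also have "\<dots> = ennreal (exp (- (N * \<tau>\<^sup>2 / 2)))"
    by (simp add: ennreal_power ennreal_mult'[symmetric] exp_of_nat_mult[symmetric] exp_add[symmetric]
        power2_eq_square algebra_simps)
  finally show ?thesis by (simp add: measure_pmf.emeasure_eq_measure)
qed

lemma replicate_pmf_two_sided_tail:
  fixes f :: "'a \<Rightarrow> real" and p :: "'a pmf"
  assumes f: "\<And>x. \<bar>f x\<bar> \<le> 1" and \<tau>: "\<tau> > 0" and N: "N > 0"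
  shows "measure_pmf.prob (replicate_pmf N p)
      {xs. \<bar>(\<Sum>x\<leftarrow>xs. f x) / N - measure_pmf.expectation p f\<bar> \<ge> \<tau>} \<le> 2 * exp (- (N * \<tau>\<^sup>2 / 2))"
proof -
  define \<mu> where "\<mu> = measure_pmf.expectation p f"
  let ?P = "measure_pmf.prob (replicate_pmf N p)"
  let ?U = "{xs. (\<Sum>x\<leftarrow>xs. f x - \<mu>) \<ge> N * \<tau>}" and ?L = "{xs. (\<Sum>x\<leftarrow>xs. - f x - (- \<mu>)) \<ge> N * \<tau>}"
  have eq1: "(\<Sum>x\<leftarrow>xs. f x - \<mu>) = (\<Sum>x\<leftarrow>xs. f x) - length xs * \<mu>"
    and eq2: "(\<Sum>x\<leftarrow>xs. - f x - - \<mu>) = length xs * \<mu> - (\<Sum>x\<leftarrow>xs. f x)" for xs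
    by (induction xs) (auto simp: algebra_simps)
  have "?P {xs. \<bar>(\<Sum>x\<leftarrow>xs. f x) / N - \<mu>\<bar> \<ge> \<tau>} \<le> ?P (?U \<union> ?L)"
  proof (rule measure_pmf.finite_measure_mono_AE)
    \<comment> \<open>The inclusion uses that the list has length N, which holds almost
      surely.\<close>
    show "AE xs in replicate_pmf N p. xs \<in> {xs. \<bar>(\<Sum>x\<leftarrow>xs. f x) / N - \<mu>\<bar> \<ge> \<tau>} \<longrightarrow> xs \<in> ?U \<union> ?L"
    proof (rule AE_pmfI, rule impI)
      fix xs assume xs: "xs \<in> set_pmf (replicate_pmf N p)" and "xs \<in> {xs. \<bar>(\<Sum>x\<leftarrow>xs. f x) / N - \<mu>\<bar> \<ge> \<tau>}"
      then have le: "\<tau> \<le> \<bar>(\<Sum>x\<leftarrow>xs. f x) / N - \<mu>\<bar>" by simp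
      have len: "length xs = N" using xs by (auto simp: set_replicate_pmf)
      have "N * \<tau> \<le> N * \<bar>(\<Sum>x\<leftarrow>xs. f x) / N - \<mu>\<bar>" using le by (intro mult_left_mono) auto
      also have "\<dots> = \<bar>N * ((\<Sum>x\<leftarrow>xs. f x) / N - \<mu>)\<bar>" by (simp add: abs_mult)
      also have "\<dots> = \<bar>(\<Sum>x\<leftarrow>xs. f x) - N * \<mu>\<bar>" using N by (simp add: right_diff_distrib)
      finally have "N * \<tau> \<le> (\<Sum>x\<leftarrow>xs. f x) - N * \<mu> \<or> N * \<tau> \<le> N * \<mu> - (\<Sum>x\<leftarrow>xs. f x)"
        by linarith
      then show "xs \<in> ?U \<union> ?L" unfolding Un_iff mem_Collect_eq eq1 eq2 len .
    qed
  qed simp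
  also have "\<dots> \<le> ?P ?U + ?P ?L" by (rule measure_Un_le) auto
  also have "?P ?U \<le> exp (- (N * \<tau>\<^sup>2 / 2))"
    unfolding \<mu>_def using f \<tau> by (rule replicate_pmf_upper_tail)
  also have "?P ?L \<le> exp (- (N * \<tau>\<^sup>2 / 2))"
    using replicate_pmf_upper_tail[of "\<lambda>x. - f x" \<tau> N p] f \<tau> by (simp add: \<mu>_def)
  finally show ?thesis by (simp add: \<mu>_def)
qed

section \<open>Estimating the coefficients\<close>

text \<open>At the probe site a matching s carries the successor of the letter of P, so the shifted
  setting carries the second successor, the letter of \<open>in_probe\<close>. The condition for
  preparing S is thus implied by the one for measuring Q and costs no further probability.\<close>

lemma matches_in_probe:
  assumes "supp P \<noteq> {}" "matches (out_probe P) s"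
  shows "matches (in_probe P) (map next_pauli s)"
  unfolding matches_def
proof (rule list_all2_all_nthI)
  have len: "length s = length P" using assms(2) by (auto simp: matches_def dest: list_all2_lengthD)
  then show "length (in_probe P) = length (map next_pauli s)" by simp
  fix i assume "i < length (in_probe P)"
  moreover have "out_probe P ! probe_site P = PI \<or> out_probe P ! probe_site P = s ! probe_site P"
    using list_all2_nthD[OF assms(2)[unfolded matches_def], of "probe_site P"] probe_site(1)[OF assms(1)] by simp
  then have "next_pauli (P ! probe_site P) = s ! probe_site P"
    using probe_site[OF assms(1)] by (simp add: out_probe_def)
  ultimately show "in_probe P ! i = PI \<or> in_probe P ! i = map next_pauli s ! i"
    using len by (cases "i = probe_site P") (auto simp: in_probe_def)
qed

text \<open>The value 0 for nonmatching settings lets one data set serve all P, at the price of a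
  damped mean. The range conditions on x and y hold for actual outcomes and make the statistic
  bounded everywhere, as the tail bound demands.\<close>

definition probe_statistic :: "pauli list \<Rightarrow> pauli list \<times> nat \<times> nat \<Rightarrow> real" where
  "probe_statistic P = (\<lambda>(s, x, y). if matches (out_probe P) s \<and> x < 2 ^ length P \<and> y < 2 ^ length P
    then z_sign (in_probe P) x * z_sign (out_probe P) y else 0)"

lemma abs_probe_statistic: "\<bar>probe_statistic P r\<bar> \<le> 1"
proof -
  obtain s x y where r: "r = (s, x, y)" by (cases r)
  show ?thesis
  proof (cases "x < 2 ^ length P \<and> y < 2 ^ length P")
    case True
    then have "\<bar>z_sign (in_probe P) x\<bar> = 1" "\<bar>z_sign (out_probe P) y\<bar> = 1"
      by (simp_all add: abs_z_sign)
    then show ?thesis unfolding r probe_statistic_def by (simp add: abs_mult)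
  qed (auto simp: r probe_statistic_def)
qed

lemma probe_mean_eq_measured_sum:
  fixes l :: "pauli list \<Rightarrow> complex" and T :: real
  assumes l: "purely_imaginary n l" and P: "P \<in> pauli_strings n" "supp P \<noteq> {}"
    and s: "matches (out_probe P) s"
  defines "U \<equiv> evolution (hamiltonian n l) T"
  shows "complex_of_real (\<Sum>x<2 ^ n. \<Sum>y<2 ^ n.
      z_sign (in_probe P) x * z_sign (out_probe P) y * (cmod (transition s U $$ (y, x)))\<^sup>2) = 2 ^ n * probe_mean n l T P"
proof -
  have len: "length P = n" "length s = n"
    using P s by (auto simp: pauli_strings_def matches_def dest: list_all2_lengthD)
  have U: "U \<in> carrier_mat (2 ^ n) (2 ^ n)" by (auto simp: U_def)
  have "mat_adjoint U = evolution (hamiltonian n l) (- T)"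
    unfolding U_def by (rule mat_adjoint_evolution[OF hamiltonian_carrier hamiltonian_hermitian[OF l]])
  then show ?thesis
    using basis_measurement_trace[OF s matches_in_probe[OF P(2) s] len(2) _ U] len
      heisenberg_trace[of "out_probe P" n "in_probe P" l T]
    by (simp add: transition_def probe_mean_def pauli_strings_def U_def)
qed

text \<open>It is a real combination of transition probabilities; \<open>out_probe P\<close> itself
  serves as a matching setting.\<close>

lemma probe_mean_real:
  assumes "purely_imaginary n l" "P \<in> pauli_strings n" "supp P \<noteq> {}"
  shows "probe_mean n l T P = complex_of_real (Re (probe_mean n l T P))"
proof -
  have "matches (out_probe P) (out_probe P)" by (simp add: matches_def list.rel_refl)
  from probe_mean_eq_measured_sum[OF assms this, of T, symmetric]
  have "Im (2 ^ n * probe_mean n l T P) = 0" by (simp only: Im_complex_of_real)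
  moreover have "(2 :: complex) ^ n = complex_of_real (2 ^ n)" by simp
  ultimately have "Im (probe_mean n l T P) = 0" by (simp del: of_real_power)
  then show ?thesis by (simp add: complex_eq_iff)
qed

text \<open>The denominator is the inverse probability that a uniform setting matches. Given a
  match, the uniform choice of x supplies the normalisation of the trace.\<close>

lemma probe_statistic_expectation:
  fixes l :: "pauli list \<Rightarrow> complex"
  assumes l: "purely_imaginary n l" and P: "P \<in> pauli_strings n" "supp P \<noteq> {}"
  shows "measure_pmf.expectation (outcome_pmf n (evolution (hamiltonian n l) T)) (probe_statistic P) =
    Re (probe_mean n l T P) / 4 ^ card (supp P)"
proof -
  let ?d = "2 ^ n :: nat" and ?X = "pauli_strings n"
  define U where "U = evolution (hamiltonian n l) T"
  define pm where "pm = Re (probe_mean n l T P)"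
  have len: "length P = n" using P by (simp add: pauli_strings_def)
  have U: "U \<in> carrier_mat ?d ?d" "mat_adjoint U * U = 1\<^sub>m ?d"
    unfolding U_def using evolution_unitary(2)[OF hamiltonian_carrier hamiltonian_hermitian[OF l]] by auto
  have ne: "{..<?d} \<noteq> {}" by (auto simp: lessThan_empty_iff)
  let ?B = "\<lambda>s x. born (transition s U *\<^sub>v unit_vec ?d x)"
  have born: "pmf (?B s x) y = (if y < ?d then (cmod (transition s U $$ (y, x)))\<^sup>2 else 0)"
    and set_born: "set_pmf (?B s x) \<subseteq> {..<?d}" if "s \<in> ?X" "x < ?d" for s x y
    using that transition_carrier[OF _ U(1), of s] transition_unitary[OF _ U, of s]
    by (auto simp: pauli_strings_def born_unitary_column dest!: set_pmf_born_unitary_column[THEN subsetD, rotated 3])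
  have fin: "finite (set_pmf (?B s x \<bind> (\<lambda>y. return_pmf (s, x, y))))" if "s \<in> ?X" "x < ?d" for s x
    using finite_subset[OF set_born[OF that]] by simp
  have inner: "measure_pmf.expectation (?B s x \<bind> (\<lambda>y. return_pmf (s, x, y))) (probe_statistic P) =
     (\<Sum>y<?d. (cmod (transition s U $$ (y, x)))\<^sup>2 * probe_statistic P (s, x, y))" if s: "s \<in> ?X" and x: "x < ?d" for s x
  proof -
    have "measure_pmf.expectation (?B s x \<bind> (\<lambda>y. return_pmf (s, x, y))) (probe_statistic P) =
      measure_pmf.expectation (?B s x) (\<lambda>y. probe_statistic P (s, x, y))"
      by (simp add: map_pmf_def[symmetric])
    also have "\<dots> = (\<Sum>y<?d. pmf (?B s x) y *\<^sub>R probe_statistic P (s, x, y))"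
      using set_born[OF s x] by (intro integral_measure_pmf) auto
    finally show ?thesis using born[OF s x] by simp
  qed
  \<comment> \<open>The contribution of one matching setting is the same for all of them, so that
    only their number matters.\<close>
  have setting: "(\<Sum>x<?d. \<Sum>y<?d. (cmod (transition s U $$ (y, x)))\<^sup>2 * probe_statistic P (s, x, y)) =
     (if matches (out_probe P) s then ?d * pm else 0)" for s
  proof (cases "matches (out_probe P) s")
    case True
    have "(\<Sum>x<?d. \<Sum>y<?d. (cmod (transition s U $$ (y, x)))\<^sup>2 * probe_statistic P (s, x, y)) =
      (\<Sum>x<?d. \<Sum>y<?d. z_sign (in_probe P) x * z_sign (out_probe P) y * (cmod (transition s U $$ (y, x)))\<^sup>2)"
      using True len by (intro sum.cong refl) (simp add: probe_statistic_def)
    also have "\<dots> = Re (2 ^ n * probe_mean n l T P)"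
      using arg_cong[OF probe_mean_eq_measured_sum[OF l P True, of T], of Re]
      unfolding U_def[symmetric] by (simp only: Re_complex_of_real)
    also have "2 ^ n * probe_mean n l T P = complex_of_real (2 ^ n * pm)"
      using probe_mean_real[OF l P, of T] by (simp add: pm_def)
    also have "Re \<dots> = ?d * pm" by (simp only: Re_complex_of_real) simp
    finally show ?thesis using True by simp
  qed (simp add: probe_statistic_def)
  have "measure_pmf.expectation (outcome_pmf n U) (probe_statistic P) =
    (\<Sum>s\<in>?X. measure_pmf.expectation (pmf_of_set {..<?d} \<bind> (\<lambda>x. ?B s x \<bind> (\<lambda>y. return_pmf (s, x, y)))) (probe_statistic P) /\<^sub>R card ?X)"
    unfolding outcome_pmf_def using fin ne by (intro pmf_expectation_bind_pmf_of_set) (auto simp: set_pmf_of_set)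
  also have "\<dots> = (\<Sum>s\<in>?X. (\<Sum>x<?d. (\<Sum>y<?d. (cmod (transition s U $$ (y, x)))\<^sup>2 * probe_statistic P (s, x, y)) /\<^sub>R ?d) /\<^sub>R card ?X)"
  proof (rule sum.cong[OF refl])
    fix s assume s: "s \<in> ?X"
    have "measure_pmf.expectation (pmf_of_set {..<?d} \<bind> (\<lambda>x. ?B s x \<bind> (\<lambda>y. return_pmf (s, x, y)))) (probe_statistic P) =
      (\<Sum>x<?d. measure_pmf.expectation (?B s x \<bind> (\<lambda>y. return_pmf (s, x, y))) (probe_statistic P) /\<^sub>R card {..<?d})"
      using fin[OF s] ne by (intro pmf_expectation_bind_pmf_of_set) auto
    then show "measure_pmf.expectation (pmf_of_set {..<?d} \<bind> (\<lambda>x. ?B s x \<bind> (\<lambda>y. return_pmf (s, x, y)))) (probe_statistic P) /\<^sub>R card ?X =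
      (\<Sum>x<?d. (\<Sum>y<?d. (cmod (transition s U $$ (y, x)))\<^sup>2 * probe_statistic P (s, x, y)) /\<^sub>R ?d) /\<^sub>R card ?X"
      using inner[OF s] by simp
  qed
  also have "\<dots> = (\<Sum>s\<in>?X. (if matches (out_probe P) s then pm else 0) / 4 ^ n)"
  proof (rule sum.cong[OF refl])
    fix s
    have "(\<Sum>x<?d. (\<Sum>y<?d. (cmod (transition s U $$ (y, x)))\<^sup>2 * probe_statistic P (s, x, y)) /\<^sub>R ?d) =
      (\<Sum>x<?d. \<Sum>y<?d. (cmod (transition s U $$ (y, x)))\<^sup>2 * probe_statistic P (s, x, y)) / ?d"
      unfolding sum_divide_distrib by (intro sum.cong refl) (simp add: divide_inverse sum_distrib_left mult_ac)
    also have "\<dots> = (if matches (out_probe P) s then pm else 0)" unfolding setting by simp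
    finally show "(\<Sum>x<?d. (\<Sum>y<?d. (cmod (transition s U $$ (y, x)))\<^sup>2 * probe_statistic P (s, x, y)) /\<^sub>R ?d) /\<^sub>R card ?X =
      (if matches (out_probe P) s then pm else 0) / 4 ^ n"
      by (simp add: card_pauli_strings divide_inverse)
  qed
  also have "\<dots> = card {s \<in> ?X. matches (out_probe P) s} * pm / 4 ^ n"
    by (simp add: sum_divide_distrib[symmetric] sum.inter_filter[symmetric])
  also have "\<dots> = pm / 4 ^ card (supp P)"
  proof -
    have "real (4 ^ card (supp P) * card {s \<in> ?X. matches (out_probe P) s}) = real (4 ^ n)"
      using card_matches[of "out_probe P"] len supp_out_probe[OF P(2)] by (simp only: length_probe)
    then have "4 ^ card (supp P) * real (card {s \<in> ?X. matches (out_probe P) s}) = 4 ^ n" by simp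
    then show ?thesis by (simp add: field_simps)
  qed
  finally show ?thesis by (simp add: U_def pm_def)
qed

section \<open>Counting strings of low weight\<close>

definition low_weight :: "nat \<Rightarrow> nat \<Rightarrow> pauli list set" where
  "low_weight k n = {P \<in> pauli_strings n. supp P \<noteq> {} \<and> card (supp P) \<le> k}"

text \<open>Every string of weight at most k + 1 arises from one of weight at most k by overwriting
  one letter, with n sites and 4 letters to choose from.\<close>

lemma card_weight_le:
  assumes "n \<ge> 1"
  shows "card {P \<in> pauli_strings n. card (supp P) \<le> k} \<le> (4 * n) ^ k"
proof (induction k)
  case 0
  have "{P \<in> pauli_strings n. card (supp P) \<le> 0} \<subseteq> {replicate n PI}"
    using supp_nonempty_iff by (auto simp: pauli_strings_def)
  from card_mono[OF _ this] show ?case by simp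
next
  case (Suc k)
  let ?W = "\<lambda>k. {P \<in> pauli_strings n. card (supp P) \<le> k}"
  have U: "(UNIV :: pauli set) = {PI, PX, PY, PZ}" using pauli.exhaust by auto
  have cU: "card (UNIV :: pauli set) = 4" "finite (UNIV :: pauli set)" unfolding U by simp_all
  have "?W (Suc k) \<subseteq> (\<lambda>(P, i, p). P[i := p]) ` (?W k \<times> {..<n} \<times> UNIV)"
  proof
    fix P assume "P \<in> ?W (Suc k)"
    then have P: "length P = n" "card (supp P) \<le> Suc k" by (auto simp: pauli_strings_def)
    show "P \<in> (\<lambda>(P, i, p). P[i := p]) ` (?W k \<times> {..<n} \<times> UNIV)"
    proof (cases "supp P = {}")
      case True
      \<comment> \<open>The identity string is reached by overwriting site 0 with its own letter;
        this site exists because n \<ge> 1.\<close>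
      then have "(P, 0, P ! 0) \<in> ?W k \<times> {..<n} \<times> UNIV" using P assms by (auto simp: pauli_strings_def)
      then show ?thesis by (rule rev_image_eqI) simp
    next
      case False
      then obtain i where i: "i \<in> supp P" by auto
      have "supp (P[i := PI]) = supp P - {i}"
        using i by (auto simp: supp_def nth_list_update split: if_splits)
      then have "card (supp (P[i := PI])) \<le> k" using i P by (simp add: card_Diff_singleton)
      moreover have "i < n" using i P by (simp add: supp_def)
      ultimately have "(P[i := PI], i, P ! i) \<in> ?W k \<times> {..<n} \<times> UNIV" using P by (auto simp: pauli_strings_def)
      then show ?thesis by (rule rev_image_eqI) simp
    qed
  qed
  then have "card (?W (Suc k)) \<le> card (?W k \<times> {..<n} \<times> (UNIV :: pauli set))"
    using cU by (intro surj_card_le) auto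
  also have "\<dots> = card (?W k) * (4 * n)" by (simp add: card_cartesian_product cU)
  also have "\<dots> \<le> (4 * n) ^ Suc k" using Suc by simp
  finally show ?case .
qed

lemma low_weight_card: "n \<ge> 1 \<Longrightarrow> card (low_weight k n) \<le> (4 * n) ^ k"
  unfolding low_weight_def by (rule order_trans[OF card_mono card_weight_le[of n k]]) auto

lemma finite_low_weight [simp, intro]: "finite (low_weight k n)"
  by (rule finite_subset[OF _ finite_pauli_strings[of n]]) (auto simp: low_weight_def)

section \<open>The estimator and its accuracy\<close>

definition admissible :: "nat \<Rightarrow> nat \<Rightarrow> real \<Rightarrow> (pauli list \<Rightarrow> complex) \<Rightarrow> bool" where
  "admissible k n g l \<longleftrightarrow> purely_imaginary n l \<and> k_local k n l \<and> norm_B1 n l \<le> g"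

definition empirical_mean :: "(pauli list \<times> nat \<times> nat) list \<Rightarrow> pauli list \<Rightarrow> real" where
  "empirical_mean rs P = (\<Sum>r\<leftarrow>rs. probe_statistic P r) / length rs"

definition consistent :: "nat \<Rightarrow> nat \<Rightarrow> real \<Rightarrow> real \<Rightarrow> (pauli list \<times> nat \<times> nat) list \<Rightarrow> (pauli list \<Rightarrow> complex) \<Rightarrow> bool" where
  "consistent k n T \<tau> rs l \<longleftrightarrow>
    (\<forall>P\<in>low_weight k n. \<bar>empirical_mean rs P - Re (probe_mean n l T P) / 4 ^ card (supp P)\<bar> \<le> \<tau>)"

text \<open>Whenever the true family is consistent with the data a choice exists; otherwise the
  value is arbitrary, which is part of the failure event.\<close>

definition estimate :: "nat \<Rightarrow> nat \<Rightarrow> real \<Rightarrow> real \<Rightarrow> real \<Rightarrow> (pauli list \<times> nat \<times> nat) list \<Rightarrow> pauli list \<Rightarrow> complex" where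
  "estimate k n g T \<tau> rs = traceless_part n (SOME l. admissible k n g l \<and> consistent k n T \<tau> rs l)"

lemma norm_inf_le_iff: "norm_inf n f \<le> \<epsilon> \<longleftrightarrow> (\<forall>P\<in>pauli_strings n. cmod (f P) \<le> \<epsilon>)"
  unfolding norm_inf_def by (subst Max_le_iff) auto

lemma supp_eq_empty_iff: "P \<in> pauli_strings n \<Longrightarrow> supp P = {} \<longleftrightarrow> P = replicate n PI"
  using supp_nonempty_iff[of P] by (auto simp: pauli_strings_def)

text \<open>Separation is available only at a string P of maximal difference, which then bounds the
  difference at R. At P the damped means of both families lie within 2 \<tau> of each other; undoing
  the damping costs at most 4^k. Strings heavier than k have no coefficient in either
  family.\<close>

lemma consistent_imp_close:
  assumes l: "admissible k n g l" and l': "admissible k n g l'"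
    and c: "consistent k n T \<tau> rs l" "consistent k n T \<tau> rs l'"
    and g: "g \<ge> 0" and k: "k \<ge> 1" and T: "T > 0" "2 * g * k * T \<le> 1 / 81"
    and R: "R \<in> pauli_strings n" "supp R \<noteq> {}"
  shows "T * cmod (l R - l' R) \<le> 2 * 4 ^ k * \<tau>"
proof -
  let ?Y = "{P \<in> pauli_strings n. supp P \<noteq> {}}"
  have "finite ?Y" "?Y \<noteq> {}" using R by auto
  then have "Max ((\<lambda>P. cmod (l P - l' P)) ` ?Y) \<in> (\<lambda>P. cmod (l P - l' P)) ` ?Y"
    by (intro Max_in) auto
  then obtain P where "P \<in> ?Y" and maxP: "Max ((\<lambda>P. cmod (l P - l' P)) ` ?Y) = cmod (l P - l' P)"
    by (rule imageE)
  then have P: "P \<in> pauli_strings n" "supp P \<noteq> {}" by auto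
  have max: "cmod (l S - l' S) \<le> cmod (l P - l' P)" if "S \<in> pauli_strings n" "supp S \<noteq> {}" for S
    unfolding maxP[symmetric] using that \<open>finite ?Y\<close> by (intro Max_ge) auto
  have bound: "T * cmod (l P - l' P) \<le> 2 * 4 ^ k * \<tau>" if wt: "card (supp P) \<le> k"
  proof -
    have low: "P \<in> low_weight k n" using P wt by (simp add: low_weight_def)
    define w :: real where "w = 4 ^ card (supp P)"
    have w: "0 < w" "w \<le> 4 ^ k" using wt by (auto simp: w_def intro: power_increasing)
    have "\<bar>Re (probe_mean n l T P) / w - Re (probe_mean n l' T P) / w\<bar> \<le> 2 * \<tau>"
      using c low unfolding consistent_def w_def by (smt (verit))
    then have "\<bar>Re (probe_mean n l T P) - Re (probe_mean n l' T P)\<bar> \<le> 2 * \<tau> * w"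
      using w by (simp add: diff_divide_distrib[symmetric] abs_divide divide_le_eq)
    moreover have "\<tau> \<ge> 0" using c(1) low abs_ge_zero order_trans unfolding consistent_def by blast
    then have "2 * \<tau> * w \<le> 2 * \<tau> * 4 ^ k" using w by (intro mult_left_mono) auto
    moreover have "T * cmod (l P - l' P) \<le> cmod (probe_mean n l T P - probe_mean n l' T P)"
      using l l' g k T P wt max unfolding admissible_def by (intro probe_mean_separates[where g = g and k = k]) auto
    moreover have "cmod (probe_mean n l T P - probe_mean n l' T P) = \<bar>Re (probe_mean n l T P) - Re (probe_mean n l' T P)\<bar>"
    proof -
      have "probe_mean n l T P - probe_mean n l' T P = complex_of_real (Re (probe_mean n l T P) - Re (probe_mean n l' T P))"
        using probe_mean_real[OF _ P, of l T] probe_mean_real[OF _ P, of l' T] l l'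
        by (simp add: admissible_def)
      then show ?thesis by (simp only: norm_of_real)
    qed
    ultimately show ?thesis by (simp add: mult_ac)
  qed
  show ?thesis
  proof (cases "card (supp R) \<le> k")
    case False
    then have "l R = 0" "l' R = 0" using l l' R by (auto simp: admissible_def k_local_def)
    moreover have "\<tau> \<ge> 0"
    proof -
      define i where "i = probe_site R"
      have i: "i < n" using probe_site(1)[OF R(2)] R(1) by (simp add: i_def pauli_strings_def)
      \<comment> \<open>Consistency implies \<tau> \<ge> 0 once some string of low weight exists; a
        single X is one because k \<ge> 1.\<close>
      let ?S = "(replicate n PI)[i := PX]"
      have "supp ?S = {i}" using i by (auto simp: supp_def nth_list_update split: if_splits)
      then have "?S \<in> low_weight k n" using k by (auto simp: low_weight_def pauli_strings_def)
      then show ?thesis using c(1) abs_ge_zero order_trans unfolding consistent_def by blast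
    qed
    ultimately show ?thesis by simp
  next
    case True
    show ?thesis
    proof (cases "card (supp P) \<le> k")
      case True
      have "T * cmod (l R - l' R) \<le> T * cmod (l P - l' P)" using max[OF R] T by simp
      with bound[OF True] show ?thesis by simp
    next
      case False
      then have "l P = 0" "l' P = 0" using l l' P by (auto simp: admissible_def k_local_def)
      then have "cmod (l R - l' R) = 0" using max[OF R] by simp
      moreover have "\<tau> \<ge> 0"
        using R True c(1) abs_ge_zero order_trans unfolding consistent_def low_weight_def by blast
      ultimately show ?thesis by simp
    qed
  qed
qed

text \<open>The tolerance is the value of \<tau> for which 2 * 4^k * \<tau> equals \<epsilon> T, so
  that the factor T of \<open>consistent_imp_close\<close> cancels.\<close>

lemma estimate_accurate:
  assumes l: "admissible k n g l" and c: "consistent k n T (\<epsilon> * T / (2 * 4 ^ k)) rs l"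
    and g: "g \<ge> 0" and k: "k \<ge> 1" and T: "T > 0" "2 * g * k * T \<le> 1 / 81" and \<epsilon>: "\<epsilon> > 0"
  shows "norm_inf n (\<lambda>P. estimate k n g T (\<epsilon> * T / (2 * 4 ^ k)) rs P - traceless_part n l P) \<le> \<epsilon>"
  unfolding norm_inf_le_iff
proof
  fix P assume P: "P \<in> pauli_strings n"
  define l' where "l' = (SOME l. admissible k n g l \<and> consistent k n T (\<epsilon> * T / (2 * 4 ^ k)) rs l)"
  have l': "admissible k n g l' \<and> consistent k n T (\<epsilon> * T / (2 * 4 ^ k)) rs l'"
    using someI[of "\<lambda>l. admissible k n g l \<and> consistent k n T (\<epsilon> * T / (2 * 4 ^ k)) rs l" l] l c
    by (simp add: l'_def)
  show "cmod (estimate k n g T (\<epsilon> * T / (2 * 4 ^ k)) rs P - traceless_part n l P) \<le> \<epsilon>"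
  proof (cases "supp P = {}")
    case True
    then show ?thesis using \<epsilon> supp_eq_empty_iff[OF P] by (simp add: estimate_def traceless_part_def)
  next
    case False
    have "T * cmod (l' P - l P) \<le> 2 * 4 ^ k * (\<epsilon> * T / (2 * 4 ^ k))"
      using l' l c g k T P False by (intro consistent_imp_close[of k n g _ _ T _ rs]) auto
    then have "T * cmod (l' P - l P) \<le> T * \<epsilon>" by (simp add: mult.commute)
    then have "cmod (l' P - l P) \<le> \<epsilon>" using T by simp
    then show ?thesis using False supp_eq_empty_iff[OF P] by (simp add: estimate_def traceless_part_def l'_def)
  qed
qed

lemma prob_consistent:
  assumes l: "purely_imaginary n l" and n: "n \<ge> 1" and \<tau>: "\<tau> > 0" and N: "N > 0"
    and \<delta>: "2 * real ((4 * n) ^ k) * exp (- (N * \<tau>\<^sup>2 / 2)) \<le> \<delta>"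
  shows "measure_pmf.prob (replicate_pmf N (outcome_pmf n (evolution (hamiltonian n l) T)))
    {rs. consistent k n T \<tau> rs l} \<ge> 1 - \<delta>"
proof -
  let ?D = "outcome_pmf n (evolution (hamiltonian n l) T)"
  let ?R = "measure_pmf.prob (replicate_pmf N ?D)"
  let ?E = "\<lambda>P. {rs. \<bar>(\<Sum>r\<leftarrow>rs. probe_statistic P r) / N - measure_pmf.expectation ?D (probe_statistic P)\<bar> \<ge> \<tau>}"
  have "?R (- {rs. consistent k n T \<tau> rs l}) \<le> ?R (\<Union>P\<in>low_weight k n. ?E P)"
  proof (rule measure_pmf.finite_measure_mono_AE)
    show "AE rs in replicate_pmf N ?D. rs \<in> - {rs. consistent k n T \<tau> rs l} \<longrightarrow> rs \<in> (\<Union>P\<in>low_weight k n. ?E P)"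
    proof (rule AE_pmfI, rule impI)
      fix rs assume "rs \<in> set_pmf (replicate_pmf N ?D)" and "rs \<in> - {rs. consistent k n T \<tau> rs l}"
      then have len: "length rs = N" and "\<not> consistent k n T \<tau> rs l"
        by (simp_all add: set_replicate_pmf)
      then obtain P where P: "P \<in> low_weight k n"
        and far: "\<not> \<bar>empirical_mean rs P - Re (probe_mean n l T P) / 4 ^ card (supp P)\<bar> \<le> \<tau>"
        unfolding consistent_def by blast
      have "rs \<in> ?E P"
        using far P by (simp add: empirical_mean_def len probe_statistic_expectation[OF l] low_weight_def)
      then show "rs \<in> (\<Union>P\<in>low_weight k n. ?E P)" using P by blast
    qed
  qed simp
  also have "\<dots> \<le> (\<Sum>P\<in>low_weight k n. ?R (?E P))"
    by (rule measure_UNION_le) auto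
  also have "\<dots> \<le> (\<Sum>P\<in>low_weight k n. 2 * exp (- (N * \<tau>\<^sup>2 / 2)))"
    by (intro sum_mono replicate_pmf_two_sided_tail abs_probe_statistic \<tau> N)
  also have "\<dots> = real (card (low_weight k n)) * (2 * exp (- (N * \<tau>\<^sup>2 / 2)))" by simp
  also have "\<dots> \<le> real ((4 * n) ^ k) * (2 * exp (- (N * \<tau>\<^sup>2 / 2)))"
    using low_weight_card[OF n, of k] by (intro mult_right_mono) (simp_all only: of_nat_le_iff, simp)
  also have "\<dots> \<le> \<delta>" using \<delta> by (simp add: mult_ac)
  finally have "?R (- {rs. consistent k n T \<tau> rs l}) \<le> \<delta>" .
  moreover have "?R (- {rs. consistent k n T \<tau> rs l}) = 1 - ?R {rs. consistent k n T \<tau> rs l}"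
    using measure_pmf.prob_compl[of "{rs. consistent k n T \<tau> rs l}" "replicate_pmf N ?D"] by (simp add: Compl_eq_Diff_UNIV)
  ultimately show ?thesis by linarith
qed

section \<open>Evolution time and sample size\<close>

lemma cmod_le_norm_B1:
  assumes "P \<in> pauli_strings n" "supp P \<noteq> {}"
  shows "cmod (l P) \<le> norm_B1 n l"
proof -
  obtain i where i: "i \<in> supp P" using assms by auto
  then have "cmod (l P) \<le> (\<Sum>P | P \<in> pauli_strings n \<and> i \<in> supp P. cmod (l P))"
    using assms by (intro member_le_sum) auto
  also have "\<dots> \<le> norm_B1 n l" using i assms by (intro sum_supp_le_norm_B1) (auto simp: supp_def pauli_strings_def)
  finally show ?thesis .
qed

text \<open>The largest multiple p t below c works: t < c gives p \<ge> 1, hence c / t < p + 1 \<le>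
  2 p.\<close>

lemma evolution_time_multiple:
  fixes t c :: real
  assumes "0 < t" "t < c"
  obtains m where "real (Suc m) * t \<le> c" "c / 2 \<le> real (Suc m) * t"
proof -
  define p where "p = nat \<lfloor>c / t\<rfloor>"
  have y: "1 < c / t" using assms by simp
  have p: "real p \<le> c / t" "c / t < real p + 1" using y unfolding p_def by linarith+
  have p1: "p \<ge> 1" using y unfolding p_def by linarith
  then obtain m where m: "p = Suc m" by (cases p) auto
  have "c / t \<le> 2 * real p" using p p1 by linarith
  then have "c / 2 \<le> real p * t" using assms by (simp add: divide_le_eq)
  moreover have "real p * t \<le> c" using p(1) assms by (simp add: le_divide_eq)
  ultimately show ?thesis using that m by blast
qed

text \<open>N is 2 A / \<tau>^2 rounded up, with A the logarithm required by the failure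
  probability. As \<tau> is proportional to \<epsilon> T, the product N T behaves like 1 /
  (\<epsilon>^2 T), and the lower bound on T makes this g / \<epsilon>^2. The summand 1 in the
  constant pays for the rounding.\<close>

lemma sample_size:
  fixes \<epsilon> \<delta> g T :: real and n k :: nat
  assumes n: "n \<ge> 1" and k: "k \<ge> 1" and \<epsilon>: "0 < \<epsilon>" "\<epsilon> < g" and \<delta>: "0 < \<delta>" "\<delta> < 1"
    and T: "1 / (324 * real k * g) \<le> T" "T \<le> 1 / (162 * real k * g)"
  obtains N :: nat where "N > 0" "2 * real ((4 * n) ^ k) * exp (- (N * (\<epsilon> * T / (2 * 4 ^ k))\<^sup>2 / 2)) \<le> \<delta>"
    "real N * T \<le> (32 * 324 * (real k)\<^sup>2 * 16 ^ k + 1) * (g * max 1 (ln (real n / \<delta>)) / \<epsilon>\<^sup>2)"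
proof -
  define L where "L = max 1 (ln (real n / \<delta>))"
  define \<tau> where "\<tau> = \<epsilon> * T / (2 * 4 ^ k)"
  define A where "A = ln (2 * real ((4 * n) ^ k) / \<delta>)"
  define N where "N = nat \<lceil>2 / \<tau>\<^sup>2 * A\<rceil>"
  have g: "g > 0" using \<epsilon> by simp
  have T0: "T > 0" using T(1) k g by (intro less_le_trans[OF _ T(1)]) auto
  have \<tau>: "\<tau> > 0" using \<epsilon> T0 by (simp add: \<tau>_def)
  have "1 \<le> (4 * n) ^ k" using n by (intro one_le_power) simp
  then have "real 1 \<le> real ((4 * n) ^ k)" by (simp only: of_nat_le_iff)
  then have M: "real ((4 * n) ^ k) \<ge> 1" by simp
  have A0: "A > 0" unfolding A_def using M \<delta> by (intro ln_gt_zero) (simp add: less_divide_eq)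
  have N: "N > 0" "2 / \<tau>\<^sup>2 * A \<le> N" "N \<le> 2 / \<tau>\<^sup>2 * A + 1"
  proof -
    have "2 / \<tau>\<^sup>2 * A > 0" using A0 \<tau> by simp
    then show "N > 0" "2 / \<tau>\<^sup>2 * A \<le> N" "N \<le> 2 / \<tau>\<^sup>2 * A + 1" unfolding N_def by linarith+
  qed
  have "A \<le> N * \<tau>\<^sup>2 / 2" using N(2) \<tau> by (simp add: field_simps)
  then have "exp (- (N * \<tau>\<^sup>2 / 2)) \<le> exp (- A)" by simp
  also have "exp (- A) = \<delta> / (2 * real ((4 * n) ^ k))" unfolding A_def using M \<delta> by (simp add: exp_minus inverse_eq_divide)
  finally have fail: "2 * real ((4 * n) ^ k) * exp (- (N * \<tau>\<^sup>2 / 2)) \<le> \<delta>"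
    using M by (simp add: le_divide_eq mult.commute)
  \<comment> \<open>A splits into ln 2, k (2 ln 2 + ln n) and ln (1 / \<delta>). Here ln 2 costs one
    k L and 2 k ln 2 two of them; the rest is at most k ln (n / \<delta>), the fourth.\<close>
  have AL: "A \<le> 4 * real k * L"
  proof -
    have "A = ln 2 + real k * ln (4 * real n) + ln (1 / \<delta>)"
      unfolding A_def using n \<delta> by (simp add: ln_mult ln_div ln_realpow distrib_left)
    also have "ln (4 * real n) = 2 * ln 2 + ln n"
      using n ln_realpow[of 2 2] by (simp add: ln_mult)
    also have "ln 2 + real k * (2 * ln 2 + ln n) + ln (1 / \<delta>) \<le> 1 + real k * (2 + ln n) + real k * ln (1 / \<delta>)"
    proof (intro add_mono mult_left_mono)
      show "ln (2 :: real) \<le> 1" "2 * ln (2 :: real) \<le> 2" using ln_le_minus_one[of 2] by simp_all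
      have "ln (1 / \<delta>) \<ge> 0" using \<delta> by (intro ln_ge_zero) simp
      then show "ln (1 / \<delta>) \<le> real k * ln (1 / \<delta>)" using k by (simp add: mult_le_cancel_right1)
    qed auto
    also have "\<dots> = 1 + 2 * real k + real k * ln (real n / \<delta>)" using n \<delta> by (simp add: ln_div algebra_simps)
    also have "\<dots> \<le> real k * L + 2 * (real k * L) + real k * L"
    proof (intro add_mono)
      have "1 * 1 \<le> real k * L" using k by (intro mult_mono) (auto simp: L_def)
      then show "1 \<le> real k * L" by simp
      have "real k * 1 \<le> real k * L" by (intro mult_left_mono) (auto simp: L_def)
      then show "2 * real k \<le> 2 * (real k * L)" by simp
      show "real k * ln (real n / \<delta>) \<le> real k * L" by (intro mult_left_mono) (auto simp: L_def)
    qed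
    finally show ?thesis by (simp add: mult_ac)
  qed
  have "real N * T \<le> (2 / \<tau>\<^sup>2 * A + 1) * T" using N(3) T0 by (intro mult_right_mono) auto
  also have "\<dots> = 2 / \<tau>\<^sup>2 * T * A + T" by (simp add: algebra_simps)
  also have "\<dots> \<le> 2 / \<tau>\<^sup>2 * T * (4 * real k * L) + T" using AL T0 by (intro add_mono mult_left_mono) auto
  \<comment> \<open>Since \<tau>^2 = \<epsilon>^2 T^2 / (4 * 16^k), the prefactor is 8 * 16^k; with
    324 k g for 1 / T and 4 k L for A it becomes the constant of the claim.\<close>
  also have "2 / \<tau>\<^sup>2 * T = 8 * 16 ^ k / \<epsilon>\<^sup>2 * (1 / T)"
  proof -
    define w :: real where "w = 16 ^ k"
    have "(4 ^ k)\<^sup>2 = w" by (simp add: w_def power2_eq_square power_mult_distrib[symmetric])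
    then have "\<tau>\<^sup>2 = \<epsilon>\<^sup>2 * T\<^sup>2 / (4 * w)" by (simp add: \<tau>_def power_mult_distrib power_divide)
    moreover have "w > 0" by (simp add: w_def)
    ultimately have "2 / \<tau>\<^sup>2 * T = 8 * w / \<epsilon>\<^sup>2 * (1 / T)"
      using T0 \<epsilon>(1) by (simp add: power2_eq_square)
    then show ?thesis by (simp add: w_def)
  qed
  also have "8 * 16 ^ k / \<epsilon>\<^sup>2 * (1 / T) * (4 * real k * L) \<le> 8 * 16 ^ k / \<epsilon>\<^sup>2 * (324 * real k * g) * (4 * real k * L)"
  proof (intro mult_right_mono mult_left_mono)
    show "1 / T \<le> 324 * real k * g" using T(1) T0 k g by (simp add: field_simps)
  qed (auto simp: L_def)
  also have "\<dots> = 32 * 324 * (real k)\<^sup>2 * 16 ^ k * (g * L / \<epsilon>\<^sup>2)" by (simp add: power2_eq_square field_simps)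
  \<comment> \<open>Rounding N up costs one more T, which is at most 1 / g; this is below g /
    \<epsilon>^2 because \<epsilon> < g.\<close>
  also have "T \<le> g * L / \<epsilon>\<^sup>2"
  proof -
    have "T \<le> 1 / (162 * real k * g)" by (rule T(2))
    also have "\<dots> \<le> 1 / g"
    proof -
      have "1 * g \<le> 162 * real k * g" using k g by (intro mult_right_mono) auto
      then show ?thesis using g by (intro frac_le) auto
    qed
    also have "\<dots> = g / g\<^sup>2" using g by (simp add: power2_eq_square)
    also have "\<dots> \<le> g / \<epsilon>\<^sup>2" using \<epsilon> g by (intro divide_left_mono power_mono) auto
    also have "\<dots> \<le> g * L / \<epsilon>\<^sup>2" using g by (intro divide_right_mono) (auto simp: L_def mult_le_cancel_left1)
    finally show ?thesis .
  qed
  finally have time: "real N * T \<le> (32 * 324 * (real k)\<^sup>2 * 16 ^ k + 1) * (g * L / \<epsilon>\<^sup>2)"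
    by (simp add: distrib_right add_divide_distrib)
  show ?thesis using that N(1) fail time unfolding \<tau>_def L_def by blast
qed

text \<open>C is chosen before n, g, \<epsilon>, \<delta> and t, hence depends on k alone, and the
  algorithm is chosen before the coefficients. The maximum with 1 keeps the bound meaningful where
  ln (n / \<delta>) is small or negative.\<close>

theorem theorem5p13:
  fixes k :: nat
  assumes "k \<ge> 1"
  shows "\<exists>C::real. C > 0 \<and>
    (\<forall>(n::nat) (g::real) (\<epsilon>::real) (\<delta>::real) (t::real).
      n \<ge> 1 \<longrightarrow> g > 0 \<longrightarrow> \<epsilon> > 0 \<longrightarrow> \<delta> > 0 \<longrightarrow>
      0 < t \<longrightarrow> t < 1 / (162 * real k * g) \<longrightarrow>
      (\<exists>(a::nat) (A :: (pauli list \<Rightarrow> complex) qalg).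
        legal (2 ^ (n + a)) A \<and>
        evolution_times (2 ^ (n + a)) A \<subseteq> {t} \<and>
        total_time (2 ^ (n + a)) A \<le> C * (g * max 1 (ln (real n / \<delta>)) / \<epsilon>\<^sup>2) \<and>
        (\<forall>l :: pauli list \<Rightarrow> complex.
          purely_imaginary n l \<longrightarrow> k_local k n l \<longrightarrow> norm_B1 n l \<le> g \<longrightarrow> norm_inf n l \<le> 1 \<longrightarrow>
          measure_pmf.prob (result n a (hamiltonian n l) A)
            {est. norm_inf n (\<lambda>P. est P - traceless_part n l P) \<le> \<epsilon>} \<ge> 1 - \<delta>)))"
proof (intro exI[of _ "32 * 324 * (real k)\<^sup>2 * 16 ^ k + 1"] conjI allI impI)
  show C: "0 < 32 * 324 * (real k)\<^sup>2 * 16 ^ k + (1 :: real)" by (simp add: add_nonneg_pos)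
  fix n :: nat and g \<epsilon> \<delta> t :: real
  assume n: "n \<ge> 1" and g: "g > 0" and \<epsilon>: "\<epsilon> > 0" and \<delta>: "\<delta> > 0" and t: "0 < t" "t < 1 / (162 * real k * g)"
  let ?C = "32 * 324 * (real k)\<^sup>2 * 16 ^ k + (1 :: real)"
  let ?accurate = "\<lambda>l est. norm_inf n (\<lambda>P. est P - traceless_part n l P) \<le> \<epsilon>"
  show "\<exists>a A. legal (2 ^ (n + a)) A \<and> evolution_times (2 ^ (n + a)) A \<subseteq> {t} \<and>
      total_time (2 ^ (n + a)) A \<le> ?C * (g * max 1 (ln (real n / \<delta>)) / \<epsilon>\<^sup>2) \<and>
      (\<forall>l. purely_imaginary n l \<longrightarrow> k_local k n l \<longrightarrow> norm_B1 n l \<le> g \<longrightarrow> norm_inf n l \<le> 1 \<longrightarrow>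
          measure_pmf.prob (result n a (hamiltonian n l) A) {est. ?accurate l est} \<ge> 1 - \<delta>)"
  proof (cases "g \<le> \<epsilon> \<or> 1 \<le> \<delta>")
    case True
    \<comment> \<open>The zero family is returned without any experiment: for g \<le> \<epsilon>
      every nonidentity coefficient is at most g, and for \<delta> \<ge> 1 nothing is claimed.
      Afterwards \<open>sample_size\<close> may assume \<epsilon> < g and \<delta> < 1.\<close>
    have "1 - \<delta> \<le> measure_pmf.prob (result n 0 (hamiltonian n l) (Output (\<lambda>_. 0))) {est. ?accurate l est}"
      if B1: "norm_B1 n l \<le> g" for l
      using True
    proof
      assume "g \<le> \<epsilon>"
      have "?accurate l (\<lambda>_. 0)"
        unfolding norm_inf_le_iff
      proof
        fix P assume P: "P \<in> pauli_strings n"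
        show "cmod (0 - traceless_part n l P) \<le> \<epsilon>"
          using \<epsilon> \<open>g \<le> \<epsilon>\<close> B1 cmod_le_norm_B1[OF P, of l] supp_eq_empty_iff[OF P]
          by (auto simp: traceless_part_def)
      qed
      then show ?thesis using \<delta> by (simp add: result_def indicator_def)
    next
      assume "1 \<le> \<delta>"
      then show ?thesis using measure_nonneg by (rule_tac order_trans[of _ 0]) auto
    qed
    then show ?thesis using C g \<epsilon>
      by (intro exI[of _ 0] exI[of _ "Output (\<lambda>_. 0)"]) auto
  next
    case False
    obtain m where m: "real (Suc m) * t \<le> 1 / (162 * real k * g)" "1 / (162 * real k * g) / 2 \<le> real (Suc m) * t"
      using evolution_time_multiple[OF t] .
    define T where "T = real (Suc m) * t"
    have T: "1 / (324 * real k * g) \<le> T" "T \<le> 1 / (162 * real k * g)" "T > 0" using m t by (auto simp: T_def)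
    \<comment> \<open>This is where 162 enters: 2 g k / (162 k g) = 1/81, the ratio that
      \<open>probe_mean_separates\<close> tolerates.\<close>
    have gT: "2 * g * k * T \<le> 1 / 81" using T(2) assms g by (simp add: field_simps)
    obtain N :: nat where N: "N > 0" "2 * real ((4 * n) ^ k) * exp (- (N * (\<epsilon> * T / (2 * 4 ^ k))\<^sup>2 / 2)) \<le> \<delta>"
      "N * T \<le> ?C * (g * max 1 (ln (n / \<delta>)) / \<epsilon>\<^sup>2)"
      by (rule sample_size[OF n assms \<epsilon> _ \<delta> _ T(1,2)]) (use False in auto)
    let ?\<tau> = "\<epsilon> * T / (2 * 4 ^ k)"
    define A where "A = trials n (Suc m) t N (estimate k n g T ?\<tau>)"
    have "1 - \<delta> \<le> measure_pmf.prob (result n 0 (hamiltonian n l) A) {est. ?accurate l est}"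
      if l: "purely_imaginary n l" "k_local k n l" "norm_B1 n l \<le> g" for l
    proof -
      let ?R = "replicate_pmf N (outcome_pmf n (evolution (hamiltonian n l) T))"
      have "1 - \<delta> \<le> measure_pmf.prob ?R {rs. consistent k n T ?\<tau> rs l}"
        using \<epsilon> T(3) N by (intro prob_consistent[OF l(1) n]) auto
      also have "\<dots> \<le> measure_pmf.prob ?R (estimate k n g T ?\<tau> -` {est. ?accurate l est})"
        using estimate_accurate[of k n g l T \<epsilon>] l g assms T(3) gT \<epsilon>
        by (intro measure_pmf.finite_measure_mono) (auto simp: admissible_def)
      also have "\<dots> = measure_pmf.prob (result n 0 (hamiltonian n l) A) {est. ?accurate l est}"
        unfolding result_def A_def T_def add_0_right
        by (subst run_trials[OF hamiltonian_carrier hamiltonian_hermitian[OF l(1)]]) simp_all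
      finally show ?thesis .
    qed
    moreover have "legal (2 ^ (n + 0)) A" "evolution_times (2 ^ (n + 0)) A \<subseteq> {t}" "total_time (2 ^ (n + 0)) A = N * T"
      unfolding A_def add_0_right trials_resources(2)[OF t(1)]
      by (rule trials_resources[OF t(1)], rule trials_resources[OF t(1)], simp only: T_def)
    ultimately show ?thesis using N(3) by (intro exI[of _ 0] exI[of _ A]) auto
  qed
qed

end
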